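(* Let $Z=(X,Y)\in\Omega$ satisfy $X_i(\mathbf 0)Y_i(\mathbf 0)<0$ for $i=1,2$ and $\det Z(\mathbf 0)=(X_1Y_2-X_2Y_1)(\mathbf 0)\neq0$. Put $a=\operatorname{sgn}(X_1(\mathbf 0))$, $b=\operatorname{sgn}(X_2(\mathbf 0))$, $c=\operatorname{sgn}(\det Z(\mathbf 0))$, and let $\delta_{m,n}$ denote the Kronecker delta. Then $Z$ is locally $\Sigma$-equivalent to the piecewise smooth system $$\tilde Z(p)=\begin{cases}\big((\delta_{-1,ab}\,\delta_{1,c}+1)\,a,\;-(\delta_{-1,ab}\,\delta_{-1,c}-ab)\,a\big), & p\in\mathcal U^+,\\[2pt] \big(-(\delta_{1,ab}\,\delta_{1,c}+1)\,a,\;-(\delta_{1,ab}\,\delta_{-1,c}+ab)\,a\big), & p\in\mathcal U^-.\end{cases}$$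
   Context: Setting. Fix $r\ge 1$ and a bounded open neighborhood $\mathcal U$ of the origin $\mathbf 0$ in $\mathbb R^2$. Let $\Sigma=\{(x_1,x_2)\in\mathcal U: x_1x_2=0\}$, $\mathcal U^+=\{x_1x_2>0\}$, $\mathcal U^-=\{x_1x_2<0\}$. Write $\Sigma=\Sigma_1\cup\Sigma_2$ with $\Sigma_1=\{x_1=0\}$, $\Sigma_2=\{x_2=0\}$; $\Sigma_1^{\pm}=\{(0,x_2):\pm x_2>0\}$ and $\Sigma_2^{\pm}=\{(x_1,0):\pm x_1>0\}$. $\Omega$ is the set of piecewise smooth vector fields $Z=(X,Y)$, where $X=(X_1,X_2)$, $Y=(Y_1,Y_2)$ are $C^r$ vector fields on $\overline{\mathcal U}$, with $Z=X$ on $\mathcal U^+$ and $Z=Y$ on $\mathcal U^-$. Regions of $\Sigma$. For $i=1,2$: crossing region $\Sigma_i^c=\{p\in\Sigma_i: X_iY_i(p)>0\}$; sliding region $\Sigma_i^s=\{p\in\Sigma_i^+:X_i(p)<0,Y_i(p)>0\}\cup\{p\in\Sigma_i^-:X_i(p)>0,Y_i(p)<0\}$; escaping region $\Sigma_i^e=\{p\in\Sigma_i^+:X_i(p)>0,Y_i(p)<0\}\cup\{p\in\Sigma_i^-:X_i(p)<0,Y_i(p)>0\}$. $\Sigma^{c},\Sigma^s,\Sigma^e$ are the unions over $i=1,2$. On $\Sigma_i^{s}\cup\Sigma_i^e$ the sliding vector field is the one-dimensional vector field $Z_i^s=\dfrac{Y_iX_j-X_iY_j}{Y_i-X_i}\Big|_{\Sigma_i}$,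 $j\neq i$. Trajectories of $Z$. For $p\neq\mathbf 0$: if $p\in\mathcal U^{+}$ (resp. $\mathcal U^-$) follow the trajectory of $X$ (resp. $Y$), where trajectories meeting $\Sigma^s\cup\Sigma^e$ transversally are regarded as relatively open (they do not reach $\Sigma^s\cup\Sigma^e$ in finite time); if $p\in\Sigma^c$ concatenate the trajectories of $X$ and $Y$ through $p$; if $p\in\Sigma_i^s\cup\Sigma_i^e$ follow the trajectory of $Z_i^s$; if $p\in\partial\Sigma_i^e\cup\partial\Sigma_i^s\cup\partial\Sigma_i^c$ and the one-sided limits $\lim_{q\to p^\pm}\varphi_Z(t;q)$ along $\Sigma_i$ coincide, the trajectory is this limit; for other such boundary points it is $\{p\}$. For $\mathbf 0$: if $\Sigma=\overline{\Sigma^c}$, it is the unique trajectory of $X$ or $Y$ that crosses the origin; if $\mathbf 0\in\overline{\Sigma_i^e\cup\Sigma_i^s}\cap\overline{\Sigma_j^c}$, $i\ne j$, it is the trajectory of $Z_i^s$; if $\mathbf 0\in\bigcap_{i=1,2}\overline{\Sigma_i^e\cup\Sigma_i^s}$, it is $\{\mathbf 0\}$. Equivalence. $Z,\tilde Z\in\Omega$ are locally $\Sigma$-equivalent if there are neighborhoods $\mathcal U_0,\tilde{\mathcal U}_0$ of the origin and an orientation preserving homeomorphism $h:\mathcal U_0\to\tilde{\mathcal U}_0$ mapping trajectories of $Z$ to trajectories of $\tilde Z$ and $\Sigma$ to $\Sigma$. *)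

theory Defs
  imports "HOL-Complex_Analysis.Complex_Analysis"
begin

type_synonym plane = "real^2"
type_synonym field = "plane \<Rightarrow> plane"

text \<open>For an open set \<open>S\<close>: all iterated directional derivatives of \<open>f\<close> up to order \<open>k\<close> exist
  and are continuous on \<open>S\<close>.\<close>

primrec Ck_on :: "nat \<Rightarrow> field \<Rightarrow> plane set \<Rightarrow> bool" where
  "Ck_on 0 f S \<longleftrightarrow> continuous_on S f"
| "Ck_on (Suc k) f S \<longleftrightarrow>
     (\<forall>p\<in>S. f differentiable (at p)) \<and>
     (\<forall>v. Ck_on k (\<lambda>p. frechet_derivative f (at p) v) S)"

text \<open>Being of class $C^r$ on a closed set means being the restriction of a $C^r$ map defined on
  an open neighbourhood of it. Only the values of the fields on the closure of \<open>U\<close> matter.\<close>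

definition Ck_on_closed :: "nat \<Rightarrow> field \<Rightarrow> plane set \<Rightarrow> bool" where
  "Ck_on_closed r f K \<longleftrightarrow>
     (\<exists>W g. open W \<and> K \<subseteq> W \<and> Ck_on r g W \<and> (\<forall>p\<in>K. g p = f p))"

text \<open>An element \<open>(X, Y)\<close> is the field equal to \<open>X\<close> on \<open>U_plus U\<close> and to \<open>Y\<close> on \<open>U_minus U\<close>.\<close>

type_synonym pw_field = "field \<times> field"

definition Omega :: "nat \<Rightarrow> plane set \<Rightarrow> pw_field set" where
  "Omega r U = {(X, Y). Ck_on_closed r X (closure U) \<and> Ck_on_closed r Y (closure U)}"

definition det_pw :: "pw_field \<Rightarrow> plane \<Rightarrow> real" where
  "det_pw Z p = fst Z p $ 1 * snd Z p $ 2 - fst Z p $ 2 * snd Z p $ 1"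

text \<open>The set \<open>D\<close> is the domain under consideration: the given neighbourhood of the origin, or a
  smaller one to which the piecewise smooth field is restricted.\<close>

definition U_plus :: "plane set \<Rightarrow> plane set" where
  "U_plus D = {p \<in> D. p $ 1 * p $ 2 > 0}"

definition U_minus :: "plane set \<Rightarrow> plane set" where
  "U_minus D = {p \<in> D. p $ 1 * p $ 2 < 0}"

definition Sigma_set :: "plane set \<Rightarrow> plane set" where
  "Sigma_set D = {p \<in> D. p $ 1 * p $ 2 = 0}"

definition Sigma_i :: "2 \<Rightarrow> plane set \<Rightarrow> plane set" where
  "Sigma_i i D = {p \<in> D. p $ i = 0}"

definition other :: "2 \<Rightarrow> 2" where
  "other i = (if i = 1 then 2 else 1)"

definition Sigma_i_pos :: "2 \<Rightarrow> plane set \<Rightarrow> plane set" where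
  "Sigma_i_pos i D = {p \<in> Sigma_i i D. p $ other i > 0}"

definition Sigma_i_neg :: "2 \<Rightarrow> plane set \<Rightarrow> plane set" where
  "Sigma_i_neg i D = {p \<in> Sigma_i i D. p $ other i < 0}"

definition crossing :: "pw_field \<Rightarrow> 2 \<Rightarrow> plane set \<Rightarrow> plane set" where
  "crossing Z i D = {p \<in> Sigma_i i D. fst Z p $ i * snd Z p $ i > 0}"

definition sliding :: "pw_field \<Rightarrow> 2 \<Rightarrow> plane set \<Rightarrow> plane set" where
  "sliding Z i D =
     {p \<in> Sigma_i_pos i D. fst Z p $ i < 0 \<and> snd Z p $ i > 0} \<union>
     {p \<in> Sigma_i_neg i D. fst Z p $ i > 0 \<and> snd Z p $ i < 0}"

definition escaping :: "pw_field \<Rightarrow> 2 \<Rightarrow> plane set \<Rightarrow> plane set" where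
  "escaping Z i D =
     {p \<in> Sigma_i_pos i D. fst Z p $ i > 0 \<and> snd Z p $ i < 0} \<union>
     {p \<in> Sigma_i_neg i D. fst Z p $ i < 0 \<and> snd Z p $ i > 0}"

text \<open>The one-dimensional sliding field, regarded as a planar field tangent to the \<open>i\<close>-th axis
  \<open>Sigma_i i D\<close>.\<close>

definition sliding_field :: "pw_field \<Rightarrow> 2 \<Rightarrow> field" where
  "sliding_field Z i p = axis (other i)
     ((snd Z p $ i * fst Z p $ other i - fst Z p $ i * snd Z p $ other i) /
      (snd Z p $ i - fst Z p $ i))"

definition integral_curve_on :: "field \<Rightarrow> real set \<Rightarrow> (real \<Rightarrow> plane) \<Rightarrow> bool" where
  "integral_curve_on V J \<gamma> \<longleftrightarrow> (\<forall>s\<in>J. (\<gamma> has_vector_derivative V (\<gamma> s)) (at s within J))"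

definition crosses_at :: "pw_field \<Rightarrow> plane set \<Rightarrow> (real \<Rightarrow> plane) \<Rightarrow> real \<Rightarrow> bool" where
  "crosses_at Z D \<gamma> t \<longleftrightarrow> (\<exists>\<epsilon>>0.
     integral_curve_on (fst Z) {t-\<epsilon>..t} \<gamma> \<and> \<gamma> ` {t-\<epsilon>..<t} \<subseteq> U_plus D \<and>
     integral_curve_on (snd Z) {t..t+\<epsilon>} \<gamma> \<and> \<gamma> ` {t<..t+\<epsilon>} \<subseteq> U_minus D
   \<or>
     integral_curve_on (snd Z) {t-\<epsilon>..t} \<gamma> \<and> \<gamma> ` {t-\<epsilon>..<t} \<subseteq> U_minus D \<and>
     integral_curve_on (fst Z) {t..t+\<epsilon>} \<gamma> \<and> \<gamma> ` {t<..t+\<epsilon>} \<subseteq> U_plus D)"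

definition slides_at :: "pw_field \<Rightarrow> 2 \<Rightarrow> plane set \<Rightarrow> (real \<Rightarrow> plane) \<Rightarrow> real \<Rightarrow> bool" where
  "slides_at Z i S \<gamma> t \<longleftrightarrow> (\<exists>\<epsilon>>0.
     integral_curve_on (sliding_field Z i) {t-\<epsilon><..<t+\<epsilon>} \<gamma> \<and> \<gamma> ` {t-\<epsilon><..<t+\<epsilon>} \<subseteq> S)"

text \<open>The rule at the origin. There are three cases: all of \<open>Sigma_set D\<close> is the closure of the
  crossing region; the origin is in the closure of the sliding and escaping regions of both axes
  (then no curve passes through it, so that its trajectory will be the singleton below); the origin
  is in the closure of the sliding and escaping regions of one axis and of the crossing region of
  the other one. If the last two conditions overlap, the second case takes precedence.\<close>

definition passes_origin_at :: "pw_field \<Rightarrow> plane set \<Rightarrow> (real \<Rightarrow> plane) \<Rightarrow> real \<Rightarrow> bool" where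
  "passes_origin_at Z D \<gamma> t \<longleftrightarrow>
     (if Sigma_set D \<subseteq> closure (\<Union>i. crossing Z i D) then
        (\<exists>\<epsilon>>0.
           integral_curve_on (fst Z) {t-\<epsilon><..<t+\<epsilon>} \<gamma> \<and> \<gamma> ` ({t-\<epsilon><..<t+\<epsilon>} - {t}) \<subseteq> U_plus D
         \<or> integral_curve_on (snd Z) {t-\<epsilon><..<t+\<epsilon>} \<gamma> \<and> \<gamma> ` ({t-\<epsilon><..<t+\<epsilon>} - {t}) \<subseteq> U_minus D)
      else if \<forall>i. 0 \<in> closure (sliding Z i D \<union> escaping Z i D) then False
      else
        (\<exists>i. 0 \<in> closure (sliding Z i D \<union> escaping Z i D) \<and>
             0 \<in> closure (crossing Z (other i) D) \<and>
             slides_at Z i (insert 0 (sliding Z i D \<union> escaping Z i D)) \<gamma> t))"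

text \<open>The rules at all points except the boundary points of the regions.\<close>

definition regular_at :: "pw_field \<Rightarrow> plane set \<Rightarrow> (real \<Rightarrow> plane) \<Rightarrow> real \<Rightarrow> bool" where
  "regular_at Z D \<gamma> t \<longleftrightarrow>
     \<gamma> t \<in> U_plus D \<and> (\<gamma> has_vector_derivative fst Z (\<gamma> t)) (at t)
   \<or> \<gamma> t \<in> U_minus D \<and> (\<gamma> has_vector_derivative snd Z (\<gamma> t)) (at t)
   \<or> \<gamma> t \<in> (\<Union>i. crossing Z i D) - {0} \<and> crosses_at Z D \<gamma> t
   \<or> (\<exists>i. \<gamma> t \<in> sliding Z i D \<union> escaping Z i D \<and>
          slides_at Z i (sliding Z i D \<union> escaping Z i D) \<gamma> t)
   \<or> \<gamma> t = 0 \<and> 0 \<in> D \<and> passes_origin_at Z D \<gamma> t"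

text \<open>The regions are pairwise disjoint and, for continuous fields, relatively open in
  \<open>Sigma_i i D\<close> away from the origin. So, away from the origin, the union of their relative boundaries
  consists of the points of \<open>Sigma_i i D\<close> in the closure of their union but not in the union itself.\<close>

definition boundary_pts :: "pw_field \<Rightarrow> 2 \<Rightarrow> plane set \<Rightarrow> plane set" where
  "boundary_pts Z i D =
     (let R = crossing Z i D \<union> sliding Z i D \<union> escaping Z i D
      in (Sigma_i i D \<inter> closure R) - R - {0})"

text \<open>\<open>Z_curve Z D I \<gamma>\<close>: the curve \<open>\<gamma>\<close> on the open interval \<open>I\<close> obeys the rules at each of its
  points. As \<open>I\<close> is open, and near a sliding or escaping point only curves inside the sliding and
  escaping regions obey the rules, a curve inside \<open>U_plus D\<close> or \<open>U_minus D\<close> does not reach these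
  regions.

  At a boundary point \<open>p = \<gamma> t\<close> the curve must be the limit of the trajectories \<open>\<phi> q\<close> through the
  points \<open>q\<close> of \<open>Sigma_i i D\<close> tending to \<open>p\<close>; the limit within \<open>Sigma_i i D\<close> exists iff the two
  one-sided limits exist and coincide. The trajectories \<open>\<phi> q\<close> may pass through boundary points
  again (for instance, through \<open>p\<close> itself if they slide across \<open>p\<close>), hence the definition is
  coinductive.\<close>

coinductive Z_curve :: "pw_field \<Rightarrow> plane set \<Rightarrow> real set \<Rightarrow> (real \<Rightarrow> plane) \<Rightarrow> bool"
  for Z :: pw_field and D :: "plane set" where
  "\<lbrakk> open I; connected I; I \<noteq> {}; continuous_on I \<gamma>; \<gamma> ` I \<subseteq> D;
     \<forall>t\<in>I. regular_at Z D \<gamma> t \<or>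
       (\<exists>i. \<gamma> t \<in> boundary_pts Z i D \<and>
         (\<exists>\<epsilon>>0. \<exists>\<phi>. {t-\<epsilon><..<t+\<epsilon>} \<subseteq> I \<and>
            (\<exists>d>0. \<forall>q\<in>Sigma_i i D. q \<noteq> \<gamma> t \<and> dist q (\<gamma> t) < d \<longrightarrow>
                \<phi> q 0 = q \<and> Z_curve Z D {-\<epsilon><..<\<epsilon>} (\<phi> q)) \<and>
            (\<forall>s\<in>{-\<epsilon><..<\<epsilon>}.
                ((\<lambda>q. \<phi> q s) \<longlongrightarrow> \<gamma> (t + s)) (at (\<gamma> t) within Sigma_i i D)))) \<rbrakk>
   \<Longrightarrow> Z_curve Z D I \<gamma>"

text \<open>The trajectories of \<open>Z\<close> restricted to \<open>D\<close>: the maximal curves, and the singletons \<open>{p}\<close>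
  (constant curves, on \<open>UNIV\<close>) for the points through which no curve passes.\<close>

definition trajectory :: "pw_field \<Rightarrow> plane set \<Rightarrow> real set \<Rightarrow> (real \<Rightarrow> plane) \<Rightarrow> bool" where
  "trajectory Z D I \<gamma> \<longleftrightarrow>
     (Z_curve Z D I \<gamma> \<and>
      (\<forall>J \<eta>. Z_curve Z D J \<eta> \<and> I \<subseteq> J \<and> (\<forall>t\<in>I. \<eta> t = \<gamma> t) \<longrightarrow> J = I))
   \<or> (I = UNIV \<and>
      (\<exists>p\<in>D. \<gamma> = (\<lambda>_. p) \<and> \<not> (\<exists>J \<eta>. Z_curve Z D J \<eta> \<and> p \<in> \<eta> ` J)))"

definition to_complex :: "plane \<Rightarrow> complex" where
  "to_complex p = Complex (p $ 1) (p $ 2)"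

definition of_complex :: "complex \<Rightarrow> plane" where
  "of_complex z = vector [Re z, Im z]"

text \<open>For \<open>h\<close> a homeomorphism between open subsets of the plane: its local degree is 1 at each point,
  that is, the image of a positively oriented circle around \<open>p\<close> winds once, in the positive sense,
  around \<open>h p\<close>.\<close>

definition orientation_preserving_on :: "plane set \<Rightarrow> (plane \<Rightarrow> plane) \<Rightarrow> bool" where
  "orientation_preserving_on S h \<longleftrightarrow>
     (\<forall>p\<in>S. \<forall>\<rho>>0. cball p \<rho> \<subseteq> S \<longrightarrow>
        winding_number (to_complex \<circ> h \<circ> of_complex \<circ> circlepath (to_complex p) \<rho>)
          (to_complex (h p)) = 1)"

text \<open>The image of a trajectory is a trajectory, with the same sense of time and up to
  reparametrization. The reparametrization \<open>\<tau>\<close> is an increasing bijection between intervals, hence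
  a homeomorphism.\<close>

definition maps_trajectories ::
  "(plane \<Rightarrow> plane) \<Rightarrow> pw_field \<Rightarrow> plane set \<Rightarrow> pw_field \<Rightarrow> plane set \<Rightarrow> bool" where
  "maps_trajectories h Z D Z' D' \<longleftrightarrow>
     (\<forall>I \<gamma>. trajectory Z D I \<gamma> \<longrightarrow>
        (\<exists>J \<eta> \<tau>. trajectory Z' D' J \<eta> \<and> strict_mono_on I \<tau> \<and> \<tau> ` I = J \<and>
           (\<forall>t\<in>I. h (\<gamma> t) = \<eta> (\<tau> t))))"

definition locally_Sigma_equivalent ::
  "nat \<Rightarrow> plane set \<Rightarrow> pw_field \<Rightarrow> pw_field \<Rightarrow> bool" where
  "locally_Sigma_equivalent r U Z Z' \<longleftrightarrow>
     Z \<in> Omega r U \<and> Z' \<in> Omega r U \<and>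
     (\<exists>U0 U0' h k. open U0 \<and> 0 \<in> U0 \<and> U0 \<subseteq> U \<and> open U0' \<and> 0 \<in> U0' \<and> U0' \<subseteq> U \<and>
        homeomorphism U0 U0' h k \<and> orientation_preserving_on U0 h \<and>
        maps_trajectories h Z U0 Z' U0' \<and>
        h ` Sigma_set U0 = Sigma_set U0')"

definition kronecker :: "real \<Rightarrow> real \<Rightarrow> real" where
  "kronecker m n = (if m = n then 1 else 0)"

end

theory Submission
  imports Defs
begin

text \<open>Near the origin both fields have nonzero components, and at each axis the normal components of \<open>X\<close>
  and \<open>Y\<close> have opposite signs. So there are no crossing points: each open half axis consists of
  sliding points or of escaping points, no curve passes through the origin, and a curve never leaves
  the open quadrant or the open half axis in which it starts (\<open>Z_curve_iff_cell_curve\<close>). An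
  equivalence therefore has to carry orbits to orbits, with their sense, in each of these eight
  cells, and to be continuous across the axes.

  On a half axis the sliding field has no zero, and its sign depends only on the signs of the
  determinant and of the normal component of \<open>Y\<close> (\<open>sgn_sliding_field\<close>). The half axis is thus a
  single orbit, and any increasing map between the half axes of two systems with the same signs
  matches the orbits (\<open>half_axis_orbits_matched\<close>).

  In an open quadrant the orbits are graphs of monotone functions. The sign \<open>\<epsilon>\<close> of the slope is the
  same in all four quadrants, since both components change sign between \<open>X\<close> and \<open>Y\<close>. In the two
  quadrants with \<open>\<epsilon> * x * y < 0\<close> the full leaves join the two half axes that bound the quadrant, so
  the restriction of the equivalence to one of these half axes determines its restriction to the
  other. In the two quadrants with \<open>\<epsilon> * x * y > 0\<close> each leaf meets at most one of the two half axes,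
  and the values on both can be prescribed. As each half axis bounds one quadrant of either kind, no
  cyclic condition arises. The equivalence has the form \<open>h (x, y) = (H x y, y)\<close> with \<open>H\<close> increasing
  in \<open>x\<close>. It is the identity on the vertical axis, the quadrants of the first kind then fix it on the
  horizontal axis, and in the quadrants of the second kind the leaves are relabelled by an increasing
  function to fit both axes (\<open>transversal_coordinate\<close>). Since \<open>h\<close> keeps the second coordinate, which
  is monotone along orbits, it keeps their sense (\<open>quadrant_orbits_matched\<close>). Since it moves points
  only along horizontal lines, it preserves the orientation
  (\<open>horizontal_shear_orientation_preserving\<close>).

  The leaves come from a scalar differential equation for \<open>y\<close> as a function of \<open>x\<close>, solved by a
  contraction argument whose unknown depends on \<open>x\<close> and on the height at which the leaf meets the
  vertical axis (\<open>picard_fixed_point\<close>). Time is reintroduced along each leaf by integrating the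
  reciprocal of the speed (\<open>complete_orbit_of_arc\<close>).\<close>

text \<open>The symbol \<open>$\<close> stands for components of vectors only.\<close>

no_notation fps_nth (infixl "$" 75)

section \<open>Curves confined to quadrants and half axes\<close>

text \<open>The condition is imposed on all of \<open>D\<close>, not only on the axes. Near the origin this follows by
  continuity from its validity at the origin.\<close>

definition opposed :: "pw_field \<Rightarrow> plane set \<Rightarrow> bool" where
  "opposed Z D \<longleftrightarrow> open D \<and> 0 \<in> D \<and> (\<forall>p\<in>D. \<forall>i. fst Z p $ i * snd Z p $ i < 0)"

text \<open>The field that governs a curve in the cell of \<open>p\<close>, the cells being the four open quadrants and the
  four open half axes.\<close>

definition cell_field :: "pw_field \<Rightarrow> field" where
  "cell_field Z p =
     (if p $ 1 = 0 then sliding_field Z 1 p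
      else if p $ 2 = 0 then sliding_field Z 2 p
      else if p $ 1 * p $ 2 > 0 then fst Z p else snd Z p)"

lemma other_simps [simp]: "other 1 = 2" "other 2 = 1"
  by (auto simp: other_def)

lemma plane_eq_0_iff: "(p::plane) = 0 \<longleftrightarrow> p $ 1 = 0 \<and> p $ 2 = 0"
  by (auto simp: vec_eq_iff forall_2)

lemma opposed_sliding_escaping:
  assumes "opposed Z D"
  shows "sliding Z i D \<union> escaping Z i D = {p \<in> D. p $ i = 0 \<and> p $ other i \<noteq> 0}"
proof -
  have "fst Z p $ i < 0 \<and> snd Z p $ i > 0 \<or> fst Z p $ i > 0 \<and> snd Z p $ i < 0" if "p \<in> D" for p
    using assms that by (auto simp: opposed_def mult_less_0_iff)
  then show ?thesis
    by (force simp: sliding_def escaping_def Sigma_i_pos_def Sigma_i_neg_def Sigma_i_def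
        neq_iff)
qed

lemma opposed_crossing_empty:
  assumes "opposed Z D"
  shows "crossing Z i D = {}"
  using assms unfolding opposed_def crossing_def Sigma_i_def
  by (metis (mono_tags, lifting) empty_Collect_eq mem_Collect_eq not_less_iff_gr_or_eq)

lemma opposed_boundary_empty:
  assumes "opposed Z D"
  shows "boundary_pts Z i D = {}"
proof -
  have "sliding Z i D \<union> escaping Z i D = Sigma_i i D - {0}"
    unfolding opposed_sliding_escaping[OF assms] Sigma_i_def plane_eq_0_iff
    using exhaust_2[of i] by (auto simp: plane_eq_0_iff)
  then show ?thesis
    unfolding boundary_pts_def Let_def opposed_crossing_empty[OF assms] by auto
qed

lemma opposed_origin_in_closure:
  assumes "opposed Z D"
  shows "0 \<in> closure (sliding Z i D \<union> escaping Z i D)"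
  unfolding closure_approachable
proof (intro allI impI)
  fix e :: real assume "e > 0"
  obtain d where d: "d > 0" "ball 0 d \<subseteq> D"
    using assms by (auto simp: opposed_def open_contains_ball)
  define p :: plane where "p = (min d e / 2) *\<^sub>R axis (other i) 1"
  have "norm p = min d e / 2"
    using d \<open>e > 0\<close> by (simp add: p_def norm_axis_1)
  then have "p \<in> D" "dist p 0 < e"
    using d \<open>e > 0\<close> by (auto simp: subset_iff)
  moreover have "p $ i = 0" "p $ other i \<noteq> 0"
    using exhaust_2[of i] d \<open>e > 0\<close> by (auto simp: p_def axis_def)
  ultimately show "\<exists>y\<in>sliding Z i D \<union> escaping Z i D. dist y 0 < e"
    unfolding opposed_sliding_escaping[OF assms] by blast
qed

text \<open>There are no crossing points whose closure could cover the axes, and sliding or escaping points of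
  both axes accumulate at the origin. So the rule at the origin is in its second case.\<close>

lemma opposed_not_passes_origin:
  assumes "opposed Z D"
  shows "\<not> passes_origin_at Z D \<gamma> t"
proof -
  have "\<not> Sigma_set D \<subseteq> closure (\<Union>i. crossing Z i D)"
    using assms by (auto simp: opposed_crossing_empty[OF assms] opposed_def Sigma_set_def)
  then show ?thesis
    using opposed_origin_in_closure[OF assms] by (simp add: passes_origin_at_def)
qed

lemma opposed_regular_at_iff:
  assumes "opposed Z D"
  shows "regular_at Z D \<gamma> t \<longleftrightarrow>
     \<gamma> t \<in> U_plus D \<and> (\<gamma> has_vector_derivative fst Z (\<gamma> t)) (at t)
   \<or> \<gamma> t \<in> U_minus D \<and> (\<gamma> has_vector_derivative snd Z (\<gamma> t)) (at t)
   \<or> (\<exists>i. \<gamma> t \<in> D \<and> \<gamma> t $ i = 0 \<and> \<gamma> t $ other i \<noteq> 0 \<and>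
        slides_at Z i {p \<in> D. p $ i = 0 \<and> p $ other i \<noteq> 0} \<gamma> t)"
  using opposed_not_passes_origin[OF assms]
  unfolding regular_at_def opposed_sliding_escaping[OF assms] opposed_crossing_empty[OF assms]
  by simp

lemma integral_curve_on_open:
  assumes "integral_curve_on V J \<gamma>" "open J" "s \<in> J"
  shows "(\<gamma> has_vector_derivative V (\<gamma> s)) (at s)"
  using assms by (metis at_within_open integral_curve_on_def)

text \<open>A curve that obeys the rules at a parameter keeps the sign of each coordinate for a while:
  a nonzero coordinate by continuity, a zero coordinate because the curve slides.\<close>

lemma regular_at_sgn_locally_constant:
  assumes Z: "opposed Z D" and reg: "regular_at Z D \<gamma> t" and cont: "isCont \<gamma> t"
  shows "\<exists>e>0. \<forall>s. \<bar>s - t\<bar> < e \<longrightarrow> sgn (\<gamma> s $ k) = sgn (\<gamma> t $ k)"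
proof (cases "\<gamma> t $ k = 0")
  case False
  have "isCont (\<lambda>s. \<gamma> s $ k) t"
    using cont by (intro continuous_intros)
  then obtain e where e: "e > 0" "\<And>s. \<bar>s - t\<bar> < e \<Longrightarrow> \<bar>\<gamma> s $ k - \<gamma> t $ k\<bar> < \<bar>\<gamma> t $ k\<bar>"
    using False unfolding continuous_at_eps_delta dist_real_def by (metis zero_less_abs_iff)
  have "sgn (\<gamma> s $ k) = sgn (\<gamma> t $ k)" if "\<bar>s - t\<bar> < e" for s
    using e(2)[OF that] by (auto simp: sgn_real_def abs_if split: if_splits)
  with e show ?thesis by blast
next
  case True
  then have "\<gamma> t \<notin> U_plus D" "\<gamma> t \<notin> U_minus D"
    using exhaust_2[of k] by (auto simp: U_plus_def U_minus_def)
  with reg obtain i where i: "\<gamma> t $ i = 0" "\<gamma> t $ other i \<noteq> 0"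
      "slides_at Z i {p \<in> D. p $ i = 0 \<and> p $ other i \<noteq> 0} \<gamma> t"
    unfolding opposed_regular_at_iff[OF Z] by blast
  have "i = k"
    using True i exhaust_2[of i] exhaust_2[of k] by auto
  with i(3) obtain e where "e > 0" "\<gamma> ` {t-e<..<t+e} \<subseteq> {p \<in> D. p $ k = 0 \<and> p $ other k \<noteq> 0}"
    unfolding slides_at_def by blast
  then show ?thesis
    using True by (intro exI[of _ e]) (auto simp: subset_iff image_iff abs_diff_less_iff Bex_def)
qed

lemma regular_at_has_vector_derivative:
  assumes Z: "opposed Z D" and reg: "regular_at Z D \<gamma> t"
  shows "(\<gamma> has_vector_derivative cell_field Z (\<gamma> t)) (at t)" "\<gamma> t \<noteq> 0"
proof -
  consider "\<gamma> t \<in> U_plus D" "(\<gamma> has_vector_derivative fst Z (\<gamma> t)) (at t)"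
    | "\<gamma> t \<in> U_minus D" "(\<gamma> has_vector_derivative snd Z (\<gamma> t)) (at t)"
    | i where "\<gamma> t $ i = 0" "\<gamma> t $ other i \<noteq> 0"
        "slides_at Z i {p \<in> D. p $ i = 0 \<and> p $ other i \<noteq> 0} \<gamma> t"
    using reg unfolding opposed_regular_at_iff[OF Z] by blast
  then have "(\<gamma> has_vector_derivative cell_field Z (\<gamma> t)) (at t) \<and> \<gamma> t \<noteq> 0"
  proof cases
    case 3
    then obtain e where "e > 0" "integral_curve_on (sliding_field Z i) {t-e<..<t+e} \<gamma>"
      unfolding slides_at_def by blast
    then have "(\<gamma> has_vector_derivative sliding_field Z i (\<gamma> t)) (at t)"
      by (intro integral_curve_on_open[where J = "{t-e<..<t+e}"]) auto
    then show ?thesis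
      using 3(1,2) exhaust_2[of i] by (auto simp: cell_field_def)
  qed (auto simp: cell_field_def U_plus_def U_minus_def)
  then show "(\<gamma> has_vector_derivative cell_field Z (\<gamma> t)) (at t)" "\<gamma> t \<noteq> 0"
    by auto
qed

lemma cell_curve_regular_at:
  assumes Z: "opposed Z D" and "open I" "t \<in> I" and "\<gamma> ` I \<subseteq> D - {0}"
    and sgn: "\<And>s k. s \<in> I \<Longrightarrow> sgn (\<gamma> s $ k) = sgn (\<gamma> t $ k)"
    and der: "\<And>s. s \<in> I \<Longrightarrow> (\<gamma> has_vector_derivative cell_field Z (\<gamma> s)) (at s)"
  shows "regular_at Z D \<gamma> t"
proof -
  have D: "\<gamma> s \<in> D" "\<gamma> s \<noteq> 0" if "s \<in> I" for s
    using assms that by auto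
  consider "\<gamma> t $ 1 * \<gamma> t $ 2 > 0" | "\<gamma> t $ 1 * \<gamma> t $ 2 < 0"
    | i where "\<gamma> t $ i = 0" "\<gamma> t $ other i \<noteq> 0"
    using D(2)[OF \<open>t \<in> I\<close>] unfolding plane_eq_0_iff
    by (metis linorder_neqE_linordered_idom mult_eq_0_iff other_simps)
  then show ?thesis
  proof cases
    case 1
    then have "cell_field Z (\<gamma> t) = fst Z (\<gamma> t)"
      by (auto simp: cell_field_def)
    then show ?thesis
      using 1 der[OF \<open>t \<in> I\<close>] D(1)[OF \<open>t \<in> I\<close>]
      unfolding opposed_regular_at_iff[OF Z] by (simp add: U_plus_def)
  next
    case 2
    then have "cell_field Z (\<gamma> t) = snd Z (\<gamma> t)"
      by (auto simp: cell_field_def)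
    then show ?thesis
      using 2 der[OF \<open>t \<in> I\<close>] D(1)[OF \<open>t \<in> I\<close>]
      unfolding opposed_regular_at_iff[OF Z] by (simp add: U_minus_def)
  next
    case 3
    obtain e where e: "e > 0" "{t-e<..<t+e} \<subseteq> I"
    proof -
      obtain e where e: "e > 0" "ball t e \<subseteq> I"
        using \<open>open I\<close> \<open>t \<in> I\<close> by (auto simp: open_contains_ball)
      then show ?thesis
        using that[of e] by (simp add: ball_eq_greaterThanLessThan)
    qed
    have s: "\<gamma> s $ i = 0" "\<gamma> s $ other i \<noteq> 0" if "s \<in> I" for s
      using sgn[OF that, of i] sgn[OF that, of "other i"] 3 by (auto simp: sgn_0_0)
    then have "cell_field Z (\<gamma> s) = sliding_field Z i (\<gamma> s)" if "s \<in> I" for s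
      using that exhaust_2[of i] by (auto simp: cell_field_def)
    then have "integral_curve_on (sliding_field Z i) {t-e<..<t+e} \<gamma>"
      unfolding integral_curve_on_def
      using e der by (metis has_vector_derivative_at_within subset_iff)
    moreover have "\<gamma> ` {t-e<..<t+e} \<subseteq> {p \<in> D. p $ i = 0 \<and> p $ other i \<noteq> 0}"
      using e s D by auto
    ultimately have "slides_at Z i {p \<in> D. p $ i = 0 \<and> p $ other i \<noteq> 0} \<gamma> t"
      unfolding slides_at_def using e by blast
    then show ?thesis
      unfolding opposed_regular_at_iff[OF Z] using 3 D[OF \<open>t \<in> I\<close>] by blast
  qed
qed

text \<open>Without boundary points the coinductive clause is void, and every parameter obeys a local rule. The
  signs of the coordinates are then locally constant, hence constant on the interval, so that one
  field governs the whole curve.\<close>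

lemma Z_curve_iff_cell_curve:
  assumes Z: "opposed Z D"
  shows "Z_curve Z D I \<gamma> \<longleftrightarrow>
    open I \<and> connected I \<and> I \<noteq> {} \<and> \<gamma> ` I \<subseteq> D - {0} \<and>
    (\<forall>s\<in>I. \<forall>t\<in>I. \<forall>k. sgn (\<gamma> s $ k) = sgn (\<gamma> t $ k)) \<and>
    (\<forall>t\<in>I. (\<gamma> has_vector_derivative cell_field Z (\<gamma> t)) (at t))"
    (is "_ \<longleftrightarrow> ?R")
proof
  assume "Z_curve Z D I \<gamma>"
  then have "open I \<and> connected I \<and> I \<noteq> {} \<and> \<gamma> ` I \<subseteq> D \<and> (\<forall>t\<in>I. regular_at Z D \<gamma> t)"
    by (rule Z_curve.cases) (simp only: opposed_boundary_empty[OF Z] empty_iff simp_thms)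
  then have I: "open I" "connected I" "I \<noteq> {}" "\<gamma> ` I \<subseteq> D"
    and reg: "\<And>t. t \<in> I \<Longrightarrow> regular_at Z D \<gamma> t"
    by (elim conjE; blast)+
  note der = regular_at_has_vector_derivative[OF Z reg]
  have "(\<lambda>t. sgn (\<gamma> t $ k)) constant_on I" for k
  proof (rule locally_constant_imp_constant[OF I(2)])
    fix t assume t: "t \<in> I"
    have "isCont \<gamma> t"
      using der(1)[OF t] by (rule has_vector_derivative_continuous)
    from regular_at_sgn_locally_constant[OF Z reg[OF t] this, of k]
    obtain e where e: "e > 0" "\<And>s. \<bar>s - t\<bar> < e \<Longrightarrow> sgn (\<gamma> s $ k) = sgn (\<gamma> t $ k)"
      by blast
    show "\<exists>T. openin (top_of_set I) T \<and> t \<in> T \<and> (\<forall>s\<in>T. sgn (\<gamma> s $ k) = sgn (\<gamma> t $ k))"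
    proof (intro exI conjI ballI)
      show "openin (top_of_set I) (I \<inter> ball t e)"
        by (intro openin_open_Int open_ball)
      show "t \<in> I \<inter> ball t e"
        using t e(1) by simp
      show "sgn (\<gamma> s $ k) = sgn (\<gamma> t $ k)" if "s \<in> I \<inter> ball t e" for s
        using that by (intro e(2)) (simp add: dist_real_def abs_minus_commute)
    qed
  qed
  then have "sgn (\<gamma> s $ k) = sgn (\<gamma> t $ k)" if "s \<in> I" "t \<in> I" for s t k
    using that unfolding constant_on_def by metis
  then have sgn: "\<forall>s\<in>I. \<forall>t\<in>I. \<forall>k. sgn (\<gamma> s $ k) = sgn (\<gamma> t $ k)"
    by blast
  have img: "\<gamma> ` I \<subseteq> D - {0}"
  proof (rule image_subsetI)
    fix t assume t: "t \<in> I"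
    then have "\<gamma> t \<in> D" using I(4) by blast
    then show "\<gamma> t \<in> D - {0}" using der(2)[OF t] by simp
  qed
  show ?R
    by (rule conjI[OF I(1) conjI[OF I(2) conjI[OF I(3) conjI[OF img conjI[OF sgn ballI[OF der(1)]]]]]])
next
  assume R: ?R
  then have I: "open I" "connected I" "I \<noteq> {}" "\<gamma> ` I \<subseteq> D - {0}"
    and sgn: "\<forall>s\<in>I. \<forall>t\<in>I. \<forall>k. sgn (\<gamma> s $ k) = sgn (\<gamma> t $ k)"
    and der: "\<forall>t\<in>I. (\<gamma> has_vector_derivative cell_field Z (\<gamma> t)) (at t)"
    by - (elim conjE, assumption)+
  have "regular_at Z D \<gamma> t" if t: "t \<in> I" for t
    by (rule cell_curve_regular_at[OF Z I(1) t I(4)])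
      (rule sgn[rule_format, OF _ t] der[rule_format]; assumption)+
  moreover have "continuous_on I \<gamma>"
    using der by (meson continuous_at_imp_continuous_on has_vector_derivative_continuous)
  ultimately show "Z_curve Z D I \<gamma>"
    using I by (intro Z_curve.intros ballI disjI1) auto
qed

section \<open>Orbits parametrised by time\<close>

text \<open>A solution over its maximal interval of existence, up to time shifts the only one through its points.
  The last clause combines uniqueness and maximality.\<close>

definition complete_orbit :: "pw_field \<Rightarrow> plane set \<Rightarrow> real set \<Rightarrow> (real \<Rightarrow> plane) \<Rightarrow> bool" where
  "complete_orbit Z D J \<Gamma> \<longleftrightarrow>
     Z_curve Z D J \<Gamma> \<and> inj_on \<Gamma> J \<and>
     (\<forall>I \<gamma>. Z_curve Z D I \<gamma> \<longrightarrow> \<gamma> ` I \<inter> \<Gamma> ` J \<noteq> {} \<longrightarrow>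
        (\<exists>k. \<forall>t\<in>I. t + k \<in> J \<and> \<gamma> t = \<Gamma> (t + k)))"

lemma Z_curveD:
  assumes "opposed Z D" "Z_curve Z D I \<gamma>"
  shows "open I" "connected I" "I \<noteq> {}" "\<gamma> ` I \<subseteq> D - {0}"
    "\<And>s t k. s \<in> I \<Longrightarrow> t \<in> I \<Longrightarrow> sgn (\<gamma> s $ k) = sgn (\<gamma> t $ k)"
    "\<And>t. t \<in> I \<Longrightarrow> (\<gamma> has_vector_derivative cell_field Z (\<gamma> t)) (at t)"
  using assms(2)[unfolded Z_curve_iff_cell_curve[OF assms(1)]] by blast+

lemma Z_curveI:
  assumes "opposed Z D" "open I" "connected I" "I \<noteq> {}" "\<gamma> ` I \<subseteq> D - {0}"
    "\<And>s t k. s \<in> I \<Longrightarrow> t \<in> I \<Longrightarrow> sgn (\<gamma> s $ k) = sgn (\<gamma> t $ k)"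
    "\<And>t. t \<in> I \<Longrightarrow> (\<gamma> has_vector_derivative cell_field Z (\<gamma> t)) (at t)"
  shows "Z_curve Z D I \<gamma>"
  unfolding Z_curve_iff_cell_curve[OF assms(1)]
  by (rule conjI[OF assms(2) conjI[OF assms(3) conjI[OF assms(4) conjI[OF assms(5)]]]])
    (rule conjI ballI allI assms(6,7); assumption?)+

lemma Z_curve_shift:
  assumes "opposed Z D" "Z_curve Z D J \<Gamma>"
  shows "Z_curve Z D ((\<lambda>t. t - k) ` J) (\<lambda>t. \<Gamma> (t + k))"
proof (rule Z_curveI[OF assms(1)])
  note D = Z_curveD[OF assms]
  show "open ((\<lambda>t. t - k) ` J)" "connected ((\<lambda>t. t - k) ` J)"
    using open_translation_subtract[OF D(1)] D(2)
    by (auto intro!: connected_continuous_image continuous_intros)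
  show "(\<lambda>t. t - k) ` J \<noteq> {}" "(\<lambda>t. \<Gamma> (t + k)) ` (\<lambda>t. t - k) ` J \<subseteq> D - {0}"
    using D(3,4) by auto
  show "sgn (\<Gamma> (s + k) $ i) = sgn (\<Gamma> (t + k) $ i)"
    if "s \<in> (\<lambda>t. t - k) ` J" "t \<in> (\<lambda>t. t - k) ` J" for s t i
    using that by (intro D(5)) auto
  show "((\<lambda>t. \<Gamma> (t + k)) has_vector_derivative cell_field Z (\<Gamma> (t + k))) (at t)"
    if "t \<in> (\<lambda>t. t - k) ` J" for t
  proof -
    have "(\<Gamma> has_vector_derivative cell_field Z (\<Gamma> (t + k))) (at (t + k))"
      using that by (intro D(6)) auto
    moreover have "((\<lambda>t. t + k) has_vector_derivative 1) (at t)"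
      by (auto intro!: derivative_eq_intros)
    ultimately show ?thesis
      using vector_diff_chain_at[of "\<lambda>t. t + k" 1 t \<Gamma>] by (simp add: o_def)
  qed
qed

text \<open>A longer curve would be a time shift of a piece of \<open>\<Gamma>\<close>, and injectivity of \<open>\<Gamma>\<close> forces the shift
  to be zero.\<close>

lemma complete_orbit_trajectory:
  assumes Z: "opposed Z D" and orb: "complete_orbit Z D J \<Gamma>"
  shows "trajectory Z D J \<Gamma>"
proof -
  have "J' = J" if \<eta>: "Z_curve Z D J' \<eta>" "J \<subseteq> J'" "\<forall>t\<in>J. \<eta> t = \<Gamma> t" for J' \<eta>
  proof -
    obtain t0 where t0: "t0 \<in> J"
      using orb Z_curveD(3)[OF Z, of J \<Gamma>] by (auto simp: complete_orbit_def)
    then have "\<eta> ` J' \<inter> \<Gamma> ` J \<noteq> {}"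
      using \<eta>(2,3) by (metis IntI empty_iff imageI subsetD)
    then obtain k where k: "\<And>t. t \<in> J' \<Longrightarrow> t + k \<in> J \<and> \<eta> t = \<Gamma> (t + k)"
      using orb \<eta>(1) unfolding complete_orbit_def by metis
    have "\<Gamma> (t0 + k) = \<Gamma> t0" "t0 + k \<in> J"
      using k[of t0] \<eta> t0 by auto
    then have "k = 0"
      using orb t0 unfolding complete_orbit_def by (metis add_cancel_right_right inj_onD)
    then show ?thesis
      using k \<eta>(2) by auto
  qed
  then show ?thesis
    using orb by (auto simp: trajectory_def complete_orbit_def)
qed

lemma trajectory_meeting_complete_orbit:
  assumes Z: "opposed Z D" and orb: "complete_orbit Z D J \<Gamma>"
    and tr: "trajectory Z D I \<gamma>" and cur: "Z_curve Z D I \<gamma>" and meet: "\<gamma> ` I \<inter> \<Gamma> ` J \<noteq> {}"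
  shows "\<exists>k. I = (\<lambda>t. t - k) ` J \<and> (\<forall>t\<in>I. \<gamma> t = \<Gamma> (t + k))"
proof -
  obtain k where k: "\<And>t. t \<in> I \<Longrightarrow> t + k \<in> J \<and> \<gamma> t = \<Gamma> (t + k)"
    using orb cur meet unfolding complete_orbit_def by metis
  let ?J = "(\<lambda>t. t - k) ` J"
  have c: "Z_curve Z D ?J (\<lambda>t. \<Gamma> (t + k))"
    using orb by (intro Z_curve_shift[OF Z]) (simp add: complete_orbit_def)
  have "I \<subseteq> ?J"
    using k by force
  have "?J = I"
    using tr unfolding trajectory_def
  proof (elim disjE conjE)
    assume "\<forall>J \<eta>. Z_curve Z D J \<eta> \<and> I \<subseteq> J \<and> (\<forall>t\<in>I. \<eta> t = \<gamma> t) \<longrightarrow> J = I"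
    then show ?thesis
      using c k \<open>I \<subseteq> ?J\<close> by auto
  next
    assume "I = UNIV"
    with \<open>I \<subseteq> ?J\<close> show ?thesis by auto
  qed
  then show ?thesis
    using k by blast
qed

text \<open>The origin is a singleton trajectory on both sides. Any other trajectory is, by maximality, a time
  shift of the whole complete orbit through one of its points.\<close>

lemma maps_trajectories_by_complete_orbits:
  assumes Z: "opposed Z D" and Z': "opposed Z' D'" and h0: "h 0 = 0"
    and orb: "\<And>p. p \<in> D \<Longrightarrow> p \<noteq> 0 \<Longrightarrow> \<exists>J \<Gamma> J' \<Gamma>' \<tau>. complete_orbit Z D J \<Gamma> \<and> p \<in> \<Gamma> ` J \<and>
      complete_orbit Z' D' J' \<Gamma>' \<and> strict_mono_on J \<tau> \<and> \<tau> ` J = J' \<and>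
      (\<forall>t\<in>J. h (\<Gamma> t) = \<Gamma>' (\<tau> t))"
  shows "maps_trajectories h Z D Z' D'"
  unfolding maps_trajectories_def
proof (intro allI impI)
  fix I \<gamma> assume tr: "trajectory Z D I \<gamma>"
  show "\<exists>J \<eta> \<tau>. trajectory Z' D' J \<eta> \<and> strict_mono_on I \<tau> \<and> \<tau> ` I = J \<and>
           (\<forall>t\<in>I. h (\<gamma> t) = \<eta> (\<tau> t))"
  proof (cases "Z_curve Z D I \<gamma>")
    case True
    note c = Z_curveD[OF Z True]
    obtain t0 where t0: "t0 \<in> I"
      using c(3) by auto
    then have "\<gamma> t0 \<in> D" "\<gamma> t0 \<noteq> 0"
      using c(4) by auto
    from orb[OF this] obtain J \<Gamma> J' \<Gamma>' \<tau> where o: "complete_orbit Z D J \<Gamma>" "\<gamma> t0 \<in> \<Gamma> ` J"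
      "complete_orbit Z' D' J' \<Gamma>'" "strict_mono_on J \<tau>" "\<tau> ` J = J'"
      and h: "\<And>t. t \<in> J \<Longrightarrow> h (\<Gamma> t) = \<Gamma>' (\<tau> t)"
      by metis
    have "\<gamma> ` I \<inter> \<Gamma> ` J \<noteq> {}"
      using t0 o(2) by blast
    from trajectory_meeting_complete_orbit[OF Z o(1) tr True this]
    obtain k where k: "I = (\<lambda>t. t - k) ` J" "\<And>t. t \<in> I \<Longrightarrow> \<gamma> t = \<Gamma> (t + k)"
      by blast
    show ?thesis
    proof (intro exI conjI ballI)
      show "trajectory Z' D' J' \<Gamma>'"
        by (rule complete_orbit_trajectory[OF Z' o(3)])
      show "strict_mono_on I (\<lambda>t. \<tau> (t + k))"
        using o(4) unfolding k(1) by (auto simp: strict_mono_on_def)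
      show "(\<lambda>t. \<tau> (t + k)) ` I = J'"
        using o(5) unfolding k(1) by (auto simp: image_image)
      show "h (\<gamma> t) = \<Gamma>' (\<tau> (t + k))" if "t \<in> I" for t
      proof -
        have "t + k \<in> J"
          using that unfolding k(1) by auto
        then show ?thesis
          using k(2)[OF that] h by simp
      qed
    qed
  next
    case False
    with tr obtain p where p: "I = UNIV" "p \<in> D" "\<gamma> = (\<lambda>_. p)"
      "\<not> (\<exists>J \<eta>. Z_curve Z D J \<eta> \<and> p \<in> \<eta> ` J)"
      unfolding trajectory_def by blast
    have "p = 0"
      using orb[OF p(2)] p(4) unfolding complete_orbit_def by metis
    have "\<not> (\<exists>J \<eta>. Z_curve Z' D' J \<eta> \<and> 0 \<in> \<eta> ` J)"
      using Z_curveD(4)[OF Z'] by blast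
    then have "trajectory Z' D' UNIV (\<lambda>_. 0)"
      using Z' by (auto simp: trajectory_def opposed_def)
    then show ?thesis
      using p \<open>p = 0\<close> h0
      by (intro exI[of _ UNIV] exI[of _ "\<lambda>_. 0"] exI[of _ "\<lambda>t. t"]) (auto simp: strict_mono_on_def)
  qed
qed

text \<open>The arc \<open>c\<close> is parametrised by one of its coordinates, and \<open>u\<close> is the reciprocal of the speed of that
  coordinate under the flow. A primitive of \<open>u\<close> is the time elapsed along the arc, and its inverse
  yields the solution. Along any other curve on the arc the elapsed time has derivative one, so the
  curve is a time shift. The number \<open>d\<close> carries the sense in which the arc is traversed; \<open>u\<close> is
  continuous on a compact interval around \<open>K\<close> in order to have a primitive.\<close>

lemma complete_orbit_of_arc:
  fixes c :: "real \<Rightarrow> plane" and d a b :: real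
  assumes Z: "opposed Z D"
    and K: "open K" "connected K" "K \<noteq> {}" "K \<subseteq> {a..b}"
    and u: "continuous_on {a..b} u" "\<And>x. x \<in> K \<Longrightarrow> d * u x > 0"
    and cD: "c ` K \<subseteq> D - {0}"
    and sgn: "\<And>x y k. x \<in> K \<Longrightarrow> y \<in> K \<Longrightarrow> sgn (c x $ k) = sgn (c y $ k)"
    and coord: "\<And>x. x \<in> K \<Longrightarrow> c x $ i = x"
    and der: "\<And>x. x \<in> K \<Longrightarrow> (c has_vector_derivative u x *\<^sub>R cell_field Z (c x)) (at x)"
    and inv: "\<And>I \<gamma> t. Z_curve Z D I \<gamma> \<Longrightarrow> t \<in> I \<Longrightarrow> \<gamma> t \<in> c ` K \<Longrightarrow> \<gamma> ` I \<subseteq> c ` K"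
  shows "\<exists>J \<Gamma>. complete_orbit Z D J \<Gamma> \<and> \<Gamma> ` J = c ` K \<and> strict_mono_on J (\<lambda>t. d * \<Gamma> t $ i)"
proof -
  obtain f where f: "\<And>x. x \<in> {a..b} \<Longrightarrow> (f has_vector_derivative u x) (at x within {a..b})"
    using antiderivative_continuous[OF u(1)] by blast
  have f': "(f has_field_derivative u x) (at x)" if "x \<in> K" for x
  proof -
    have "(f has_vector_derivative u x) (at x within K)"
      using f[of x] that K(4) has_vector_derivative_within_subset by blast
    then show ?thesis
      unfolding has_real_derivative_iff_has_vector_derivative at_within_open[OF that K(1)] .
  qed
  have cont_f: "continuous_on K f"
    using f' by (meson DERIV_isCont continuous_at_imp_continuous_on)
  have mono_f: "d * f x < d * f y" if "x \<in> K" "y \<in> K" "x < y" for x y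
  proof (rule DERIV_pos_imp_increasing[OF \<open>x < y\<close>])
    fix z assume "x \<le> z" "z \<le> y"
    then have z: "z \<in> K"
      using that K(2) by (meson connected_contains_Icc atLeastAtMost_iff subset_iff)
    then show "\<exists>y. ((\<lambda>x. d * f x) has_real_derivative y) (at z) \<and> 0 < y"
      using f'[OF z] u(2)[OF z] by (intro exI[of _ "d * u z"]) (auto intro: DERIV_cmult)
  qed
  then have inj_f: "inj_on f K"
    by (intro linorder_inj_onI) (metis less_irrefl, linarith)
  define J where "J = f ` K"
  define \<theta> where "\<theta> = inv_into K f"
  have J: "open J" "connected J" "J \<noteq> {}"
    using invariance_of_domain[OF cont_f K(1) inj_f] connected_continuous_image[OF cont_f K(2)] K(3)
    by (auto simp: J_def)
  have \<theta>: "\<theta> t \<in> K" "f (\<theta> t) = t" if "t \<in> J" for t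
    using that by (auto simp: \<theta>_def J_def inv_into_into f_inv_into_f)
  have \<theta>f: "\<theta> (f x) = x" if "x \<in> K" for x
    using that inj_f by (simp add: \<theta>_def)
  have "continuous_on J \<theta>"
    unfolding J_def using \<theta>f by (intro continuous_on_inverse_open[OF K(1) cont_f]) simp_all
  then have \<theta>': "(\<theta> has_field_derivative inverse (u (\<theta> t))) (at t)" if "t \<in> J" for t
    using that f'[OF \<theta>(1)[OF that]] u(2)[OF \<theta>(1)[OF that]] J(1) \<theta>
    by (intro has_field_derivative_inverse_basic[of f _ _ _ J])
      (auto simp: continuous_on_eq_continuous_at)
  define \<Gamma> where "\<Gamma> = c \<circ> \<theta>"
  have img: "\<Gamma> ` J = c ` K"
    using \<theta> \<theta>f by (force simp: \<Gamma>_def J_def)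
  have coord\<Gamma>: "\<Gamma> t $ i = \<theta> t" if "t \<in> J" for t
    using that \<theta> coord by (simp add: \<Gamma>_def)
  have cur: "Z_curve Z D J \<Gamma>"
  proof (rule Z_curveI[OF Z J])
    show "\<Gamma> ` J \<subseteq> D - {0}"
      using img cD by simp
    show "sgn (\<Gamma> s $ k) = sgn (\<Gamma> t $ k)" if "s \<in> J" "t \<in> J" for s t k
      using that \<theta> unfolding \<Gamma>_def o_def by (intro sgn)
    show "(\<Gamma> has_vector_derivative cell_field Z (\<Gamma> t)) (at t)" if t: "t \<in> J" for t
    proof -
      have "u (\<theta> t) \<noteq> 0"
        using u(2)[OF \<theta>(1)[OF t]] by auto
      moreover have "(\<theta> has_vector_derivative inverse (u (\<theta> t))) (at t)"
        using \<theta>'[OF t] by (simp add: has_real_derivative_iff_has_vector_derivative)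
      note vector_diff_chain_at[of \<theta>, OF this der[OF \<theta>(1)[OF t]]]
      ultimately show ?thesis
        by (simp add: \<Gamma>_def)
    qed
  qed
  have speed: "u x * cell_field Z (c x) $ i = 1" if x: "x \<in> K" for x
  proof -
    have "((\<lambda>x. c x $ i) has_vector_derivative (u x *\<^sub>R cell_field Z (c x)) $ i) (at x)"
      using der[OF x] by (rule bounded_linear.has_vector_derivative[OF bounded_linear_vec_nth])
    then have "((\<lambda>x. c x $ i) has_vector_derivative u x * cell_field Z (c x) $ i) (at x)"
      by simp
    from has_vector_derivative_transform_within_open[OF this K(1) x coord]
    have "((\<lambda>x. x) has_vector_derivative u x * cell_field Z (c x) $ i) (at x)" .
    moreover have "((\<lambda>x. x) has_vector_derivative (1::real)) (at x)"
      by (auto intro!: derivative_eq_intros)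
    ultimately show ?thesis
      by (rule vector_derivative_unique_at)
  qed
  have "\<exists>k. \<forall>t\<in>I. t + k \<in> J \<and> \<gamma> t = \<Gamma> (t + k)"
    if \<gamma>: "Z_curve Z D I \<gamma>" "\<gamma> ` I \<inter> \<Gamma> ` J \<noteq> {}" for I \<gamma>
  proof -
    note I = Z_curveD[OF Z \<gamma>(1)]
    have "\<gamma> ` I \<subseteq> c ` K"
      using inv[OF \<gamma>(1)] \<gamma>(2) img by blast
    then have \<kappa>: "\<gamma> t $ i \<in> K" "c (\<gamma> t $ i) = \<gamma> t" if "t \<in> I" for t
      using that coord by fastforce+
    have "((\<lambda>t. f (\<gamma> t $ i) - t) has_field_derivative 0) (at t)" if t: "t \<in> I" for t
    proof -
      have "((\<lambda>t. \<gamma> t $ i) has_vector_derivative cell_field Z (\<gamma> t) $ i) (at t)"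
        using I(6)[OF t] by (rule bounded_linear.has_vector_derivative[OF bounded_linear_vec_nth])
      then have "((\<lambda>t. \<gamma> t $ i) has_field_derivative cell_field Z (\<gamma> t) $ i) (at t)"
        by (simp add: has_real_derivative_iff_has_vector_derivative)
      from DERIV_chain2[OF f'[OF \<kappa>(1)[OF t]] this]
      have "((\<lambda>t. f (\<gamma> t $ i)) has_field_derivative 1) (at t)"
        using speed[OF \<kappa>(1)[OF t]] \<kappa>(2)[OF t] by simp
      then show ?thesis
        by (auto intro!: derivative_eq_intros)
    qed
    then have d0: "\<forall>t\<in>I - {}. ((\<lambda>t. f (\<gamma> t $ i) - t) has_field_derivative 0) (at t)"
      and "continuous_on I (\<lambda>t. f (\<gamma> t $ i) - t)"
      by (blast, meson DERIV_isCont continuous_at_imp_continuous_on)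
    then obtain k where k: "\<And>t. t \<in> I \<Longrightarrow> f (\<gamma> t $ i) - t = k"
      using DERIV_zero_connected_constant[OF I(2,1), of "{}" "\<lambda>t. f (\<gamma> t $ i) - t"]
      by blast
    have "t + k \<in> J \<and> \<gamma> t = \<Gamma> (t + k)" if "t \<in> I" for t
    proof -
      have "t + k = f (\<gamma> t $ i)"
        using k[OF that] by simp
      then show ?thesis
        using \<kappa>[OF that] \<theta>f by (simp add: J_def \<Gamma>_def)
    qed
    then show ?thesis
      by blast
  qed
  moreover have "inj_on \<Gamma> J"
    by (rule inj_onI) (metis coord\<Gamma> \<theta>(2))
  ultimately have "complete_orbit Z D J \<Gamma>"
    using cur unfolding complete_orbit_def by blast
  moreover have "strict_mono_on J (\<lambda>t. d * \<Gamma> t $ i)"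
  proof (rule strict_mono_onI)
    fix s t assume st: "s \<in> J" "t \<in> J" "s < t"
    have "d \<noteq> 0"
      using u(2) K(3) by fastforce
    have "d * \<theta> s < d * \<theta> t"
    proof (rule ccontr)
      assume "\<not> d * \<theta> s < d * \<theta> t"
      then consider "d > 0" "\<theta> t \<le> \<theta> s" | "d < 0" "\<theta> s \<le> \<theta> t"
        using \<open>d \<noteq> 0\<close> by (cases "d > 0") (auto simp: not_less mult_le_cancel_left)
      then show False
      proof cases
        case 1
        then have "d * f (\<theta> t) \<le> d * f (\<theta> s)"
          using mono_f[of "\<theta> t" "\<theta> s"] \<theta>(1) st by (cases "\<theta> t = \<theta> s") auto
        then show False
          using 1 st \<theta>(2) by simp
      next
        case 2
        then have "d * f (\<theta> s) \<le> d * f (\<theta> t)"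
          using mono_f[of "\<theta> s" "\<theta> t"] \<theta>(1) st by (cases "\<theta> t = \<theta> s") auto
        then show False
          using 2 st \<theta>(2) by simp
      qed
    qed
    then show "d * \<Gamma> s $ i < d * \<Gamma> t $ i"
      using st coord\<Gamma> by simp
  qed
  ultimately show ?thesis
    using img by blast
qed

section \<open>A scalar initial value problem depending on its initial height\<close>

definition clamp1 :: "real \<Rightarrow> real \<Rightarrow> real" where
  "clamp1 e x = max (- e) (min e x)"

lemma clamp1_bound: "e \<ge> 0 \<Longrightarrow> \<bar>clamp1 e x\<bar> \<le> e"
  by (auto simp: clamp1_def)

lemma clamp1_id: "\<bar>x\<bar> \<le> e \<Longrightarrow> clamp1 e x = x"
  by (auto simp: clamp1_def)

lemma clamp1_lipschitz: "\<bar>clamp1 e x - clamp1 e y\<bar> \<le> \<bar>x - y\<bar>"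
  by (auto simp: clamp1_def)

lemma continuous_on_clamp1 [continuous_intros]:
  "continuous_on S f \<Longrightarrow> continuous_on S (\<lambda>x. clamp1 e (f x))"
  unfolding clamp1_def by (intro continuous_intros)

lemma picard_integral_bcontfun:
  fixes F :: "real \<times> real \<Rightarrow> real" and W :: "real \<times> real \<Rightarrow> real"
  assumes F: "continuous_on UNIV F" "\<And>p. \<bar>F p\<bar> \<le> M" and W: "continuous_on UNIV W" and "\<delta> > 0"
  shows "(\<lambda>(x, s). clamp1 \<delta> x * integral {0..1} (\<lambda>u. F (u * clamp1 \<delta> x, s + W (u * clamp1 \<delta> x, s))))
    \<in> bcontfun"
proof (rule bcontfun_normI)
  let ?G = "\<lambda>(p::real \<times> real) u. F (u * clamp1 \<delta> (fst p), snd p + W (u * clamp1 \<delta> (fst p), snd p))"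
  have G: "continuous_on (UNIV \<times> cbox 0 1) (\<lambda>(p, u). ?G p u)"
    unfolding split_beta
    by (intro continuous_intros continuous_on_compose2[OF F(1)] continuous_on_compose2[OF W]) auto
  then have "continuous_on UNIV (\<lambda>p. integral (cbox 0 1) (?G p))"
    by (rule integral_continuous_on_param)
  then have "continuous_on UNIV (\<lambda>p. clamp1 \<delta> (fst p) * integral (cbox 0 1) (?G p))"
    by (intro continuous_intros)
  then show "continuous_on UNIV (\<lambda>(x, s). clamp1 \<delta> x * integral {0..1} (\<lambda>u. F (u * clamp1 \<delta> x, s + W (u * clamp1 \<delta> x, s))))"
    by (simp add: split_beta)
  fix p :: "real \<times> real"
  have "continuous_on {0..1} (?G p)"
    by (intro continuous_intros continuous_on_compose2[OF F(1)] continuous_on_compose2[OF W]) auto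
  then have "norm (integral {0..1} (?G p)) \<le> M * (1 - 0)"
    using F(2) by (intro integral_bound) auto
  then have "\<bar>clamp1 \<delta> (fst p)\<bar> * \<bar>integral {0..1} (?G p)\<bar> \<le> \<delta> * M"
    using clamp1_bound[of \<delta> "fst p"] \<open>\<delta> > 0\<close> by (intro mult_mono) auto
  then show "norm (case p of (x, s) \<Rightarrow> clamp1 \<delta> x * integral {0..1} (\<lambda>u. F (u * clamp1 \<delta> x, s + W (u * clamp1 \<delta> x, s)))) \<le> \<delta> * M"
    by (simp add: split_beta abs_mult)
qed

text \<open>The unknown \<open>W (x, s)\<close> is the height over \<open>x\<close>, relative to \<open>s\<close>, of the solution that starts at
  height \<open>s\<close> over \<open>0\<close>. As a fixed point in the space of bounded continuous functions of both variables
  it is jointly continuous, and no separate argument about dependence on initial values is needed.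
  The integral from \<open>0\<close> to \<open>x\<close> is scaled to the unit interval to treat both signs of \<open>x\<close> alike.\<close>

lemma picard_fixed_point:
  fixes F :: "real \<times> real \<Rightarrow> real"
  assumes F: "continuous_on UNIV F" "\<And>p. \<bar>F p\<bar> \<le> M"
    and L: "\<And>x y z. \<bar>F (x, y) - F (x, z)\<bar> \<le> L * \<bar>y - z\<bar>"
    and \<delta>: "\<delta> > 0" "\<delta> * L < 1"
  obtains W :: "real \<times> real \<Rightarrow> real" and B where "continuous_on UNIV W" "\<And>p. \<bar>W p\<bar> \<le> B"
    "\<And>x s. W (x, s) = clamp1 \<delta> x * integral {0..1} (\<lambda>u. F (u * clamp1 \<delta> x, s + W (u * clamp1 \<delta> x, s)))"
proof -
  have L0: "L \<ge> 0"
    using L[of 0 0 1] by auto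
  define G where "G W = (\<lambda>(x, s). clamp1 \<delta> x * integral {0..1}
      (\<lambda>u. F (u * clamp1 \<delta> x, s + W (u * clamp1 \<delta> x, s))))" for W :: "real \<times> real \<Rightarrow> real"
  define P where "P W = Bcontfun (G (apply_bcontfun W))" for W :: "(real \<times> real) \<Rightarrow>\<^sub>C real"
  have P: "apply_bcontfun (P W) = G (apply_bcontfun W)" for W
    unfolding P_def G_def
    by (intro Bcontfun_inverse picard_integral_bcontfun[OF F _ \<delta>(1)]) simp
  have "\<exists>!W. P W = W"
  proof (rule banach_fix_type)
    show "0 \<le> \<delta> * L" "\<delta> * L < 1"
      using \<delta> L0 by auto
    show "\<forall>V W. dist (P V) (P W) \<le> \<delta> * L * dist V W"
    proof (intro allI dist_bound)
      fix V W :: "(real \<times> real) \<Rightarrow>\<^sub>C real" and p :: "real \<times> real"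
      obtain x s where p: "p = (x, s)" by force
      let ?x = "clamp1 \<delta> x"
      let ?f = "\<lambda>W u. F (u * ?x, s + apply_bcontfun W (u * ?x, s))"
      have cont: "continuous_on {0..1} (?f W)" for W
        by (intro continuous_intros continuous_on_compose2[OF F(1)]
            continuous_on_compose2[OF continuous_on_apply_bcontfun[of UNIV W]]) auto
      have "\<bar>?f V u - ?f W u\<bar> \<le> L * dist V W" for u
      proof -
        have "\<bar>apply_bcontfun V (u * ?x, s) - apply_bcontfun W (u * ?x, s)\<bar> \<le> dist V W"
          using dist_bounded[of V _ W] by (simp add: dist_real_def)
        then show ?thesis
          using L[of "u * ?x" "s + apply_bcontfun V (u * ?x, s)" "s + apply_bcontfun W (u * ?x, s)"]
            mult_left_mono[OF _ L0] by fastforce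
      qed
      then have "norm (integral {0..1} (\<lambda>u. ?f V u - ?f W u)) \<le> L * dist V W * (1 - 0)"
        using cont by (intro integral_bound) (auto intro: continuous_on_diff)
      moreover have "integral {0..1} (\<lambda>u. ?f V u - ?f W u) = integral {0..1} (?f V) - integral {0..1} (?f W)"
        using cont by (intro Henstock_Kurzweil_Integration.integral_diff integrable_continuous_interval)
      ultimately have "\<bar>?x\<bar> * \<bar>integral {0..1} (?f V) - integral {0..1} (?f W)\<bar> \<le> \<delta> * (L * dist V W)"
        using clamp1_bound[of \<delta> x] \<delta>(1) by (intro mult_mono) auto
      then show "dist (apply_bcontfun (P V) p) (apply_bcontfun (P W) p) \<le> \<delta> * L * dist V W"
        unfolding P G_def p dist_real_def
        by (simp add: abs_mult[symmetric] right_diff_distrib mult.assoc)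
    qed
  qed
  then obtain W where W: "P W = W" by blast
  show thesis
  proof (rule that)
    show "continuous_on UNIV (apply_bcontfun W)" by simp
    show "\<bar>apply_bcontfun W p\<bar> \<le> norm W" for p
      using norm_bounded[of W p] by simp
    show "apply_bcontfun W (x, s) = clamp1 \<delta> x * integral {0..1}
        (\<lambda>u. F (u * clamp1 \<delta> x, s + apply_bcontfun W (u * clamp1 \<delta> x, s)))" for x s
      using fun_cong[OF P[of W], of "(x, s)"] by (simp add: W G_def)
  qed
qed

text \<open>By substitution \<open>W\<close> is the primitive of \<open>g\<close> that vanishes at \<open>0\<close>, on both sides of \<open>0\<close>.\<close>

lemma integral_scaled_antiderivative:
  fixes g :: "real \<Rightarrow> real"
  assumes g: "continuous_on {-\<delta>..\<delta>} g" and \<delta>: "\<delta> > 0"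
    and W: "\<And>x. \<bar>x\<bar> \<le> \<delta> \<Longrightarrow> W x = x * integral {0..1} (\<lambda>u. g (u * x))"
    and x: "\<bar>x\<bar> < \<delta>"
  shows "(W has_real_derivative g x) (at x)"
proof -
  obtain G where G: "\<And>x. x \<in> {-\<delta>..\<delta>} \<Longrightarrow> (G has_vector_derivative g x) (at x within {-\<delta>..\<delta>})"
    using antiderivative_continuous[OF g] by blast
  have WG: "W y = G y - G 0" if y: "\<bar>y\<bar> \<le> \<delta>" for y
  proof -
    have uy: "u * y \<in> {-\<delta>..\<delta>}" if "u \<in> {0..1}" for u
    proof -
      have "\<bar>u * y\<bar> \<le> 1 * \<delta>"
        unfolding abs_mult using that y \<delta> by (intro mult_mono) auto
      then show ?thesis by auto
    qed
    have "((\<lambda>u. y * g (u * y)) has_integral (G (1 * y) - G (0 * y))) {0..1}"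
    proof (rule fundamental_theorem_of_calculus)
      fix u :: real assume u: "u \<in> {0..1}"
      have 1: "((\<lambda>u. u * y) has_vector_derivative y) (at u within {0..1})"
        by (auto intro!: derivative_eq_intros)
      have "(G has_vector_derivative g (u * y)) (at (u * y) within (\<lambda>u. u * y) ` {0..1})"
        using uy by (intro has_vector_derivative_within_subset[OF G[OF uy[OF u]]]) auto
      from vector_diff_chain_within[OF 1 this]
      show "((\<lambda>u. G (u * y)) has_vector_derivative y * g (u * y)) (at u within {0..1})"
        by (simp add: o_def)
    qed simp
    then have "integral {0..1} (\<lambda>u. y * g (u * y)) = G (1 * y) - G (0 * y)"
      by (rule integral_unique)
    then show ?thesis
      using W[OF y] by simp
  qed
  have "(G has_vector_derivative g x) (at x within {-\<delta><..<\<delta>})"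
    using x by (intro has_vector_derivative_within_subset[OF G]) auto
  then have "(G has_real_derivative g x) (at x)"
    using x by (subst (asm) at_within_open) (auto simp: has_real_derivative_iff_has_vector_derivative)
  then have "((\<lambda>x. G x - G 0) has_real_derivative g x) (at x)"
    by (auto intro!: derivative_eq_intros)
  then show ?thesis
    by (rule DERIV_cong_ev[THEN iffD1, rotated -1, OF _ refl _ refl])
       (use x WG in \<open>auto simp: eventually_nhds intro!: exI[of _ "{-\<delta><..<\<delta>}"]\<close>)
qed

text \<open>After \<open>t0\<close> the function \<open>(d t)\<^sup>2 * exp (- 2 * C * t)\<close> is nonincreasing, before \<open>t0\<close> the function
  \<open>(d t)\<^sup>2 * exp (2 * C * t)\<close> is nondecreasing, and both are nonnegative and vanish at \<open>t0\<close>.\<close>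

lemma gronwall_zero:
  fixes d :: "real \<Rightarrow> real"
  assumes I: "open I" "connected I" "t0 \<in> I" "d t0 = 0"
    and der: "\<And>t. t \<in> I \<Longrightarrow> (d has_real_derivative d' t) (at t)"
    and bound: "\<And>t. t \<in> I \<Longrightarrow> \<bar>d' t\<bar> \<le> C * \<bar>d t\<bar>"
    and "t \<in> I"
  shows "d t = 0"
proof -
  have sq: "d s * d' s \<le> C * (d s)\<^sup>2 \<and> - (C * (d s)\<^sup>2) \<le> d s * d' s" if "s \<in> I" for s
  proof -
    have "\<bar>d s * d' s\<bar> \<le> C * (d s)\<^sup>2"
      using mult_left_mono[OF bound[OF that], of "\<bar>d s\<bar>"]
      by (simp add: abs_mult power2_eq_square ac_simps)
    then show ?thesis by auto
  qed
  have der_e: "((\<lambda>s. (d s)\<^sup>2 * exp (k * s)) has_real_derivative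
      (2 * d s * d' s + k * (d s)\<^sup>2) * exp (k * s)) (at s)" if "s \<in> I" for k s
    by (rule derivative_eq_intros der[OF that] refl | simp add: algebra_simps)+
  have Icc: "{x..y} \<subseteq> I" if "x \<in> I" "y \<in> I" for x y
    using I(2) that by (meson connected_contains_Icc)
  have "(d t)\<^sup>2 * exp k \<le> 0" if "k = (if t0 \<le> t then - (2 * C) * t else (2 * C) * t)" for k
  proof (cases "t0 \<le> t")
    case True
    have "(d t)\<^sup>2 * exp (- (2 * C) * t) \<le> (d t0)\<^sup>2 * exp (- (2 * C) * t0)"
    proof (rule DERIV_nonpos_imp_nonincreasing[OF True])
      fix s assume "t0 \<le> s" "s \<le> t"
      then have s: "s \<in> I" using Icc[OF I(3) \<open>t \<in> I\<close>] by auto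
      show "\<exists>y. ((\<lambda>s. (d s)\<^sup>2 * exp (- (2 * C) * s)) has_real_derivative y) (at s) \<and> y \<le> 0"
      proof (intro exI conjI)
        show "((\<lambda>s. (d s)\<^sup>2 * exp (- (2 * C) * s)) has_real_derivative
            (2 * d s * d' s + - (2 * C) * (d s)\<^sup>2) * exp (- (2 * C) * s)) (at s)"
          by (rule der_e[OF s])
        show "(2 * d s * d' s + - (2 * C) * (d s)\<^sup>2) * exp (- (2 * C) * s) \<le> 0"
          using sq[OF s] by (intro mult_nonpos_nonneg) auto
      qed
    qed
    then show ?thesis using True that I(4) by simp
  next
    case False
    then have "t \<le> t0" by simp
    have "(d t)\<^sup>2 * exp ((2 * C) * t) \<le> (d t0)\<^sup>2 * exp ((2 * C) * t0)"
    proof (rule DERIV_nonneg_imp_nondecreasing[OF \<open>t \<le> t0\<close>])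
      fix s assume "t \<le> s" "s \<le> t0"
      then have s: "s \<in> I" using Icc[OF \<open>t \<in> I\<close> I(3)] by auto
      show "\<exists>y. ((\<lambda>s. (d s)\<^sup>2 * exp ((2 * C) * s)) has_real_derivative y) (at s) \<and> y \<ge> 0"
      proof (intro exI conjI)
        show "((\<lambda>s. (d s)\<^sup>2 * exp ((2 * C) * s)) has_real_derivative
            (2 * d s * d' s + 2 * C * (d s)\<^sup>2) * exp ((2 * C) * s)) (at s)"
          by (rule der_e[OF s])
        show "(2 * d s * d' s + 2 * C * (d s)\<^sup>2) * exp ((2 * C) * s) \<ge> 0"
          using sq[OF s] by (intro mult_nonneg_nonneg) auto
      qed
    qed
    then show ?thesis using False that I(4) by simp
  qed
  then show ?thesis
    by (metis exp_gt_zero mult_le_0_iff not_le power2_eq_iff_nonneg power_zero_numeral zero_le_power2 zero_less_power2)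
qed

section \<open>Foliations by monotone graphs\<close>

text \<open>The label of the leaf through \<open>(x, y)\<close>.\<close>

definition level :: "(real \<Rightarrow> real \<Rightarrow> real) \<Rightarrow> real \<Rightarrow> real \<Rightarrow> real" where
  "level Y x y = inv (Y x) y"

text \<open>The plane is filled by the graphs of the functions \<open>\<lambda>x. Y x s\<close>. A leaf is labelled by the height \<open>s\<close>
  at which it meets the vertical axis, and \<open>\<epsilon>\<close> is the common sign of the slopes.\<close>

locale foliation =
  fixes \<epsilon> :: real and Y :: "real \<Rightarrow> real \<Rightarrow> real"
  assumes eps: "\<epsilon> = 1 \<or> \<epsilon> = - 1"
    and cont_leaf: "continuous_on UNIV (\<lambda>(x, s). Y x s)"
    and leaf_0: "Y 0 s = s"
    and leaf_mono: "strict_mono (Y x)"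
    and leaf_surj: "surj (Y x)"
    and leaf_slope: "strict_mono (\<lambda>x. \<epsilon> * Y x s)"
    and leaf_meets_axis: "\<exists>x. Y x s = 0"
begin

lemma level_eq_iff: "level Y x y = s \<longleftrightarrow> Y x s = y"
  unfolding level_def
  by (metis inv_f_f leaf_mono leaf_surj strict_mono_on_imp_inj_on surj_f_inv_f)

lemma leaf_level [simp]: "Y x (level Y x y) = y"
  using level_eq_iff by blast

lemma level_0 [simp]: "level Y 0 y = y"
  by (simp add: level_eq_iff leaf_0)

lemma level_anti:
  assumes "x < x'"
  shows "\<epsilon> * level Y x' y < \<epsilon> * level Y x y"
proof -
  have "\<epsilon> * y < \<epsilon> * Y x' (level Y x y)"
    using strict_monoD[OF leaf_slope assms, of "level Y x y"] by simp
  then have "\<epsilon> * Y x' (level Y x' y) < \<epsilon> * Y x' (level Y x y)"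
    by simp
  then show ?thesis
    using eps strict_mono_less[OF leaf_mono[of x'], of "level Y x' y" "level Y x y"]
      strict_mono_less[OF leaf_mono[of x'], of "level Y x y" "level Y x' y"] by auto
qed

text \<open>The map \<open>(x, s) \<mapsto> (x, Y x s)\<close> is a continuous bijection of the plane, so its inverse is continuous by
  invariance of domain.\<close>

lemma continuous_on_level: "continuous_on UNIV (\<lambda>(x, y). level Y x y)"
proof -
  define f where "f = (\<lambda>(x, s). (x, Y x s))"
  have "continuous_on UNIV f"
    using cont_leaf by (auto simp: f_def split_beta intro!: continuous_intros)
  moreover have "inj f"
    by (rule injI) (auto simp: f_def strict_mono_eq[OF leaf_mono])
  ultimately obtain g where g: "homeomorphism UNIV (range f) f g"
    using invariance_of_domain_homeomorphism[of UNIV f] by auto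
  have f_level: "f (x, level Y x y) = (x, y)" for x y
    by (simp add: f_def)
  then have "p \<in> range f" for p
    by (intro range_eqI[of _ _ "(fst p, level Y (fst p) (snd p))"]) simp
  then have "range f = UNIV"
    by blast
  moreover have "g (x, y) = (x, level Y x y)" for x y
    using homeomorphism_apply1[OF g, of "(x, level Y x y)"] f_level by simp
  then have "(\<lambda>(x, y). level Y x y) = (\<lambda>p. snd (g p))"
    by auto
  ultimately show ?thesis
    using homeomorphism_cont2[OF g] by (auto intro!: continuous_intros)
qed

lemma axis_level_bij: "bij (\<lambda>x. level Y x 0)"
proof (rule bijI)
  show "inj (\<lambda>x. level Y x 0)"
    by (intro linorder_inj_onI') (metis level_anti less_irrefl)
  show "surj (\<lambda>x. level Y x 0)"
    using leaf_meets_axis level_eq_iff by (metis surjI surj_def)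
qed

text \<open>Along a leaf with label \<open>s\<close> the quantity \<open>x' = (y - \<phi> s) / m\<close> makes the point \<open>(x', y)\<close> move on the
  line of slope \<open>m\<close> through \<open>(0, \<phi> s)\<close>. It increases in \<open>x\<close> because, at the same height, a point further right lies on a
  leaf with lower label if the slopes are positive, and with higher label if they are negative.\<close>

lemma transversal_strict_mono:
  assumes "strict_mono \<phi>" "\<epsilon> * m > 0"
  shows "strict_mono (\<lambda>x. (y - \<phi> (level Y x y)) / m)"
proof (rule strict_monoI)
  fix x x' :: real assume "x < x'"
  then have "\<epsilon> * level Y x' y < \<epsilon> * level Y x y"
    by (rule level_anti)
  then show "(y - \<phi> (level Y x y)) / m < (y - \<phi> (level Y x' y)) / m"
    using eps assms by (auto simp: divide_strict_right_mono divide_strict_right_mono_neg strict_mono_less)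
qed

end

lemma strict_mono_glue:
  fixes f g h :: "real \<Rightarrow> real"
  assumes "strict_mono f" "strict_mono g"
    and "\<And>x. x \<le> 0 \<Longrightarrow> h x = f x" "\<And>x. x \<ge> 0 \<Longrightarrow> h x = g x"
  shows "strict_mono h"
proof (rule strict_monoI)
  fix x y :: real assume "x < y"
  consider "y \<le> 0" | "x \<ge> 0" | "x < 0" "0 < y" by linarith
  then show "h x < h y"
  proof cases
    case 3
    then have "h x < h 0 \<and> h 0 < h y"
      using strict_monoD[OF assms(1), of x 0] strict_monoD[OF assms(2), of 0 y]
        assms(3)[of x] assms(3)[of 0] assms(4)[of 0] assms(4)[of y] by simp
    then show ?thesis by simp
  qed (use \<open>x < y\<close> assms in \<open>auto simp: strict_mono_less\<close>)
qed

lemma strict_mono_surj_continuous: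
  fixes f :: "real \<Rightarrow> real"
  assumes "strict_mono f" "surj f"
  shows "continuous_on UNIV f"
  using assms by (intro continuous_onI_mono) (auto simp: strict_mono_less_eq)

text \<open>The leaves of \<open>YT\<close>, used where \<open>\<epsilon> * x * y \<le> 0\<close>, become lines of slope \<open>mT\<close> with unchanged labels.
  This fixes the map on the horizontal axis. The leaves of \<open>YR\<close>, used in the other two quadrants, become
  lines of slope \<open>mR\<close>. There a leaf that meets the vertical side of the quadrant keeps its label, and one
  that meets the horizontal side is relabelled by \<open>\<psi>\<close>, the function that reproduces the map already
  fixed on the horizontal axis. The two rules agree at the leaf through the origin. The relabellings
  \<open>\<phi>p\<close> for the upper and \<open>\<phi>m\<close> for the lower quadrant differ because the vertical side carries the
  positive labels above and the negative labels below.\<close>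

lemma transversal_coordinate:
  assumes T: "foliation \<epsilon> YT" and R: "foliation \<epsilon> YR" and mT: "\<epsilon> * mT > 0" and mR: "\<epsilon> * mR > 0"
  obtains H \<phi>p \<phi>m where
    "continuous_on UNIV (\<lambda>(x, y). H x y :: real)"
    "\<And>y. strict_mono (\<lambda>x. H x y)"
    "\<And>y. H 0 y = 0"
    "strict_mono (\<phi>p :: real \<Rightarrow> real)" "strict_mono (\<phi>m :: real \<Rightarrow> real)"
    "\<And>x y. \<epsilon> * x * y \<le> 0 \<Longrightarrow> H x y = (y - level YT x y) / mT"
    "\<And>x y. \<epsilon> * x \<ge> 0 \<Longrightarrow> y \<ge> 0 \<Longrightarrow> H x y = (y - \<phi>p (level YR x y)) / mR"
    "\<And>x y. \<epsilon> * x \<le> 0 \<Longrightarrow> y \<le> 0 \<Longrightarrow> H x y = (y - \<phi>m (level YR x y)) / mR"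
proof -
  interpret T: foliation \<epsilon> YT by fact
  interpret R: foliation \<epsilon> YR by fact
  have \<epsilon>: "\<epsilon> = 1 \<or> \<epsilon> = - 1" by (rule T.eps)
  have \<kappa>: "mR / mT > 0"
    using mT mR \<epsilon> by (auto simp: zero_less_divide_iff)
  \<comment> \<open>The first coordinate of the point where a leaf of \<open>YR\<close> meets the horizontal axis.\<close>
  define \<rho> where "\<rho> = inv (\<lambda>x. level YR x 0)"
  have \<rho>: "level YR (\<rho> s) 0 = s" "\<rho> (level YR x 0) = x" for s x
    using R.axis_level_bij unfolding \<rho>_def
    by (metis bij_inv_eq_iff)+
  define \<psi> where "\<psi> s = mR / mT * level YT (\<rho> s) 0" for s
  have \<psi>_level: "\<psi> (level YR x 0) = mR / mT * level YT x 0" for x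
    by (simp add: \<psi>_def \<rho>)
  have \<psi>_mono: "strict_mono \<psi>"
  proof (rule strict_monoI)
    fix s t :: real assume "s < t"
    show "\<psi> s < \<psi> t"
    proof (cases "\<epsilon> = 1")
      case True
      have "\<rho> t < \<rho> s"
      proof (rule ccontr)
        assume "\<not> \<rho> t < \<rho> s"
        then have "\<rho> s < \<rho> t \<or> \<rho> s = \<rho> t" by auto
        then show False
          using R.level_anti[of "\<rho> s" "\<rho> t" 0] \<rho>(1)[of s] \<rho>(1)[of t] \<open>s < t\<close> True by auto
      qed
      then have "level YT (\<rho> s) 0 < level YT (\<rho> t) 0"
        using T.level_anti[of "\<rho> t" "\<rho> s" 0] True by simp
      then show ?thesis
        unfolding \<psi>_def using \<kappa> by (rule mult_strict_left_mono)
    next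
      case False
      then have \<epsilon>: "\<epsilon> = -1" using \<epsilon> by simp
      have "\<rho> s < \<rho> t"
      proof (rule ccontr)
        assume "\<not> \<rho> s < \<rho> t"
        then have "\<rho> t < \<rho> s \<or> \<rho> s = \<rho> t" by auto
        then show False
          using R.level_anti[of "\<rho> t" "\<rho> s" 0] \<rho>(1)[of s] \<rho>(1)[of t] \<open>s < t\<close> \<epsilon> by auto
      qed
      then have "level YT (\<rho> s) 0 < level YT (\<rho> t) 0"
        using T.level_anti[of "\<rho> s" "\<rho> t" 0] \<epsilon> by simp
      then show ?thesis
        unfolding \<psi>_def using \<kappa> by (rule mult_strict_left_mono)
    qed
  qed
  have "surj \<psi>"
    unfolding surj_def
  proof
    fix t
    obtain x where "level YT x 0 = t / (mR / mT)"
      using T.axis_level_bij by (metis bij_pointE)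
    then have "t = \<psi> (level YR x 0)"
      unfolding \<psi>_level using mT mR by auto
    then show "\<exists>s. t = \<psi> s" ..
  qed
  with \<psi>_mono have \<psi>_cont: "continuous_on UNIV \<psi>"
    by (rule strict_mono_surj_continuous)
  have \<psi>_0: "\<psi> 0 = 0"
    using \<psi>_level[of 0] by simp
  have \<psi>_sgn: "\<psi> s > 0 \<longleftrightarrow> s > 0" "\<psi> s < 0 \<longleftrightarrow> s < 0" for s
    using strict_mono_less[OF \<psi>_mono, of 0 s] strict_mono_less[OF \<psi>_mono, of s 0] \<psi>_0 by auto
  define \<phi>p where "\<phi>p s = max s 0 + min (\<psi> s) 0" for s
  define \<phi>m where "\<phi>m s = min s 0 + max (\<psi> s) 0" for s
  have \<phi>p: "s \<ge> 0 \<Longrightarrow> \<phi>p s = s" "s \<le> 0 \<Longrightarrow> \<phi>p s = \<psi> s"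
    and \<phi>m: "s \<le> 0 \<Longrightarrow> \<phi>m s = s" "s \<ge> 0 \<Longrightarrow> \<phi>m s = \<psi> s" for s
    using \<psi>_sgn[of s] by (auto simp: \<phi>p_def \<phi>m_def max_def min_def)
  have id_mono: "strict_mono (\<lambda>s::real. s)"
    by (rule strict_monoI)
  have mono: "strict_mono \<phi>p" "strict_mono \<phi>m"
    by (rule strict_mono_glue[OF \<psi>_mono id_mono \<phi>p(2,1)] strict_mono_glue[OF id_mono \<psi>_mono \<phi>m]; assumption)+
  define A where "A x y = (y - level YT x y) / mT" for x y
  define B where "B \<phi> x y = (y - \<phi> (level YR x y)) / mR" for \<phi> and x y :: real
  have A_mono: "strict_mono (\<lambda>x. A x y)" for y
    unfolding A_def by (rule T.transversal_strict_mono[OF id_mono mT])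
  have B_mono: "strict_mono (\<lambda>x. B \<phi> x y)" if "strict_mono \<phi>" for \<phi> y
    unfolding B_def by (rule R.transversal_strict_mono[OF that mR])
  have A_0: "A 0 y = 0" for y
    by (simp add: A_def)
  define H where "H x y = (if \<epsilon> * x * y \<le> 0 then A x y else B (if y \<ge> 0 then \<phi>p else \<phi>m) x y)" for x y
  have level_sgn: "\<epsilon> * x \<ge> 0 \<Longrightarrow> level YR x 0 \<le> 0" "\<epsilon> * x \<le> 0 \<Longrightarrow> level YR x 0 \<ge> 0" for x
    using R.level_anti[of x 0 0] R.level_anti[of 0 x 0] \<epsilon> by (cases x "0::real" rule: linorder_cases; force)+
  have AB_axis: "mR / mT * level YT x 0 / mR = level YT x 0 / mT" for x
    using mR by auto
  have HA: "H x y = A x y" if "\<epsilon> * x * y \<le> 0" for x y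
    using that by (simp add: H_def)
  have HBp: "H x y = B \<phi>p x y" if xy: "\<epsilon> * x \<ge> 0" "y \<ge> 0" for x y
  proof (cases "\<epsilon> * x * y \<le> 0")
    case True
    with xy \<epsilon> have "x = 0 \<or> y = 0"
      by (auto simp: mult_le_0_iff)
    then show ?thesis
    proof
      assume "y = 0"
      have "\<phi>p (level YR x 0) = mR / mT * level YT x 0"
        using level_sgn(1)[OF xy(1)] by (simp add: \<phi>p(2) \<psi>_level)
      then show ?thesis
        using AB_axis[of x] by (simp add: \<open>y = 0\<close> H_def A_def B_def)
    qed (use xy in \<open>simp add: H_def A_def B_def \<phi>p\<close>)
  qed (use xy in \<open>simp add: H_def\<close>)
  have HBm: "H x y = B \<phi>m x y" if xy: "\<epsilon> * x \<le> 0" "y \<le> 0" for x y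
  proof (cases "\<epsilon> * x * y \<le> 0")
    case True
    with xy \<epsilon> have "x = 0 \<or> y = 0"
      by (auto simp: mult_le_0_iff)
    then show ?thesis
    proof
      assume "y = 0"
      have "\<phi>m (level YR x 0) = mR / mT * level YT x 0"
        using level_sgn(2)[OF xy(1)] by (simp add: \<phi>m(2) \<psi>_level)
      then show ?thesis
        using AB_axis[of x] by (simp add: \<open>y = 0\<close> H_def A_def B_def)
    qed (use xy in \<open>simp add: H_def A_def B_def \<phi>m\<close>)
  next
    case False
    with xy have "y \<noteq> 0" by auto
    with False xy show ?thesis by (simp add: H_def)
  qed
  have H_mono: "strict_mono (\<lambda>x. H x y)" for y
  proof -
    consider "y = 0" | "y > 0" "\<epsilon> = 1" | "y > 0" "\<epsilon> = -1" | "y < 0" "\<epsilon> = 1" | "y < 0" "\<epsilon> = -1"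
      using \<epsilon> by linarith
    then show ?thesis
    proof cases
      case 1
      then show ?thesis
        using A_mono[of 0] by (simp add: HA)
    next
      case 2
      then show ?thesis
        by (intro strict_mono_glue[OF A_mono[of y] B_mono[OF mono(1), of y]] HA HBp)
          (auto simp: mult_le_0_iff zero_le_mult_iff)
    next
      case 3
      then show ?thesis
        by (intro strict_mono_glue[OF B_mono[OF mono(1), of y] A_mono[of y]] HA HBp)
          (auto simp: mult_le_0_iff zero_le_mult_iff)
    next
      case 4
      then show ?thesis
        by (intro strict_mono_glue[OF B_mono[OF mono(2), of y] A_mono[of y]] HA HBm)
          (auto simp: mult_le_0_iff zero_le_mult_iff)
    next
      case 5
      then show ?thesis
        by (intro strict_mono_glue[OF A_mono[of y] B_mono[OF mono(2), of y]] HA HBm)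
          (auto simp: mult_le_0_iff zero_le_mult_iff)
    qed
  qed
  have "continuous_on UNIV (\<lambda>p. H (fst p) (snd p))"
  proof -
    define Q where "Q = {p :: real \<times> real. \<epsilon> * fst p * snd p \<le> 0}"
    define Qp where "Qp = {p :: real \<times> real. \<epsilon> * fst p \<ge> 0 \<and> snd p \<ge> 0}"
    define Qm where "Qm = {p :: real \<times> real. \<epsilon> * fst p \<le> 0 \<and> snd p \<le> 0}"
    have cl: "closed Q" "closed Qp" "closed Qm"
      unfolding Q_def Qp_def Qm_def
      by (intro closed_Collect_conj closed_Collect_le continuous_intros)+
    have cT: "continuous_on S (\<lambda>p. level YT (fst p) (snd p))"
      and cR: "continuous_on S (\<lambda>p. level YR (fst p) (snd p))" for S
      using T.continuous_on_level R.continuous_on_level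
      by (auto simp: split_beta intro: continuous_on_subset)
    have cA: "continuous_on S (\<lambda>p. A (fst p) (snd p))" for S
      unfolding A_def using mT by (intro continuous_intros cT) auto
    have cB: "continuous_on S (\<lambda>p. B \<phi> (fst p) (snd p))" if "continuous_on UNIV \<phi>" for S \<phi>
      unfolding B_def using mR
      by (intro continuous_intros continuous_on_compose2[OF that cR]) auto
    have c\<phi>: "continuous_on UNIV \<phi>p" "continuous_on UNIV \<phi>m"
      unfolding \<phi>p_def \<phi>m_def using \<psi>_cont by (auto intro!: continuous_intros)
    have "continuous_on (Q \<union> (Qp \<union> Qm)) (\<lambda>p. H (fst p) (snd p))"
    proof (intro continuous_on_closed_Un cl closed_Un)
      show "continuous_on Q (\<lambda>p. H (fst p) (snd p))"
        using cA by (rule continuous_on_eq) (simp add: HA Q_def)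
      show "continuous_on Qp (\<lambda>p. H (fst p) (snd p))"
        using cB[OF c\<phi>(1)] by (rule continuous_on_eq) (simp add: HBp Qp_def)
      show "continuous_on Qm (\<lambda>p. H (fst p) (snd p))"
        using cB[OF c\<phi>(2)] by (rule continuous_on_eq) (simp add: HBm Qm_def)
    qed
    moreover have "p \<in> Q \<union> (Qp \<union> Qm)" for p
      unfolding Q_def Qp_def Qm_def Un_iff mem_Collect_eq by (metis linear mult_le_0_iff)
    then have "Q \<union> (Qp \<union> Qm) = UNIV"
      by blast
    ultimately show ?thesis by simp
  qed
  then have H_cont: "continuous_on UNIV (\<lambda>(x, y). H x y)"
    by (simp add: split_beta)
  have H_0: "H 0 y = 0" for y
    by (simp add: HA A_0)
  show thesis
    by (rule that[OF H_cont H_mono H_0 mono HA[unfolded A_def] HBp[unfolded B_def] HBm[unfolded B_def]])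
qed

text \<open>The two foliations are attached to the sign of \<open>x * y\<close>, as the two fields of a piecewise smooth system
  are; which of them plays which part in the construction depends on \<open>\<epsilon>\<close>.\<close>

lemma transversal_coordinate_quadrants:
  assumes P: "foliation \<epsilon> Yp" and N: "foliation \<epsilon> Yn" and mp: "\<epsilon> * mp > 0" and mn: "\<epsilon> * mn > 0"
  obtains H where
    "continuous_on UNIV (\<lambda>(x, y). H x y :: real)"
    "\<And>y. strict_mono (\<lambda>x. H x y)"
    "\<And>y. H 0 y = 0"
    "\<And>s1 s2 :: real. s1 = 1 \<or> s1 = - 1 \<Longrightarrow> s2 = 1 \<or> s2 = - 1 \<Longrightarrow>
      \<exists>\<phi> :: real \<Rightarrow> real. strict_mono \<phi> \<and> (\<forall>x y. s1 * x > 0 \<longrightarrow> s2 * y > 0 \<longrightarrow>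
        H x y = (y - \<phi> (level (if s1 * s2 > 0 then Yp else Yn) x y)) / (if s1 * s2 > 0 then mp else mn))"
proof -
  have id: "strict_mono (\<lambda>s::real. s)"
    by (rule strict_monoI)
  have "\<epsilon> = 1 \<or> \<epsilon> = - 1"
    using P by (rule foliation.eps)
  then show thesis
  proof
    assume \<epsilon>: "\<epsilon> = 1"
    show thesis
    proof (rule transversal_coordinate[OF N P mn mp])
      fix H \<phi>p \<phi>m
      assume H: "continuous_on UNIV (\<lambda>(x, y). H x y :: real)"
        "\<And>y. strict_mono (\<lambda>x. H x y)" "\<And>y. H 0 y = 0"
        and \<phi>: "strict_mono (\<phi>p :: real \<Rightarrow> real)" "strict_mono (\<phi>m :: real \<Rightarrow> real)"
        "\<And>x y. \<epsilon> * x * y \<le> 0 \<Longrightarrow> H x y = (y - level Yn x y) / mn"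
        "\<And>x y. \<epsilon> * x \<ge> 0 \<Longrightarrow> y \<ge> 0 \<Longrightarrow> H x y = (y - \<phi>p (level Yp x y)) / mp"
        "\<And>x y. \<epsilon> * x \<le> 0 \<Longrightarrow> y \<le> 0 \<Longrightarrow> H x y = (y - \<phi>m (level Yp x y)) / mp"
      show thesis
      proof (rule that[OF H])
        fix s1 s2 :: real assume s: "s1 = 1 \<or> s1 = - 1" "s2 = 1 \<or> s2 = - 1"
        then consider "s1 = 1" "s2 = 1" | "s1 = -1" "s2 = -1" | "s1 * s2 = -1" by auto
        then show "\<exists>\<phi> :: real \<Rightarrow> real. strict_mono \<phi> \<and> (\<forall>x y. s1 * x > 0 \<longrightarrow> s2 * y > 0 \<longrightarrow>
          H x y = (y - \<phi> (level (if s1 * s2 > 0 then Yp else Yn) x y)) / (if s1 * s2 > 0 then mp else mn))"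
        proof cases
          case 1
          then show ?thesis using \<phi>(4) \<phi>(1) \<epsilon> by (intro exI[of _ \<phi>p]) simp
        next
          case 2
          then show ?thesis using \<phi>(5) \<phi>(2) \<epsilon> by (intro exI[of _ \<phi>m]) simp
        next
          case 3
          then have "x * y \<le> 0" if "s1 * x > 0" "s2 * y > 0" for x y
            using s that by (auto simp: mult_le_0_iff)
          then show ?thesis using \<phi>(3) id \<epsilon> 3 by (intro exI[of _ "\<lambda>s. s"]) simp
        qed
      qed
    qed
  next
    assume \<epsilon>: "\<epsilon> = - 1"
    show thesis
    proof (rule transversal_coordinate[OF P N mp mn])
      fix H \<phi>p \<phi>m
      assume H: "continuous_on UNIV (\<lambda>(x, y). H x y :: real)"
        "\<And>y. strict_mono (\<lambda>x. H x y)" "\<And>y. H 0 y = 0"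
        and \<phi>: "strict_mono (\<phi>p :: real \<Rightarrow> real)" "strict_mono (\<phi>m :: real \<Rightarrow> real)"
        "\<And>x y. \<epsilon> * x * y \<le> 0 \<Longrightarrow> H x y = (y - level Yp x y) / mp"
        "\<And>x y. \<epsilon> * x \<ge> 0 \<Longrightarrow> y \<ge> 0 \<Longrightarrow> H x y = (y - \<phi>p (level Yn x y)) / mn"
        "\<And>x y. \<epsilon> * x \<le> 0 \<Longrightarrow> y \<le> 0 \<Longrightarrow> H x y = (y - \<phi>m (level Yn x y)) / mn"
      show thesis
      proof (rule that[OF H])
        fix s1 s2 :: real assume s: "s1 = 1 \<or> s1 = - 1" "s2 = 1 \<or> s2 = - 1"
        then consider "s1 = -1" "s2 = 1" | "s1 = 1" "s2 = -1" | "s1 * s2 = 1" by auto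
        then show "\<exists>\<phi> :: real \<Rightarrow> real. strict_mono \<phi> \<and> (\<forall>x y. s1 * x > 0 \<longrightarrow> s2 * y > 0 \<longrightarrow>
          H x y = (y - \<phi> (level (if s1 * s2 > 0 then Yp else Yn) x y)) / (if s1 * s2 > 0 then mp else mn))"
        proof cases
          case 1
          then show ?thesis using \<phi>(4) \<phi>(1) \<epsilon> by (intro exI[of _ \<phi>p]) simp
        next
          case 2
          then show ?thesis using \<phi>(5) \<phi>(2) \<epsilon> by (intro exI[of _ \<phi>m]) simp
        next
          case 3
          then have "x * y \<ge> 0" if "s1 * x > 0" "s2 * y > 0" for x y
            using s that by (auto simp: zero_le_mult_iff)
          then show ?thesis using \<phi>(3) id \<epsilon> 3 by (intro exI[of _ "\<lambda>s. s"]) simp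
        qed
      qed
    qed
  qed
qed

section \<open>The foliation by the orbits of a planar field\<close>

definition pt :: "real \<Rightarrow> real \<Rightarrow> plane" where
  "pt x y = x *\<^sub>R axis 1 1 + y *\<^sub>R axis 2 1"

lemma pt_nth [simp]: "pt x y $ 1 = x" "pt x y $ 2 = y"
  by (simp_all add: pt_def axis_def)

lemma pt_eta [simp]: "pt (p $ 1) (p $ 2) = p"
  by (simp add: vec_eq_iff forall_2)

lemma continuous_on_pt [continuous_intros]:
  "continuous_on S f \<Longrightarrow> continuous_on S g \<Longrightarrow> continuous_on S (\<lambda>x. pt (f x) (g x))"
  unfolding pt_def by (intro continuous_intros)

definition square :: "real \<Rightarrow> plane set" where
  "square e = {p. \<bar>p $ 1\<bar> \<le> e \<and> \<bar>p $ 2\<bar> \<le> e}"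

lemma compact_square: "compact (square e)"
proof -
  have "square e = cbox (pt (-e) (-e)) (pt e e)"
    by (rule set_eqI) (auto simp: square_def mem_box_cart forall_2 abs_le_iff)
  then show ?thesis by simp
qed

lemma pt_in_square [simp]: "pt x y \<in> square e \<longleftrightarrow> \<bar>x\<bar> \<le> e \<and> \<bar>y\<bar> \<le> e"
  by (simp add: square_def)

lemma square_subset_open:
  assumes "open S" "0 \<in> S"
  obtains e where "e > 0" "square e \<subseteq> S"
proof -
  obtain d where d: "d > 0" "ball 0 d \<subseteq> S"
    using assms by (auto simp: open_contains_ball)
  have "norm p < d" if "p \<in> square (d / 3)" for p
  proof -
    have "norm p \<le> \<bar>p $ 1\<bar> + \<bar>p $ 2\<bar>"
      using norm_le_l1_cart[of p] by (simp add: sum_2)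
    then show ?thesis
      using that d(1) by (auto simp: square_def)
  qed
  then have "square (d / 3) \<subseteq> S"
    using d(2) by (auto simp: subset_iff)
  then show thesis
    using that[of "d / 3"] d(1) by simp
qed

lemma near_identity_surj:
  fixes f :: "real \<Rightarrow> real"
  assumes "continuous_on UNIV f" "\<And>x. \<bar>f x - x\<bar> \<le> C"
  shows "\<exists>x. f x = y"
proof -
  have "f (y - C) \<le> y" "y \<le> f (y + C)" "y - C \<le> y + C"
    using assms(2)[of "y - C"] assms(2)[of "y + C"] by auto
  then show ?thesis
    using IVT'[of f "y - C" y "y + C"] continuous_on_subset[OF assms(1)] by blast
qed

lemma slope_lipschitz:
  fixes a b a' b' :: real
  assumes "\<bar>a\<bar> \<le> M" "\<bar>b\<bar> \<le> M" "\<mu> \<le> \<bar>b\<bar>" "\<mu> \<le> \<bar>b'\<bar>" "\<mu> > 0" "\<bar>a - a'\<bar> \<le> D" "\<bar>b - b'\<bar> \<le> D"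
  shows "\<bar>a / b - a' / b'\<bar> \<le> 2 * M / \<mu>\<^sup>2 * D"
proof -
  have nz: "b \<noteq> 0" "b' \<noteq> 0" using assms by auto
  have "a / b - a' / b' = (b * (a - a') - a * (b - b')) / (b * b')"
    using nz by (simp add: field_simps)
  then have "\<bar>a / b - a' / b'\<bar> = \<bar>b * (a - a') - a * (b - b')\<bar> / \<bar>b * b'\<bar>"
    by simp
  also have "\<dots> \<le> (2 * M * D) / \<mu>\<^sup>2"
  proof (rule frac_le)
    have "\<bar>b * (a - a')\<bar> \<le> M * D" "\<bar>a * (b - b')\<bar> \<le> M * D"
      unfolding abs_mult using assms by (intro mult_mono; linarith)+
    then show "\<bar>b * (a - a') - a * (b - b')\<bar> \<le> 2 * M * D" "0 \<le> 2 * M * D" by linarith+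
    show "\<mu>\<^sup>2 \<le> \<bar>b * b'\<bar>"
      unfolding abs_mult power2_eq_square using assms by (intro mult_mono) auto
  qed (use assms in simp)
  finally show ?thesis by simp
qed

text \<open>Over \<open>[-\<delta>, \<delta>]\<close> the leaves are solutions of \<open>y' = F (x, y)\<close>, outside they continue as straight lines
  of slope \<open>\<epsilon>\<close>. Thus every leaf is an unbounded graph and meets the horizontal axis. Two leaves never
  meet, by \<open>gronwall_zero\<close>.\<close>

lemma foliation_of_slope:
  fixes F :: "real \<times> real \<Rightarrow> real"
  assumes F: "continuous_on UNIV F" "\<And>p. \<bar>F p\<bar> \<le> M"
    and L: "\<And>x y z. \<bar>F (x, y) - F (x, z)\<bar> \<le> L * \<bar>y - z\<bar>"
    and \<epsilon>: "\<epsilon> = 1 \<or> \<epsilon> = - 1" and sgn: "\<And>p. \<epsilon> * F p > 0" and e: "e > 0"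
  obtains \<delta> Y where "0 < \<delta>" "\<delta> \<le> e" "foliation \<epsilon> Y"
    "\<And>x s. \<bar>x\<bar> < \<delta> \<Longrightarrow> ((\<lambda>x. Y x s) has_real_derivative F (x, Y x s)) (at x)"
proof -
  have L0: "L \<ge> 0"
    using L[of 0 0 1] by auto
  \<comment> \<open>The contraction is set up on \<open>[-2 * \<delta>, 2 * \<delta>]\<close>, so that the equation holds at the ends of \<open>[-\<delta>, \<delta>]\<close> as well.\<close>
  define \<delta> where "\<delta> = min e (1 / (2 * L + 2))"
  have \<delta>: "0 < \<delta>" "\<delta> \<le> e" "2 * \<delta> * L < 1"
  proof -
    show "0 < \<delta>" "\<delta> \<le> e" using e L0 by (auto simp: \<delta>_def)
    have "2 * \<delta> * L \<le> 2 * (1 / (2 * L + 2)) * L"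
      using L0 by (intro mult_right_mono) (auto simp: \<delta>_def)
    also have "\<dots> < 1"
      using L0 by (simp add: field_simps)
    finally show "2 * \<delta> * L < 1" .
  qed
  obtain W :: "real \<times> real \<Rightarrow> real" and B where W: "continuous_on UNIV W" "\<And>p. \<bar>W p\<bar> \<le> B"
    "\<And>x s. W (x, s) = clamp1 (2 * \<delta>) x *
       integral {0..1} (\<lambda>u. F (u * clamp1 (2 * \<delta>) x, s + W (u * clamp1 (2 * \<delta>) x, s)))"
    using picard_fixed_point[OF F L, of "2 * \<delta>"] \<delta> by auto
  have W0: "W (0, s) = 0" for s
    using W(3)[of 0 s] \<delta> by (simp add: clamp1_id)
  have contW: "continuous_on S (\<lambda>x. W (f x, g x))" if "continuous_on S f" "continuous_on S g"
    for S and f g :: "'a::topological_space \<Rightarrow> real"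
    using that by (intro continuous_on_compose2[OF W(1)] continuous_intros) auto
  have W': "((\<lambda>x. s + W (x, s)) has_real_derivative F (x, s + W (x, s))) (at x)" if "\<bar>x\<bar> < 2 * \<delta>" for x s
  proof -
    have "((\<lambda>x. W (x, s)) has_real_derivative F (x, s + W (x, s))) (at x)"
    proof (rule integral_scaled_antiderivative[where \<delta> = "2 * \<delta>"])
      show "continuous_on {-(2*\<delta>)..2*\<delta>} (\<lambda>x. F (x, s + W (x, s)))"
        by (intro continuous_on_compose2[OF F(1)] continuous_intros contW) auto
      show "W (x, s) = x * integral {0..1} (\<lambda>u. F (u * x, s + W (u * x, s)))" if "\<bar>x\<bar> \<le> 2 * \<delta>" for x
        using W(3)[of x s] that by (simp add: clamp1_id)
    qed (use that \<delta> in auto)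
    then show ?thesis
      by (auto intro!: derivative_eq_intros)
  qed
  have W_mono: "s + W (x, s) < t + W (x, t)" if st: "s < t" and x: "\<bar>x\<bar> < 2 * \<delta>" for s t x
  proof -
    define d where "d x = (t + W (x, t)) - (s + W (x, s))" for x
    \<comment> \<open>If the difference of two solutions vanished anywhere, it would vanish at \<open>0\<close>, where it is \<open>t - s\<close>.\<close>
    let ?I = "{-(2*\<delta>)<..<2*\<delta>}"
    have d': "(d has_real_derivative F (x, t + W (x, t)) - F (x, s + W (x, s))) (at x)" if "x \<in> ?I" for x
      unfolding d_def using that by (intro DERIV_diff W') auto
    have nz: "d x \<noteq> 0" if "x \<in> ?I" for x
    proof
      assume "d x = 0"
      have "d 0 = 0"
      proof (rule gronwall_zero[OF _ _ that \<open>d x = 0\<close> d'])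
        show "\<bar>F (x, t + W (x, t)) - F (x, s + W (x, s))\<bar> \<le> L * \<bar>d x\<bar>" for x
          unfolding d_def by (rule L)
        show "0 \<in> ?I" using \<delta> by simp
      qed auto
      then show False
        using st by (simp add: d_def W0)
    qed
    have "d x > 0"
    proof (rule ccontr)
      assume "\<not> d x > 0"
      have "connected (d ` ?I)"
        by (intro connected_continuous_image continuous_at_imp_continuous_on ballI)
           (auto intro: DERIV_isCont[OF d'])
      moreover have "d 0 \<in> d ` ?I" "d x \<in> d ` ?I"
        using x \<delta> by (auto intro!: imageI)
      moreover have "d x \<le> 0" "0 \<le> d 0"
        using st \<open>\<not> d x > 0\<close> by (auto simp: d_def W0)
      ultimately have "0 \<in> d ` ?I"
        by (meson connectedD_interval)
      then show False
        using nz by auto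
    qed
    then show ?thesis by (simp add: d_def)
  qed
  have W_slope: "\<epsilon> * (s + W (x, s)) < \<epsilon> * (s + W (y, s))" if "x < y" "\<bar>x\<bar> \<le> \<delta>" "\<bar>y\<bar> \<le> \<delta>" for x y s
  proof (rule DERIV_pos_imp_increasing[OF \<open>x < y\<close>])
    fix z assume "x \<le> z" "z \<le> y"
    then have "\<bar>z\<bar> < 2 * \<delta>" using that \<delta> by auto
    then show "\<exists>y. ((\<lambda>x. \<epsilon> * (s + W (x, s))) has_real_derivative y) (at z) \<and> 0 < y"
      using sgn by (intro exI[of _ "\<epsilon> * F (z, s + W (z, s))"] conjI DERIV_cmult W') auto
  qed
  define Y where "Y x s = s + W (clamp1 \<delta> x, s) + \<epsilon> * (x - clamp1 \<delta> x)" for x s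
  have cl: "\<bar>clamp1 \<delta> x\<bar> < 2 * \<delta>" for x
    using clamp1_bound[of \<delta> x] \<delta>(1) by auto
  have "foliation \<epsilon> Y"
  proof
    show "\<epsilon> = 1 \<or> \<epsilon> = - 1" by fact
    show "continuous_on UNIV (\<lambda>(x, s). Y x s)"
      unfolding Y_def split_beta by (intro continuous_intros contW)
    show "Y 0 s = s" for s
      using \<delta> by (simp add: Y_def W0 clamp1_id)
    show "strict_mono (Y x)" for x
      unfolding Y_def by (rule strict_monoI) (use W_mono cl in auto)
    show "surj (Y x)" for x
    proof -
      have "continuous_on UNIV (Y x)"
        unfolding Y_def by (intro continuous_intros contW)
      moreover have "\<bar>Y x s - s\<bar> \<le> B + \<bar>\<epsilon> * (x - clamp1 \<delta> x)\<bar>" for s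
        using W(2)[of "(clamp1 \<delta> x, s)"] unfolding Y_def by linarith
      ultimately show ?thesis
        using near_identity_surj[of "Y x"] unfolding surj_def by metis
    qed
    show "strict_mono (\<lambda>x. \<epsilon> * Y x s)" for s
    proof (rule strict_monoI)
      fix x y :: real assume "x < y"
      have *: "\<epsilon> * Y x s = \<epsilon> * (s + W (clamp1 \<delta> x, s)) + (x - clamp1 \<delta> x)" for x
        using \<epsilon> by (auto simp: Y_def)
      have "clamp1 \<delta> x \<le> clamp1 \<delta> y" "x - clamp1 \<delta> x \<le> y - clamp1 \<delta> y"
        using \<open>x < y\<close> \<delta>(1) by (auto simp: clamp1_def)
      then show "\<epsilon> * Y x s < \<epsilon> * Y y s"
        using W_slope[of "clamp1 \<delta> x" "clamp1 \<delta> y" s] clamp1_bound[of \<delta>] \<delta>(1) \<open>x < y\<close>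
        unfolding * by (cases "clamp1 \<delta> x = clamp1 \<delta> y") fastforce+
    qed
    show "\<exists>x. Y x s = 0" for s
    proof -
      have "continuous_on UNIV (\<lambda>x. \<epsilon> * Y x s)"
        unfolding Y_def by (intro continuous_intros contW)
      moreover have "\<bar>\<epsilon> * Y x s - x\<bar> \<le> \<bar>s\<bar> + B + \<delta>" for x
        using W(2)[of "(clamp1 \<delta> x, s)"] clamp1_bound[of \<delta> x] \<delta>(1) \<epsilon> unfolding Y_def by auto
      ultimately obtain x where "\<epsilon> * Y x s = 0"
        using near_identity_surj[of "\<lambda>x. \<epsilon> * Y x s" _ 0] by blast
      then show ?thesis
        using \<epsilon> by auto
    qed
  qed
  moreover have "((\<lambda>x. Y x s) has_real_derivative F (x, Y x s)) (at x)" if x: "\<bar>x\<bar> < \<delta>" for x s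
  proof -
    have YW: "s + W (y, s) = Y y s" if "y \<in> {-\<delta><..<\<delta>}" for y
      using that clamp1_id[of y \<delta>] by (simp add: Y_def abs_if split: if_splits)
    have "((\<lambda>x. s + W (x, s)) has_real_derivative F (x, s + W (x, s))) (at x)"
      using x by (intro W') auto
    then have "((\<lambda>x. Y x s) has_real_derivative F (x, s + W (x, s))) (at x)"
      by (rule has_field_derivative_transform_within_open[of _ _ _ "{-\<delta><..<\<delta>}"])
        (use x YW in auto)
    then show ?thesis
      using YW[of x] x by (simp add: abs_less_iff minus_less_iff)
  qed
  ultimately show thesis
    using that \<delta> by blast
qed

text \<open>Over the rectangle given by \<open>\<delta>\<close> and \<open>e\<close> the leaves have the direction of \<open>V\<close>, and the integral curves of
  \<open>V\<close> stay on leaves. The second clause is the uniqueness of integral curves, in a form that does not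
  mention their parametrisation.\<close>

definition has_leaves :: "field \<Rightarrow> real \<Rightarrow> real \<Rightarrow> (real \<Rightarrow> real \<Rightarrow> real) \<Rightarrow> bool" where
  "has_leaves V \<delta> e Y \<longleftrightarrow>
     (\<forall>x s. \<bar>x\<bar> < \<delta> \<longrightarrow> \<bar>Y x s\<bar> \<le> e \<longrightarrow>
        ((\<lambda>x. Y x s) has_real_derivative V (pt x (Y x s)) $ 2 / V (pt x (Y x s)) $ 1) (at x)) \<and>
     (\<forall>I \<gamma>. open I \<longrightarrow> connected I \<longrightarrow>
        (\<forall>t\<in>I. \<bar>\<gamma> t $ 1\<bar> < \<delta> \<and> \<bar>\<gamma> t $ 2\<bar> \<le> e \<and> (\<gamma> has_vector_derivative V (\<gamma> t)) (at t)) \<longrightarrow>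
        (\<forall>s\<in>I. \<forall>t\<in>I. level Y (\<gamma> s $ 1) (\<gamma> s $ 2) = level Y (\<gamma> t $ 1) (\<gamma> t $ 2)))"

lemma has_leaves_derivative:
  assumes "has_leaves V \<delta> e Y" "\<bar>x\<bar> < \<delta>" "\<bar>Y x s\<bar> \<le> e"
  shows "((\<lambda>x. Y x s) has_real_derivative V (pt x (Y x s)) $ 2 / V (pt x (Y x s)) $ 1) (at x)"
  using assms unfolding has_leaves_def by blast

lemma has_leaves_level_constant:
  assumes "has_leaves V \<delta> e Y" "open I" "connected I" "s \<in> I" "t \<in> I"
    and "\<And>t. t \<in> I \<Longrightarrow> \<bar>\<gamma> t $ 1\<bar> < \<delta> \<and> \<bar>\<gamma> t $ 2\<bar> \<le> e"
    and "\<And>t. t \<in> I \<Longrightarrow> (\<gamma> has_vector_derivative V (\<gamma> t)) (at t)"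
  shows "level Y (\<gamma> s $ 1) (\<gamma> s $ 2) = level Y (\<gamma> t $ 1) (\<gamma> t $ 2)"
proof -
  have "\<forall>t\<in>I. \<bar>\<gamma> t $ 1\<bar> < \<delta> \<and> \<bar>\<gamma> t $ 2\<bar> \<le> e \<and> (\<gamma> has_vector_derivative V (\<gamma> t)) (at t)"
    using assms(6,7) by blast
  with assms(1-5) show ?thesis
    unfolding has_leaves_def by metis
qed

lemma has_leaves_mono:
  assumes "has_leaves V \<delta> e Y" "\<eta> \<le> \<delta>"
  shows "has_leaves V \<eta> e Y"
proof -
  have lt: "\<bar>x\<bar> < \<delta>" if "\<bar>x\<bar> < \<eta>" for x :: real
    using that assms(2) by simp
  show ?thesis
    unfolding has_leaves_def
  proof (intro conjI allI impI ballI)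
    fix x s assume "\<bar>x\<bar> < \<eta>" "\<bar>Y x s\<bar> \<le> e"
    then show "((\<lambda>x. Y x s) has_real_derivative V (pt x (Y x s)) $ 2 / V (pt x (Y x s)) $ 1) (at x)"
      by (intro has_leaves_derivative[OF assms(1)] lt)
  next
    fix I \<gamma> s t
    assume I: "open I" "connected I" "s \<in> I" "t \<in> I"
      and \<gamma>: "\<forall>t\<in>I. \<bar>\<gamma> t $ 1\<bar> < \<eta> \<and> \<bar>\<gamma> t $ 2\<bar> \<le> e \<and> (\<gamma> has_vector_derivative V (\<gamma> t)) (at t)"
    show "level Y (\<gamma> s $ 1) (\<gamma> s $ 2) = level Y (\<gamma> t $ 1) (\<gamma> t $ 2)"
      by (rule has_leaves_level_constant[OF assms(1) I]) (use \<gamma> lt in blast)+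
  qed
qed

text \<open>Evaluating the slope \<open>V p $ 2 / V p $ 1\<close> at the point of the square with clamped coordinates gives a
  slope function on the whole plane that is bounded, continuous and Lipschitz in \<open>y\<close>. Along an integral
  curve the height above a fixed leaf satisfies the hypotheses of \<open>gronwall_zero\<close>.\<close>

lemma foliation_of_field:
  fixes V :: field
  assumes cont: "continuous_on (square e) V" and e: "e > 0"
    and lip: "\<And>x y z. \<bar>x\<bar> \<le> e \<Longrightarrow> \<bar>y\<bar> \<le> e \<Longrightarrow> \<bar>z\<bar> \<le> e \<Longrightarrow> norm (V (pt x y) - V (pt x z)) \<le> L * \<bar>y - z\<bar>"
    and \<epsilon>: "\<epsilon> = 1 \<or> \<epsilon> = - 1" and sgn: "\<And>p. p \<in> square e \<Longrightarrow> \<epsilon> * (V p $ 1 * V p $ 2) > 0"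
  obtains \<delta> Y where "0 < \<delta>" "foliation \<epsilon> Y" "has_leaves V \<delta> e Y"
proof -
  have nz: "V p $ 1 \<noteq> 0" "V p $ 2 \<noteq> 0" if "p \<in> square e" for p
    using sgn[OF that] by auto
  have "bounded (V ` square e)"
    using compact_continuous_image[OF cont compact_square] by (rule compact_imp_bounded)
  then obtain M where M: "\<And>p. p \<in> square e \<Longrightarrow> norm (V p) \<le> M"
    by (auto simp: bounded_iff)
  have Mi: "\<bar>V p $ i\<bar> \<le> M" if "p \<in> square e" for p i
    using M[OF that] component_le_norm_cart[of "V p" i] by linarith
  have cont_i: "continuous_on (square e) (\<lambda>p. V p $ i)" for i
    using cont by (intro continuous_intros)
  obtain \<mu> where \<mu>: "\<mu> > 0" "\<And>p. p \<in> square e \<Longrightarrow> \<mu> \<le> \<bar>V p $ 1\<bar>"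
  proof -
    have "pt 0 0 \<in> square e" using e by simp
    moreover have "continuous_on (square e) (\<lambda>p. \<bar>V p $ 1\<bar>)"
      by (intro continuous_intros cont_i)
    ultimately obtain q where "q \<in> square e" "\<And>p. p \<in> square e \<Longrightarrow> \<bar>V q $ 1\<bar> \<le> \<bar>V p $ 1\<bar>"
      using continuous_attains_inf[OF compact_square] by (metis empty_iff)
    then show thesis
      using that[of "\<bar>V q $ 1\<bar>"] nz by auto
  qed
  define c where "c p = pt (clamp1 e (fst p)) (clamp1 e (snd p))" for p
  have c: "c p \<in> square e" for p
    using e clamp1_bound[of e] by (simp add: c_def)
  have contc: "continuous_on UNIV c"
    unfolding c_def by (intro continuous_intros)
  define F where "F p = V (c p) $ 2 / V (c p) $ 1" for p
  have contVc: "continuous_on UNIV (\<lambda>p. V (c p) $ i)" for i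
    using c by (intro continuous_on_compose2[OF cont_i contc]) auto
  have F: "continuous_on UNIV F"
    unfolding F_def using nz c by (intro continuous_intros contVc) auto
  have FM: "\<bar>F p\<bar> \<le> M / \<mu>" for p
    unfolding F_def abs_divide using Mi[OF c] \<mu> c
    by (intro frac_le) (auto intro: order_trans[OF abs_ge_zero])
  have FL: "\<bar>F (x, y) - F (x, z)\<bar> \<le> 2 * M / \<mu>\<^sup>2 * L * \<bar>y - z\<bar>" for x y z
  proof -
    have L0: "L \<ge> 0"
      using order_trans[OF norm_ge_zero lip[of 0 0 e]] e by (simp add: zero_le_mult_iff)
    have M0: "M \<ge> 0"
      using order_trans[OF norm_ge_zero M[OF c]] .
    let ?D = "L * \<bar>clamp1 e y - clamp1 e z\<bar>"
    have n: "norm (V (c (x, y)) - V (c (x, z))) \<le> ?D"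
      using lip clamp1_bound[of e] e by (simp add: c_def)
    have "\<bar>V (c (x, y)) $ i - V (c (x, z)) $ i\<bar> \<le> ?D" for i
      using component_le_norm_cart[of "V (c (x, y)) - V (c (x, z))" i] n by simp
    then have "\<bar>F (x, y) - F (x, z)\<bar> \<le> 2 * M / \<mu>\<^sup>2 * ?D"
      unfolding F_def using Mi \<mu> c by (intro slope_lipschitz) auto
    also have "\<dots> \<le> 2 * M / \<mu>\<^sup>2 * (L * \<bar>y - z\<bar>)"
      using clamp1_lipschitz L0 M0 by (intro mult_left_mono) auto
    finally show ?thesis by (simp add: mult.assoc)
  qed
  have F_sgn: "\<epsilon> * F p > 0" for p
  proof -
    have "\<epsilon> * F p = \<epsilon> * (V (c p) $ 1 * V (c p) $ 2) / (V (c p) $ 1)\<^sup>2"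
      using nz[OF c] by (simp add: F_def power2_eq_square)
    then show ?thesis
      using sgn[OF c] nz[OF c] by simp
  qed
  obtain \<delta> Y where \<delta>: "0 < \<delta>" "\<delta> \<le> e" and fol: "foliation \<epsilon> Y"
    and der: "\<And>x s. \<bar>x\<bar> < \<delta> \<Longrightarrow> ((\<lambda>x. Y x s) has_real_derivative F (x, Y x s)) (at x)"
    using foliation_of_slope[OF F FM FL \<epsilon> F_sgn e] by blast
  interpret foliation \<epsilon> Y by (rule fol)
  have F_eq: "F (x, y) = V (pt x y) $ 2 / V (pt x y) $ 1" if "\<bar>x\<bar> \<le> e" "\<bar>y\<bar> \<le> e" for x y
    using that by (simp add: F_def c_def clamp1_id)
  have "has_leaves V \<delta> e Y"
    unfolding has_leaves_def
  proof (intro conjI allI impI ballI)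
    show "((\<lambda>x. Y x s) has_real_derivative V (pt x (Y x s)) $ 2 / V (pt x (Y x s)) $ 1) (at x)"
      if "\<bar>x\<bar> < \<delta>" "\<bar>Y x s\<bar> \<le> e" for x s
      using der[OF that(1), of s] F_eq[of x "Y x s"] that \<delta> by simp
  next
    fix I \<gamma> s t
    assume I: "open I" "connected I" "s \<in> I" "t \<in> I"
      and all: "\<forall>t\<in>I. \<bar>\<gamma> t $ 1\<bar> < \<delta> \<and> \<bar>\<gamma> t $ 2\<bar> \<le> e \<and> (\<gamma> has_vector_derivative V (\<gamma> t)) (at t)"
    have sq: "\<bar>\<gamma> t $ 1\<bar> < \<delta> \<and> \<bar>\<gamma> t $ 2\<bar> \<le> e"
      and \<gamma>: "(\<gamma> has_vector_derivative V (\<gamma> t)) (at t)" if "t \<in> I" for t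
      using all that by blast+
    define k where "k = level Y (\<gamma> s $ 1) (\<gamma> s $ 2)"
    define d where "d t = \<gamma> t $ 2 - Y (\<gamma> t $ 1) k" for t
    have \<gamma>i: "((\<lambda>t. \<gamma> t $ i) has_real_derivative V (\<gamma> t) $ i) (at t)" if "t \<in> I" for t i
      unfolding has_real_derivative_iff_has_vector_derivative
      using \<gamma>[OF that] by (rule bounded_linear.has_vector_derivative[OF bounded_linear_vec_nth])
    have "d t = 0"
    proof (rule gronwall_zero[where d = d and t = t, OF I(1,2,3)])
      show "d s = 0"
        by (simp add: d_def k_def)
      show "t \<in> I" by fact
      fix t assume t: "t \<in> I"
      show "(d has_real_derivative V (\<gamma> t) $ 2 - F (\<gamma> t $ 1, Y (\<gamma> t $ 1) k) * V (\<gamma> t) $ 1) (at t)"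
        unfolding d_def using sq[OF t] by (intro DERIV_diff \<gamma>i[OF t] DERIV_chain2[OF der]) auto
      have sqt: "\<gamma> t \<in> square e"
        using sq[OF t] \<delta> by (simp add: square_def)
      have "V (\<gamma> t) $ 2 = F (\<gamma> t $ 1, \<gamma> t $ 2) * V (\<gamma> t) $ 1"
        using sq[OF t] \<delta> nz[OF sqt] by (simp add: F_eq)
      then have "\<bar>V (\<gamma> t) $ 2 - F (\<gamma> t $ 1, Y (\<gamma> t $ 1) k) * V (\<gamma> t) $ 1\<bar>
          = \<bar>F (\<gamma> t $ 1, \<gamma> t $ 2) - F (\<gamma> t $ 1, Y (\<gamma> t $ 1) k)\<bar> * \<bar>V (\<gamma> t) $ 1\<bar>"
        by (simp add: abs_mult[symmetric] left_diff_distrib)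
      also have "\<dots> \<le> (2 * M / \<mu>\<^sup>2 * L * \<bar>\<gamma> t $ 2 - Y (\<gamma> t $ 1) k\<bar>) * M"
        by (intro mult_mono FL Mi[OF sqt]) (use order_trans[OF abs_ge_zero FL] in auto)
      finally show "\<bar>V (\<gamma> t) $ 2 - F (\<gamma> t $ 1, Y (\<gamma> t $ 1) k) * V (\<gamma> t) $ 1\<bar>
          \<le> 2 * M / \<mu>\<^sup>2 * L * M * \<bar>d t\<bar>"
        by (simp add: d_def mult_ac)
    qed
    then show "level Y (\<gamma> s $ 1) (\<gamma> s $ 2) = level Y (\<gamma> t $ 1) (\<gamma> t $ 2)"
      unfolding k_def[symmetric] by (subst eq_commute, simp add: level_eq_iff d_def)
  qed
  then show thesis
    using that \<delta>(1) fol by blast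
qed

lemma Ck_on_continuous: "Ck_on k f S \<Longrightarrow> open S \<Longrightarrow> continuous_on S f"
  by (cases k) (auto intro!: continuous_at_imp_continuous_on differentiable_imp_continuous_within)

text \<open>Only the derivative in the vertical direction enters: it is continuous, hence bounded on the square.\<close>

lemma C1_local_lipschitz:
  assumes "Ck_on_closed r f K" "r \<ge> 1" "square e \<subseteq> K"
  obtains L where "continuous_on (square e) f"
    "\<And>x y z. \<bar>x\<bar> \<le> e \<Longrightarrow> \<bar>y\<bar> \<le> e \<Longrightarrow> \<bar>z\<bar> \<le> e \<Longrightarrow> norm (f (pt x y) - f (pt x z)) \<le> L * \<bar>y - z\<bar>"
proof -
  obtain W g where W: "open W" "K \<subseteq> W" "Ck_on r g W" and gf: "\<And>p. p \<in> K \<Longrightarrow> g p = f p"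
    using assms(1) unfolding Ck_on_closed_def by blast
  obtain k where k: "r = Suc k"
    using \<open>r \<ge> 1\<close> by (cases r) auto
  let ?D = "\<lambda>p. frechet_derivative g (at p) (axis 2 1)"
  have sqW: "square e \<subseteq> W" using assms(3) W(2) by blast
  have dg: "(g has_derivative frechet_derivative g (at p)) (at p)" if "p \<in> W" for p
    using W(3) that unfolding k by (simp add: frechet_derivative_works)
  have "continuous_on W ?D"
    using W(3) unfolding k by (intro Ck_on_continuous[of k, OF _ W(1)]) simp
  then have "continuous_on (square e) ?D"
    using sqW by (rule continuous_on_subset)
  then have "bounded (?D ` square e)"
    using compact_continuous_image compact_square compact_imp_bounded by blast
  then obtain L where L: "\<And>p. p \<in> square e \<Longrightarrow> norm (?D p) \<le> L"
    by (auto simp: bounded_iff)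
  have "continuous_on W g"
    using W(1,3) by (intro Ck_on_continuous)
  then have "continuous_on (square e) f"
    using sqW assms(3) gf by (metis continuous_on_cong continuous_on_subset subset_iff)
  moreover have "norm (f (pt x y) - f (pt x z)) \<le> L * \<bar>y - z\<bar>"
    if "\<bar>x\<bar> \<le> e" "\<bar>y\<bar> \<le> e" "\<bar>z\<bar> \<le> e" for x y z
  proof -
    have "norm (g (pt x y) - g (pt x z)) \<le> L * norm (y - z)"
    proof (rule differentiable_bound[of "{-e..e}" "\<lambda>y. g (pt x y)" "\<lambda>y h. h *\<^sub>R ?D (pt x y)"])
      fix y :: real assume "y \<in> {-e..e}"
      then have p: "pt x y \<in> square e"
        using that by (auto simp: abs_le_iff)
      have "((\<lambda>y. pt x y) has_derivative (\<lambda>h. h *\<^sub>R axis 2 1)) (at y within {-e..e})"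
        unfolding pt_def by (auto intro!: derivative_eq_intros)
      moreover have "(g has_derivative frechet_derivative g (at (pt x y))) (at (pt x y) within pt x ` {-e..e})"
        using p sqW by (intro has_derivative_at_withinI[OF dg] subsetD[OF sqW])
      ultimately have "((\<lambda>y. g (pt x y)) has_derivative
          (\<lambda>h. frechet_derivative g (at (pt x y)) (h *\<^sub>R axis 2 1))) (at y within {-e..e})"
        by (rule has_derivative_in_compose)
      moreover have "linear (frechet_derivative g (at (pt x y)))"
        using p sqW by (intro has_derivative_linear[OF dg] subsetD[OF sqW])
      ultimately show "((\<lambda>y. g (pt x y)) has_derivative (\<lambda>h. h *\<^sub>R ?D (pt x y))) (at y within {-e..e})"
        by (simp add: linear_scale)
      show "onorm (\<lambda>h. h *\<^sub>R ?D (pt x y)) \<le> L"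
        using L[OF p] by (intro onorm_le) (simp add: mult.commute[of L] mult_left_mono)
    qed (use that in auto)
    then show ?thesis
      using that assms(3) gf by (simp add: subset_iff)
  qed
  ultimately show thesis by (rule that)
qed

section \<open>Orbits on half axes and in quadrants\<close>

text \<open>The sign of \<open>d\<close> tells whether the \<open>i\<close>-th coordinate increases or decreases in time along \<open>S\<close>.\<close>

definition directed_orbit :: "pw_field \<Rightarrow> plane set \<Rightarrow> plane set \<Rightarrow> 2 \<Rightarrow> real \<Rightarrow> bool" where
  "directed_orbit Z D S i d \<longleftrightarrow>
     (\<exists>J \<Gamma>. complete_orbit Z D J \<Gamma> \<and> \<Gamma> ` J = S \<and> strict_mono_on J (\<lambda>t. d * \<Gamma> t $ i))"

lemma directed_orbit_connected:
  assumes "opposed Z D" "directed_orbit Z D S i d"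
  shows "connected S"
proof -
  obtain J \<Gamma> where "complete_orbit Z D J \<Gamma>" and S: "\<Gamma> ` J = S"
    using assms(2) unfolding directed_orbit_def by blast
  then have c: "Z_curve Z D J \<Gamma>"
    by (simp add: complete_orbit_def)
  note J = Z_curveD[OF assms(1) c]
  have "continuous_on J \<Gamma>"
    using J(6) by (meson continuous_at_imp_continuous_on has_vector_derivative_continuous)
  from connected_continuous_image[OF this J(2)] show ?thesis
    by (simp add: S)
qed

text \<open>Each time \<open>t\<close> on the first orbit is sent to the time at which the second orbit reaches \<open>h (\<Gamma> t)\<close>. This
  is increasing because the directed coordinates increase in time on both orbits.\<close>

lemma directed_orbits_correspond:
  assumes "directed_orbit Z D S i d" "directed_orbit Z' D' (h ` S) i' d'"
    and ord: "\<And>p q. p \<in> S \<Longrightarrow> q \<in> S \<Longrightarrow> d * p $ i < d * q $ i \<Longrightarrow> d' * h p $ i' < d' * h q $ i'"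
  shows "\<exists>J \<Gamma> J' \<Gamma>' \<tau>. complete_orbit Z D J \<Gamma> \<and> \<Gamma> ` J = S \<and>
      complete_orbit Z' D' J' \<Gamma>' \<and> strict_mono_on J \<tau> \<and> \<tau> ` J = J' \<and>
      (\<forall>t\<in>J. h (\<Gamma> t) = \<Gamma>' (\<tau> t))"
proof -
  obtain J \<Gamma> where o: "complete_orbit Z D J \<Gamma>" and S: "\<Gamma> ` J = S"
    and m: "strict_mono_on J (\<lambda>t. d * \<Gamma> t $ i)"
    using assms(1) unfolding directed_orbit_def by blast
  obtain J' \<Gamma>' where o': "complete_orbit Z' D' J' \<Gamma>'" and S': "\<Gamma>' ` J' = h ` S"
    and m': "strict_mono_on J' (\<lambda>t. d' * \<Gamma>' t $ i')"
    using assms(2) unfolding directed_orbit_def by blast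
  have inj: "inj_on \<Gamma>' J'"
    using o' by (simp add: complete_orbit_def)
  define \<tau> where "\<tau> t = inv_into J' \<Gamma>' (h (\<Gamma> t))" for t
  have \<tau>: "\<tau> t \<in> J'" "\<Gamma>' (\<tau> t) = h (\<Gamma> t)" if "t \<in> J" for t
  proof -
    have "h (\<Gamma> t) \<in> \<Gamma>' ` J'"
      using that S S' by auto
    then show "\<tau> t \<in> J'" "\<Gamma>' (\<tau> t) = h (\<Gamma> t)"
      unfolding \<tau>_def by (rule inv_into_into, rule f_inv_into_f)
  qed
  have "strict_mono_on J \<tau>"
  proof (rule strict_mono_onI)
    fix s t assume st: "s \<in> J" "t \<in> J" "s < t"
    have "d * \<Gamma> s $ i < d * \<Gamma> t $ i"
      using strict_mono_onD[OF m st] .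
    then have "d' * \<Gamma>' (\<tau> s) $ i' < d' * \<Gamma>' (\<tau> t) $ i'"
      using ord[of "\<Gamma> s" "\<Gamma> t"] st S \<tau> by auto
    then show "\<tau> s < \<tau> t"
      using strict_mono_onD[OF m' \<tau>(1)[OF st(2)] \<tau>(1)[OF st(1)]]
      by (cases "\<tau> s" "\<tau> t" rule: linorder_cases) auto
  qed
  moreover have "\<tau> ` J = J'"
  proof
    show "\<tau> ` J \<subseteq> J'" using \<tau> by blast
    show "J' \<subseteq> \<tau> ` J"
    proof
      fix u assume u: "u \<in> J'"
      then have "\<Gamma>' u \<in> h ` \<Gamma> ` J"
        using S S' by blast
      then obtain t where "t \<in> J" "\<Gamma>' u = h (\<Gamma> t)" by blast
      then have "\<tau> t = u"
        using \<tau>[of t] inj u by (metis inj_onD)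
      then show "u \<in> \<tau> ` J" using \<open>t \<in> J\<close> by blast
    qed
  qed
  ultimately show ?thesis
    using o S o' \<tau>(2) by (intro exI[of _ J] exI[of _ \<Gamma>] exI[of _ J'] exI[of _ \<Gamma>'] exI[of _ \<tau>]) simp
qed

lemma same_side:
  fixes s x y :: real
  assumes "sgn x = sgn y"
  shows "s * x > 0 \<longleftrightarrow> s * y > 0"
  using assms by (auto simp: sgn_real_def zero_less_mult_iff split: if_splits)

lemma same_side_sgn:
  fixes s x y :: real
  assumes "s * x > 0" "s * y > 0"
  shows "sgn x = sgn y"
  using assms by (auto simp: sgn_real_def zero_less_mult_iff)

lemma other_other [simp]: "other (other i) = i"
  using exhaust_2[of i] by auto

lemma other_neq: "k \<noteq> i \<Longrightarrow> k = other i"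
  using exhaust_2[of i] exhaust_2[of k] by auto

text \<open>A curve that starts on the half axis stays on it, because the signs of its coordinates are constant.
  There the sliding field moves it with the nonzero speed \<open>g\<close>.\<close>

lemma half_axis_directed_orbit:
  assumes Z: "opposed Z D"
    and S_def: "S = {p \<in> D. p $ other j = 0 \<and> s * p $ j > 0}"
    and S: "connected S" "S \<noteq> {}" "\<And>p. p \<in> S \<Longrightarrow> \<bar>p $ j\<bar> \<le> b"
    and g: "continuous_on {-b..b} g" "\<And>x. x \<in> {-b..b} \<Longrightarrow> d * g x > 0"
    and sl: "\<And>x. x *\<^sub>R axis j 1 \<in> S \<Longrightarrow> sliding_field Z (other j) (x *\<^sub>R axis j 1) $ j = g x"
  shows "directed_orbit Z D S j d"
proof -
  define c where "c x = x *\<^sub>R (axis j 1 :: plane)" for x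
  define K where "K = {x. c x \<in> S}"
  have cj: "c x $ j = x" "c x $ other j = 0" for x
    using exhaust_2[of j] by (auto simp: c_def axis_def)
  have c_eta: "c (p $ j) = p" if "p \<in> S" for p
    using that exhaust_2[of j] by (auto simp: S_def c_def axis_def vec_eq_iff forall_2)
  have K_eq: "K = (\<lambda>p. p $ j) ` S"
  proof (intro equalityI subsetI)
    fix y assume "y \<in> K"
    then have "c y $ j \<in> (\<lambda>p. p $ j) ` S"
      unfolding K_def by blast
    then show "y \<in> (\<lambda>p. p $ j) ` S"
      by (simp add: cj)
  qed (auto simp: K_def c_eta)
  have cK: "c ` K = S"
    unfolding K_eq image_image using c_eta by simp
  have Kb: "K \<subseteq> {-b..b}"
    using S(3) unfolding K_eq by (auto simp: abs_le_iff minus_le_iff)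
  have "open D" using Z by (simp add: opposed_def)
  have "continuous_on UNIV c"
    unfolding c_def by (intro continuous_intros)
  then have "open (c -` D)"
    using \<open>open D\<close> by (simp add: open_vimage)
  moreover have "open {x. s * x > 0}"
    by (intro open_Collect_less continuous_intros)
  moreover have "K = c -` D \<inter> {x. s * x > 0}"
    by (auto simp: K_def S_def cj)
  ultimately have "open K" by auto
  have der: "(c has_vector_derivative (1 / g x) *\<^sub>R cell_field Z (c x)) (at x)" if x: "x \<in> K" for x
  proof -
    have xS: "c x \<in> S" using x by (simp add: K_def)
    have gx: "g x \<noteq> 0" using g(2)[of x] Kb x by auto
    have "x \<noteq> 0" using xS by (auto simp: S_def cj)
    then have "cell_field Z (c x) = sliding_field Z (other j) (c x)"
      using exhaust_2[of j] cj[of x] by (auto simp: cell_field_def)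
    also have "\<dots> = axis j (sliding_field Z (other j) (c x) $ j)"
      by (simp add: sliding_field_def)
    also have "\<dots> = g x *\<^sub>R axis j 1"
      using sl[of x] xS by (simp add: c_def vec_eq_iff axis_def)
    finally have "(1 / g x) *\<^sub>R cell_field Z (c x) = axis j 1"
      using gx by simp
    then show ?thesis
      unfolding c_def by (auto intro!: derivative_eq_intros)
  qed
  have "\<exists>J \<Gamma>. complete_orbit Z D J \<Gamma> \<and> \<Gamma> ` J = c ` K \<and> strict_mono_on J (\<lambda>t. d * \<Gamma> t $ j)"
  proof (rule complete_orbit_of_arc[OF Z \<open>open K\<close> _ _ Kb])
    show "connected K"
      unfolding K_eq using S(1) by (intro connected_continuous_image continuous_intros)
    show "K \<noteq> {}"
      using S(2) K_eq by simp
    show "continuous_on {-b..b} (\<lambda>x. 1 / g x)"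
      using g by (intro continuous_intros) fastforce+
    show "d * (1 / g x) > 0" if "x \<in> K" for x
      using g(2)[of x] that Kb by (auto simp: zero_less_mult_iff zero_less_divide_iff divide_less_0_iff)
    show "c ` K \<subseteq> D - {0}"
      unfolding cK S_def by auto
    show "sgn (c x $ k) = sgn (c y $ k)" if "x \<in> K" "y \<in> K" for x y k
    proof (cases "k = j")
      case True
      have "s * c x $ j > 0" "s * c y $ j > 0"
        using that by (auto simp: K_def S_def)
      then show ?thesis
        unfolding True by (rule same_side_sgn)
    next
      case False
      then show ?thesis
        by (simp only: other_neq[OF False] cj(2))
    qed
    show "c x $ j = x" for x
      by (rule cj)
    show "(c has_vector_derivative (1 / g x) *\<^sub>R cell_field Z (c x)) (at x)" if "x \<in> K" for x
      by (rule der[OF that])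
    show "\<gamma> ` I \<subseteq> c ` K" if c: "Z_curve Z D I \<gamma>" and t: "t \<in> I" "\<gamma> t \<in> c ` K" for I \<gamma> t
    proof (rule image_subsetI)
      fix u assume u: "u \<in> I"
      note sg = Z_curveD(5)[OF Z c t(1) u]
      have "\<gamma> u $ other j = 0" "s * \<gamma> u $ j > 0"
        using t(2) sg[of "other j"] same_side[OF sg[of j], of s]
        by (auto simp: cK S_def sgn_0_0)
      moreover have "\<gamma> u \<in> D"
        using Z_curveD(4)[OF Z c] u by blast
      ultimately show "\<gamma> u \<in> c ` K"
        by (simp add: cK S_def)
    qed
  qed
  then show ?thesis
    by (simp add: directed_orbit_def cK)
qed

definition open_square :: "real \<Rightarrow> plane set" where
  "open_square d = {p. \<bar>p $ 1\<bar> < d \<and> \<bar>p $ 2\<bar> < d}"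

lemma open_open_square: "open (open_square d)"
  unfolding open_square_def by (intro open_Collect_conj open_Collect_less continuous_intros)

text \<open>The part of a leaf inside a rectangle is connected because the leaf is a monotone graph, and it is
  parametrised by the first coordinate, whose speed is \<open>V p $ 1\<close>. Hence the part of a leaf in the quadrant
  is a single orbit.\<close>

lemma leaf_directed_orbit:
  fixes V :: field
  assumes Z: "opposed Z (open_square \<eta>)" and fol: "foliation \<epsilon> Y"
    and s: "s1 = 1 \<or> s1 = - 1" "s2 = 1 \<or> s2 = - 1"
    and \<eta>: "0 < \<eta>" "\<eta> \<le> e" and V: "continuous_on (square e) V" "\<And>p. p \<in> square e \<Longrightarrow> d * V p $ 1 > 0"
    and cell: "\<And>p. p \<in> open_square \<eta> \<Longrightarrow> s1 * p $ 1 > 0 \<Longrightarrow> s2 * p $ 2 > 0 \<Longrightarrow> cell_field Z p = V p"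
    and leaves: "has_leaves V \<eta> e Y"
    and S_def: "S = {p \<in> open_square \<eta>. s1 * p $ 1 > 0 \<and> s2 * p $ 2 > 0 \<and> level Y (p $ 1) (p $ 2) = k}"
    and "S \<noteq> {}"
  shows "directed_orbit Z (open_square \<eta>) S 1 d"
proof -
  interpret foliation \<epsilon> Y by fact
  define c where "c x = pt x (Y x k)" for x
  define K where "K = {x. \<bar>x\<bar> < \<eta> \<and> s1 * x > 0 \<and> \<bar>Y x k\<bar> < \<eta> \<and> s2 * Y x k > 0}"
  have contY: "continuous_on A (\<lambda>x. Y x k)" for A
    by (rule continuous_on_compose2[OF cont_leaf, where f = "\<lambda>x. (x, k)", simplified])
      (auto intro!: continuous_intros)
  have cK: "c ` K = S"
  proof
    show "c ` K \<subseteq> S"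
      by (auto simp: c_def K_def S_def open_square_def level_eq_iff)
    show "S \<subseteq> c ` K"
    proof
      fix p assume p: "p \<in> S"
      then have "Y (p $ 1) k = p $ 2"
        by (simp add: S_def level_eq_iff)
      then have "p = c (p $ 1)" "p $ 1 \<in> K"
        using p by (auto simp: c_def K_def S_def open_square_def)
      then show "p \<in> c ` K" by blast
    qed
  qed
  have openK: "open K"
    unfolding K_def by (intro open_Collect_conj open_Collect_less continuous_intros contY)
  have connK: "connected K"
  proof -
    have "x \<in> K" if "a \<in> K" "b \<in> K" "a \<le> x" "x \<le> b" for a b x
    proof -
      have "\<epsilon> * Y a k \<le> \<epsilon> * Y x k" "\<epsilon> * Y x k \<le> \<epsilon> * Y b k"
        using strict_mono_less_eq[OF leaf_slope[of k]] that(3,4) by blast+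
      then show ?thesis
        using that s eps unfolding K_def by auto
    qed
    then show ?thesis
      unfolding is_interval_connected_1[symmetric] is_interval_1 by blast
  qed
  \<comment> \<open>The leaf may leave the square over some \<open>x\<close> outside \<open>K\<close>; clamping keeps \<open>u\<close> defined and continuous there.\<close>
  define u where "u x = 1 / V (pt x (clamp1 \<eta> (Y x k))) $ 1" for x
  have V1: "V p $ 1 \<noteq> 0" if "p \<in> square e" for p
    using V(2)[OF that] by auto
  have sq: "pt x (clamp1 \<eta> (Y x k)) \<in> square e" if "x \<in> {-\<eta>..\<eta>}" for x
    using that clamp1_bound[of \<eta> "Y x k"] \<eta> by (auto simp: abs_le_iff)
  have uK: "u x = 1 / V (c x) $ 1" "c x \<in> square e" if "x \<in> K" for x
    using that \<eta> by (auto simp: u_def K_def c_def clamp1_id)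
  have Kb: "K \<subseteq> {-\<eta>..\<eta>}"
    by (auto simp: K_def abs_less_iff)
  have "\<exists>J \<Gamma>. complete_orbit Z (open_square \<eta>) J \<Gamma> \<and> \<Gamma> ` J = c ` K \<and> strict_mono_on J (\<lambda>t. d * \<Gamma> t $ 1)"
  proof (rule complete_orbit_of_arc[OF Z openK connK _ Kb])
    show "K \<noteq> {}"
      using cK \<open>S \<noteq> {}\<close> by auto
    have "continuous_on {-\<eta>..\<eta>} (\<lambda>x. V (pt x (clamp1 \<eta> (Y x k))) $ 1)"
      using sq by (intro continuous_on_component continuous_on_compose2[OF V(1)] continuous_intros contY) blast
    then show "continuous_on {-\<eta>..\<eta>} u"
      unfolding u_def
      by (rule continuous_on_divide[OF continuous_on_const]) (use sq V1 in blast)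
    show "d * u x > 0" if "x \<in> K" for x
      using V(2)[OF uK(2)[OF that]] uK(1)[OF that]
      by (auto simp: zero_less_mult_iff zero_less_divide_iff divide_less_0_iff)
    show "c ` K \<subseteq> open_square \<eta> - {0}"
      unfolding cK S_def by auto
    show "sgn (c x $ i) = sgn (c y $ i)" if "x \<in> K" "y \<in> K" for x y i
      using that exhaust_2[of i] same_side_sgn[of s1 x y] same_side_sgn[of s2 "Y x k" "Y y k"]
      by (auto simp: K_def c_def)
    show "c x $ 1 = x" for x
      by (simp add: c_def)
    show "(c has_vector_derivative u x *\<^sub>R cell_field Z (c x)) (at x)" if x: "x \<in> K" for x
    proof -
      define m where "m = V (pt x (Y x k)) $ 2 / V (pt x (Y x k)) $ 1"
      have "((\<lambda>x. Y x k) has_real_derivative m) (at x)"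
        unfolding m_def using x \<eta> by (intro has_leaves_derivative[OF leaves]) (auto simp: K_def)
      then have "(c has_vector_derivative pt 1 m) (at x)"
        unfolding c_def pt_def by (auto intro!: derivative_eq_intros)
      moreover have "cell_field Z (c x) = V (c x)"
        using cell[of "c x"] x by (simp add: K_def c_def open_square_def)
      moreover have "pt 1 m = u x *\<^sub>R V (c x)"
        using uK[OF x] V1[OF uK(2)[OF x]] by (auto simp: vec_eq_iff forall_2 c_def m_def)
      ultimately show ?thesis by simp
    qed
    show "\<gamma> ` I \<subseteq> c ` K"
      if c: "Z_curve Z (open_square \<eta>) I \<gamma>" and t: "t \<in> I" "\<gamma> t \<in> c ` K" for I \<gamma> t
    proof (rule image_subsetI)
      fix w assume w: "w \<in> I"
      note I = Z_curveD[OF Z c]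
      have side: "s1 * \<gamma> v $ 1 > 0" "s2 * \<gamma> v $ 2 > 0" "\<gamma> v \<in> open_square \<eta>" if "v \<in> I" for v
        using t(2) same_side[OF I(5)[OF t(1) that, of 1], of s1] same_side[OF I(5)[OF t(1) that, of 2], of s2]
          I(4) that by (auto simp: cK S_def)
      have "level Y (\<gamma> t $ 1) (\<gamma> t $ 2) = level Y (\<gamma> w $ 1) (\<gamma> w $ 2)"
      proof (rule has_leaves_level_constant[OF leaves I(1,2) t(1) w])
        show "\<bar>\<gamma> v $ 1\<bar> < \<eta> \<and> \<bar>\<gamma> v $ 2\<bar> \<le> e" if "v \<in> I" for v
          using side(3)[OF that] \<eta> by (auto simp: open_square_def)
        show "(\<gamma> has_vector_derivative V (\<gamma> v)) (at v)" if "v \<in> I" for v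
          using I(6)[OF that] cell[OF side(3)[OF that] side(1)[OF that] side(2)[OF that]] by simp
      qed
      then show "\<gamma> w \<in> c ` K"
        using t(2) side[OF w] by (auto simp: cK S_def)
    qed
  qed
  then show ?thesis
    by (simp add: directed_orbit_def cK)
qed

text \<open>For a constant field \<open>v\<close> the leaves are lines. Here connectedness of the part of the line in \<open>D\<close> is a
  hypothesis, since \<open>D\<close> will be the image of a square under a homeomorphism.\<close>

lemma line_directed_orbit:
  assumes Z: "opposed Z D" and v: "v $ 1 \<noteq> 0" "v $ 2 \<noteq> 0"
    and cell: "\<And>p. p \<in> D \<Longrightarrow> s1 * p $ 1 > 0 \<Longrightarrow> s2 * p $ 2 > 0 \<Longrightarrow> cell_field Z p = v"
    and S_def: "S = {p \<in> D. s1 * p $ 1 > 0 \<and> s2 * p $ 2 > 0 \<and> p $ 2 - v $ 2 / v $ 1 * p $ 1 = k}"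
    and S: "connected S" "S \<noteq> {}" "\<And>p. p \<in> S \<Longrightarrow> \<bar>p $ 2\<bar> \<le> b"
  shows "directed_orbit Z D S 2 (sgn (v $ 2))"
proof -
  define c where "c y = pt ((y - k) * (v $ 1 / v $ 2)) y" for y
  define K where "K = {y. c y \<in> S}"
  have c_eta: "c (p $ 2) = p" if "p \<in> S" for p
  proof -
    have "p $ 2 - k = v $ 2 / v $ 1 * p $ 1"
      using that by (simp add: S_def algebra_simps)
    then show ?thesis
      using v by (simp add: c_def vec_eq_iff forall_2)
  qed
  have c2: "c y $ 2 = y" for y
    by (simp add: c_def)
  have cline: "c y $ 2 - v $ 2 / v $ 1 * c y $ 1 = k" for y
    using v by (simp add: c_def)
  have K_eq: "K = (\<lambda>p. p $ 2) ` S"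
  proof (intro equalityI subsetI)
    fix y assume "y \<in> K"
    then have "c y $ 2 \<in> (\<lambda>p. p $ 2) ` S"
      unfolding K_def by blast
    then show "y \<in> (\<lambda>p. p $ 2) ` S"
      by (simp add: c2)
  qed (auto simp: K_def c_eta)
  have cK: "c ` K = S"
    unfolding K_eq image_image using c_eta by simp
  have Kb: "K \<subseteq> {-b..b}"
    using S(3) unfolding K_eq by (auto simp: abs_le_iff minus_le_iff)
  have "open D" using Z by (simp add: opposed_def)
  have contc: "continuous_on UNIV c"
    unfolding c_def by (intro continuous_intros)
  then have "open (c -` D)"
    using \<open>open D\<close> by (simp add: open_vimage)
  moreover have "open {y. s1 * c y $ 1 > 0}" "open {y. s2 * c y $ 2 > 0}"
    by (intro open_Collect_less continuous_intros contc)+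
  moreover have "K = c -` D \<inter> {y. s1 * c y $ 1 > 0} \<inter> {y. s2 * c y $ 2 > 0}"
    using cline by (auto simp: K_def S_def)
  ultimately have "open K" by auto
  have "\<exists>J \<Gamma>. complete_orbit Z D J \<Gamma> \<and> \<Gamma> ` J = c ` K \<and> strict_mono_on J (\<lambda>t. sgn (v $ 2) * \<Gamma> t $ 2)"
  proof (rule complete_orbit_of_arc[OF Z \<open>open K\<close> _ _ Kb])
    show "connected K"
      unfolding K_eq using S(1) by (intro connected_continuous_image continuous_intros)
    show "K \<noteq> {}"
      using S(2) K_eq by simp
    show "continuous_on {-b..b} (\<lambda>_. 1 / v $ 2)"
      by (intro continuous_intros)
    show "sgn (v $ 2) * (1 / v $ 2) > 0"
      using v(2) by (auto simp: sgn_real_def)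
    show "c ` K \<subseteq> D - {0}"
      unfolding cK S_def by auto
    show "sgn (c x $ i) = sgn (c y $ i)" if "x \<in> K" "y \<in> K" for x y i
      using that exhaust_2[of i] same_side_sgn[of s1 "c x $ 1" "c y $ 1"] same_side_sgn[of s2 "c x $ 2" "c y $ 2"]
      by (auto simp: K_def S_def)
    show "c x $ 2 = x" for x
      by (rule c2)
    show "(c has_vector_derivative (1 / v $ 2) *\<^sub>R cell_field Z (c x)) (at x)" if "x \<in> K" for x
    proof -
      have "cell_field Z (c x) = v"
        using that by (intro cell) (auto simp: K_def S_def)
      then have "(1 / v $ 2) *\<^sub>R cell_field Z (c x) = pt (v $ 1 / v $ 2) 1"
        using v by (simp add: vec_eq_iff forall_2)
      moreover have "(c has_vector_derivative pt (v $ 1 / v $ 2) 1) (at x)"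
        unfolding c_def pt_def using v by (auto intro!: derivative_eq_intros)
      ultimately show ?thesis by simp
    qed
    show "\<gamma> ` I \<subseteq> c ` K" if c: "Z_curve Z D I \<gamma>" and t: "t \<in> I" "\<gamma> t \<in> c ` K" for I \<gamma> t
    proof (rule image_subsetI)
      fix w assume w: "w \<in> I"
      note I = Z_curveD[OF Z c]
      have side: "s1 * \<gamma> x $ 1 > 0" "s2 * \<gamma> x $ 2 > 0" "\<gamma> x \<in> D" if "x \<in> I" for x
        using t(2) same_side[OF I(5)[OF t(1) that, of 1], of s1] same_side[OF I(5)[OF t(1) that, of 2], of s2]
          I(4) that by (auto simp: cK S_def)
      define f where "f x = \<gamma> x $ 2 - v $ 2 / v $ 1 * \<gamma> x $ 1" for x
      have "(f has_field_derivative 0) (at x)" if "x \<in> I" for x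
      proof -
        have "(\<gamma> has_vector_derivative v) (at x)"
          using I(6)[OF that] cell[OF side(3)[OF that] side(1)[OF that] side(2)[OF that]] by simp
        then have "((\<lambda>x. \<gamma> x $ i) has_real_derivative v $ i) (at x)" for i
          unfolding has_real_derivative_iff_has_vector_derivative
          by (rule bounded_linear.has_vector_derivative[OF bounded_linear_vec_nth])
        then have "(f has_real_derivative v $ 2 - v $ 2 / v $ 1 * v $ 1) (at x)"
          unfolding f_def by (intro DERIV_diff DERIV_cmult)
        then show ?thesis using v by simp
      qed
      then have "\<forall>x\<in>I - {}. (f has_field_derivative 0) (at x)" "continuous_on I f"
        by (blast, meson DERIV_isCont continuous_at_imp_continuous_on)
      then obtain a where "\<And>x. x \<in> I \<Longrightarrow> f x = a"
        using DERIV_zero_connected_constant[OF I(2,1), of "{}" f] by blast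
      then have "f w = f t"
        using w t by simp
      then show "\<gamma> w \<in> c ` K"
        using t(2) side[OF w] by (auto simp: cK S_def f_def)
    qed
  qed
  then show ?thesis
    by (simp add: directed_orbit_def cK)
qed

section \<open>Orientation\<close>

lemma continuous_on_to_complex: "continuous_on S f \<Longrightarrow> continuous_on S (\<lambda>x. to_complex (f x))"
  unfolding to_complex_def Complex_eq by (intro continuous_intros)

lemma continuous_on_of_complex:
  assumes "continuous_on S f"
  shows "continuous_on S (\<lambda>x. of_complex (f x))"
proof -
  have eq: "of_complex = (\<lambda>z. pt (Re z) (Im z))"
    by (auto simp: of_complex_def fun_eq_iff vec_eq_iff forall_2)
  show ?thesis
    unfolding eq using assms by (intro continuous_intros)
qed

lemma of_to_complex [simp]: "of_complex (to_complex p) = p" "to_complex (of_complex z) = z"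
  by (auto simp: of_complex_def to_complex_def vec_eq_iff forall_2 complex_eq_iff)

text \<open>The image of a circle around \<open>p\<close> is joined by segments to a round circle around the image of \<open>p\<close>. The
  vectors from that image to the two ends of a segment have the same second component, and if it is zero
  then their first components have the same sign, as \<open>H\<close> increases along horizontal lines. So no segment
  meets the image of \<open>p\<close>.\<close>

lemma horizontal_shear_orientation_preserving:
  fixes H :: "real \<Rightarrow> real \<Rightarrow> real"
  assumes cont: "continuous_on UNIV (\<lambda>p::plane. H (p $ 1) (p $ 2))"
    and mono: "\<And>y. strict_mono (\<lambda>x. H x y)"
  shows "orientation_preserving_on S (\<lambda>p. pt (H (p $ 1) (p $ 2)) (p $ 2))"
  unfolding orientation_preserving_on_def
proof (intro ballI allI impI)
  fix p :: plane and \<rho> :: real assume "\<rho> > 0"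
  let ?h = "\<lambda>p::plane. pt (H (p $ 1) (p $ 2)) (p $ 2)"
  let ?g = "to_complex \<circ> ?h \<circ> of_complex \<circ> circlepath (to_complex p) \<rho>"
  let ?c = "circlepath (to_complex (?h p)) \<rho>"
  have conth: "continuous_on UNIV ?h"
    using cont by (intro continuous_intros)
  have circ: "continuous_on {0..1} (circlepath z \<rho>)" for z
    using path_circlepath[of z \<rho>] by (simp add: path_def)
  have "homotopic_loops (- {to_complex (?h p)}) ?g ?c"
  proof (rule homotopic_loops_linear)
    show "path ?g"
      unfolding path_def o_def
      by (intro continuous_on_to_complex continuous_on_compose2[OF conth] continuous_on_of_complex circ) auto
    show "pathfinish ?g = pathstart ?g"
      by (simp add: pathfinish_def pathstart_def circlepath)
    fix t :: real assume "t \<in> {0..1}"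
    define w where "w = of_real \<rho> * exp (2 * of_real pi * \<i> * of_real t)"
    define q where "q = of_complex (to_complex p + w)"
    have w: "w \<noteq> 0" using \<open>\<rho> > 0\<close> by (simp add: w_def)
    have q: "q $ 1 = p $ 1 + Re w" "q $ 2 = p $ 2 + Im w"
      by (auto simp: q_def of_complex_def to_complex_def)
    have gt: "?g t = to_complex (?h q)" "?c t = to_complex (?h p) + w"
      by (auto simp: q_def w_def circlepath)
    show "closed_segment (?g t) (?c t) \<subseteq> - {to_complex (?h p)}"
    proof
      fix z assume "z \<in> closed_segment (?g t) (?c t)"
      then obtain u where u: "0 \<le> u" "u \<le> 1" and z: "z = (1 - u) *\<^sub>R ?g t + u *\<^sub>R ?c t"
        unfolding closed_segment_def by blast
      have "z \<noteq> to_complex (?h p)"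
      proof
        assume eq: "z = to_complex (?h p)"
        have Im: "Im z - Im (to_complex (?h p)) = Im w"
          unfolding z gt by (simp add: to_complex_def q algebra_simps)
        have Re: "Re z - Re (to_complex (?h p)) =
            (1 - u) * (H (q $ 1) (q $ 2) - H (p $ 1) (p $ 2)) + u * Re w"
          unfolding z gt by (simp add: to_complex_def algebra_simps)
        from Im eq have "Im w = 0" by simp
        then have "q $ 2 = p $ 2" "Re w \<noteq> 0"
          using w q by (auto simp: complex_eq_iff)
        then consider "Re w > 0" "H (q $ 1) (q $ 2) - H (p $ 1) (p $ 2) > 0"
          | "Re w < 0" "H (q $ 1) (q $ 2) - H (p $ 1) (p $ 2) < 0"
          using strict_mono_less[OF mono, of "q $ 1" "p $ 2" "p $ 1"]
            strict_mono_less[OF mono, of "p $ 1" "p $ 2" "q $ 1"] q(1)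
          by (metis diff_gt_0_iff_gt diff_less_0_iff_less less_add_same_cancel1 add_less_same_cancel1 linorder_neqE_linordered_idom)
        then have "(1 - u) * (H (q $ 1) (q $ 2) - H (p $ 1) (p $ 2)) + u * Re w \<noteq> 0"
        proof cases
          case 1
          then show ?thesis
            using u by (cases "u = 0") (auto simp: add_nonneg_pos less_imp_neq[symmetric] intro!: less_imp_neq[symmetric] add_nonneg_pos)
        next
          case 2
          then show ?thesis
            using u by (cases "u = 0") (auto simp: mult_nonneg_nonpos intro!: less_imp_neq add_nonpos_neg mult_nonneg_nonpos mult_pos_neg)
        qed
        then show False
          using Re eq by simp
      qed
      then show "z \<in> - {to_complex (?h p)}" by simp
    qed
  qed auto
  then have "winding_number ?g (to_complex (?h p)) = winding_number ?c (to_complex (?h p))"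
    by (rule winding_number_homotopic_loops)
  also have "\<dots> = 1"
    using \<open>\<rho> > 0\<close> by (rule winding_number_circlepath_centre)
  finally show "winding_number ?g (to_complex (?h p)) = 1" .
qed

lemma Ck_on_const: "Ck_on k (\<lambda>_. v) S"
  by (induction k arbitrary: v) (auto simp: frechet_derivative_const)

lemma Ck_on_closed_const: "Ck_on_closed k (\<lambda>_. v) S"
  unfolding Ck_on_closed_def by (intro exI[of _ UNIV] exI[of _ "\<lambda>_. v"]) (auto simp: Ck_on_const)

section \<open>Matching the orbits of two systems\<close>

text \<open>The numerator of the sliding field is the determinant up to sign, and the denominator has the sign of
  the normal component of the second field, as the first one has the opposite sign.\<close>

lemma sgn_sliding_field:
  assumes "fst Z p $ i * snd Z p $ i < 0"
  shows "sgn (sliding_field Z i p $ other i) =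
    (if i = 1 then - 1 else 1) * sgn (det_pw Z p) * sgn (snd Z p $ i)"
proof -
  have "snd Z p $ i * fst Z p $ other i - fst Z p $ i * snd Z p $ other i =
      (if i = 1 then - 1 else 1) * det_pw Z p"
    using exhaust_2[of i] by (auto simp: det_pw_def algebra_simps)
  moreover have "sgn (snd Z p $ i - fst Z p $ i) = sgn (snd Z p $ i)"
    using assms by (auto simp: sgn_real_def mult_less_0_iff)
  ultimately show ?thesis
    by (simp add: sliding_field_def axis_def sgn_mult divide_inverse)
qed

lemma cell_field_quadrant:
  assumes "s1 * p $ 1 > 0" "s2 * p $ 2 > 0"
  shows "cell_field Z p = (if s1 * s2 > 0 then fst Z p else snd Z p)"
proof -
  have "p $ 1 \<noteq> 0" "p $ 2 \<noteq> 0"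
    using assms by auto
  moreover have "p $ 1 * p $ 2 > 0 \<longleftrightarrow> s1 * s2 > 0"
    using assms by (auto simp: zero_less_mult_iff)
  ultimately show ?thesis
    by (simp add: cell_field_def)
qed

lemma open_square_subset: "\<eta> \<le> e \<Longrightarrow> open_square \<eta> \<subseteq> square e"
  by (auto simp: open_square_def square_def)

definition orbits_matched ::
  "pw_field \<Rightarrow> plane set \<Rightarrow> (plane \<Rightarrow> plane) \<Rightarrow> pw_field \<Rightarrow> plane set \<Rightarrow> plane \<Rightarrow> bool" where
  "orbits_matched Z D h Z' D' p \<longleftrightarrow>
     (\<exists>J \<Gamma> J' \<Gamma>' \<tau>. complete_orbit Z D J \<Gamma> \<and> p \<in> \<Gamma> ` J \<and>
        complete_orbit Z' D' J' \<Gamma>' \<and> strict_mono_on J \<tau> \<and> \<tau> ` J = J' \<and>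
        (\<forall>t\<in>J. h (\<Gamma> t) = \<Gamma>' (\<tau> t)))"

lemma orbits_matchedI:
  assumes "p \<in> S" "directed_orbit Z D S i d" "directed_orbit Z' D' (h ` S) i' d'"
    "\<And>p q. p \<in> S \<Longrightarrow> q \<in> S \<Longrightarrow> d * p $ i < d * q $ i \<Longrightarrow> d' * h p $ i' < d' * h q $ i'"
  shows "orbits_matched Z D h Z' D' p"
  using directed_orbits_correspond[OF assms(2-4)] assms(1) unfolding orbits_matched_def by blast

text \<open>A leaf with label \<open>k\<close> is carried to the line with label \<open>\<phi> k\<close>. The first orbit is directed by its first
  coordinate, the second by its second coordinate; the two senses agree because the sign \<open>\<epsilon>\<close> of the slope
  relates them in both systems.\<close>

lemma quadrant_orbits_matched:
  fixes V :: field and v :: plane and H :: "real \<Rightarrow> real \<Rightarrow> real" and h :: "plane \<Rightarrow> plane"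
  assumes h_def: "\<And>p. h p = pt (H (p $ 1) (p $ 2)) (p $ 2)"
    and Z: "opposed Z (open_square \<eta>)" and Z': "opposed Z' (h ` open_square \<eta>)"
    and fol: "foliation \<epsilon> Y"
    and s: "s1 = 1 \<or> s1 = - 1" "s2 = 1 \<or> s2 = - 1"
    and \<eta>: "0 < \<eta>" "\<eta> \<le> e" and V: "continuous_on (square e) V" "\<And>p. p \<in> square e \<Longrightarrow> sgn (V p $ 1) = sgn (v $ 1)"
    and v: "v $ 1 \<noteq> 0" "sgn (v $ 2) = \<epsilon> * sgn (v $ 1)"
    and cell: "\<And>p. s1 * p $ 1 > 0 \<Longrightarrow> s2 * p $ 2 > 0 \<Longrightarrow> cell_field Z p = V p"
    and cell': "\<And>p. s1 * p $ 1 > 0 \<Longrightarrow> s2 * p $ 2 > 0 \<Longrightarrow> cell_field Z' p = v"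
    and leaves: "has_leaves V \<eta> e Y"
    and H: "continuous_on UNIV h" "\<And>p k. sgn (h p $ k) = sgn (p $ k)"
    and \<phi>: "strict_mono \<phi>" "\<And>x y. s1 * x > 0 \<Longrightarrow> s2 * y > 0 \<Longrightarrow>
        H x y = (y - \<phi> (level Y x y)) / (v $ 2 / v $ 1)"
    and p: "p \<in> open_square \<eta>" "s1 * p $ 1 > 0" "s2 * p $ 2 > 0"
  shows "orbits_matched Z (open_square \<eta>) h Z' (h ` open_square \<eta>) p"
proof -
  interpret foliation \<epsilon> Y by fact
  define k where "k = level Y (p $ 1) (p $ 2)"
  define S where "S = {q \<in> open_square \<eta>. s1 * q $ 1 > 0 \<and> s2 * q $ 2 > 0 \<and> level Y (q $ 1) (q $ 2) = k}"
  have v2: "v $ 2 \<noteq> 0"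
    using v eps by (auto simp: sgn_zero_iff)
  have pS: "p \<in> S"
    using p by (simp add: S_def k_def)
  have dir: "directed_orbit Z (open_square \<eta>) S 1 (sgn (v $ 1))"
  proof (rule leaf_directed_orbit[OF Z fol s \<eta> V(1) _ cell leaves S_def])
    show "sgn (v $ 1) * V q $ 1 > 0" if "q \<in> square e" for q
      using V(2)[OF that] v(1) by (auto simp: sgn_real_def split: if_splits)
  qed (use pS in auto)
  have side: "s1 * h q $ 1 > 0 \<longleftrightarrow> s1 * q $ 1 > 0" "s2 * h q $ 2 > 0 \<longleftrightarrow> s2 * q $ 2 > 0" for q
    using same_side[OF H(2)] by auto
  have line: "h q $ 2 - v $ 2 / v $ 1 * h q $ 1 = \<phi> (level Y (q $ 1) (q $ 2))"
    if "s1 * q $ 1 > 0" "s2 * q $ 2 > 0" for q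
    using \<phi>(2)[OF that] v v2 by (simp add: h_def)
  have hS: "h ` S = {q \<in> h ` open_square \<eta>. s1 * q $ 1 > 0 \<and> s2 * q $ 2 > 0 \<and>
      q $ 2 - v $ 2 / v $ 1 * q $ 1 = \<phi> k}"
  proof -
    have "s1 * h q $ 1 > 0 \<and> s2 * h q $ 2 > 0 \<and> h q $ 2 - v $ 2 / v $ 1 * h q $ 1 = \<phi> k \<longleftrightarrow> q \<in> S"
      if "q \<in> open_square \<eta>" for q
      unfolding S_def mem_Collect_eq side
      using line[of q] strict_mono_eq[OF \<phi>(1), of "level Y (q $ 1) (q $ 2)" k] that
      by (cases "s1 * q $ 1 > 0 \<and> s2 * q $ 2 > 0") auto
    moreover have "S \<subseteq> open_square \<eta>"
      by (auto simp: S_def)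
    ultimately show ?thesis
      by blast
  qed
  have "directed_orbit Z' (h ` open_square \<eta>) (h ` S) 2 (sgn (v $ 2))"
  proof (rule line_directed_orbit[OF Z' v(1) v2 _ hS])
    show "connected (h ` S)"
      using directed_orbit_connected[OF Z dir] continuous_on_subset[OF H(1)]
      by (intro connected_continuous_image) auto
    show "\<bar>q $ 2\<bar> \<le> \<eta>" if "q \<in> h ` S" for q
      using that by (auto simp: S_def h_def open_square_def)
  qed (use pS cell' in auto)
  with pS dir show ?thesis
  proof (rule orbits_matchedI)
    fix q q' assume q: "q \<in> S" "q' \<in> S" "sgn (v $ 1) * q $ 1 < sgn (v $ 1) * q' $ 1"
    have Yq: "q $ 2 = Y (q $ 1) k" "q' $ 2 = Y (q' $ 1) k"
      using q by (auto simp: S_def level_eq_iff)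
    consider "v $ 1 > 0" "q $ 1 < q' $ 1" | "v $ 1 < 0" "q' $ 1 < q $ 1"
      using q(3) v(1) by (auto simp: sgn_real_def split: if_splits)
    then have "sgn (v $ 2) * q $ 2 < sgn (v $ 2) * q' $ 2"
    proof cases
      case 1
      then show ?thesis
        using strict_monoD[OF leaf_slope 1(2), of k] v(2) by (simp add: Yq)
    next
      case 2
      then show ?thesis
        using strict_monoD[OF leaf_slope 2(2), of k] v(2) by (simp add: Yq)
    qed
    then show "sgn (v $ 2) * h q $ 2 < sgn (v $ 2) * h q' $ 2"
      by (simp add: h_def)
  qed
qed

lemma half_axis_orbits_matched:
  assumes Z: "opposed Z (open_square \<eta>)" and Z': "opposed Z' (h ` open_square \<eta>)"
    and \<eta>: "0 < \<eta>" "\<eta> \<le> e"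
    and h: "continuous_on UNIV h" "\<And>p k. sgn (h p $ k) = sgn (p $ k)"
      "\<And>p q. p $ other j = 0 \<Longrightarrow> q $ other j = 0 \<Longrightarrow> p $ j < q $ j \<Longrightarrow> h p $ j < h q $ j"
    and g: "continuous_on (square e) (\<lambda>p. sliding_field Z (other j) p $ j)"
      "\<And>p. p \<in> square e \<Longrightarrow> sgn (sliding_field Z (other j) p $ j) = sgn g'"
    and g': "g' \<noteq> 0" "\<And>p. sliding_field Z' (other j) p $ j = g'"
    and p: "p \<in> open_square \<eta>" "p $ other j = 0" "p $ j \<noteq> 0"
  shows "orbits_matched Z (open_square \<eta>) h Z' (h ` open_square \<eta>) p"
proof -
  define s where "s = sgn (p $ j)"
  define S where "S = {q \<in> open_square \<eta>. q $ other j = 0 \<and> s * q $ j > 0}"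
  have pS: "p \<in> S"
    using p by (auto simp: S_def s_def sgn_real_def)
  have bj: "\<bar>q $ j\<bar> < \<eta>" if "q \<in> open_square \<eta>" for q
    using that exhaust_2[of j] by (auto simp: open_square_def)
  define K where "K = {x. \<bar>x\<bar> < \<eta> \<and> s * x > 0}"
  have "connected K"
  proof -
    have "x \<in> K" if "a \<in> K" "b \<in> K" "a \<le> x" "x \<le> b" for a b x
      using that by (auto simp: K_def s_def sgn_real_def split: if_splits)
    then show ?thesis
      unfolding is_interval_connected_1[symmetric] is_interval_1 by blast
  qed
  moreover have "S = (\<lambda>x. x *\<^sub>R axis j 1) ` K"
  proof (intro equalityI subsetI)
    fix q assume q: "q \<in> S"
    then have "q = q $ j *\<^sub>R axis j 1"
      using exhaust_2[of j] by (auto simp: S_def vec_eq_iff forall_2 axis_def)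
    moreover have "q $ j \<in> K"
      using q bj by (auto simp: S_def K_def)
    ultimately show "q \<in> (\<lambda>x. x *\<^sub>R axis j 1) ` K" by blast
  next
    fix q :: plane assume "q \<in> (\<lambda>x. x *\<^sub>R axis j 1) ` K"
    then show "q \<in> S"
      using exhaust_2[of j] \<eta> by (auto simp: S_def K_def axis_def open_square_def)
  qed
  ultimately have connS: "connected S"
    by (auto intro!: connected_continuous_image continuous_intros)
  have sq: "x *\<^sub>R axis j 1 \<in> square e" if "x \<in> {-\<eta>..\<eta>}" for x :: real
    using that \<eta> exhaust_2[of j] by (auto simp: square_def axis_def)
  have dir: "directed_orbit Z (open_square \<eta>) S j (sgn g')"
  proof (rule half_axis_directed_orbit[OF Z S_def connS, of \<eta>])
    show "continuous_on {-\<eta>..\<eta>} (\<lambda>x. sliding_field Z (other j) (x *\<^sub>R axis j 1) $ j)"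
      by (rule continuous_on_compose2[OF g(1)]) (use sq in \<open>auto intro!: continuous_intros\<close>)
    show "sgn g' * sliding_field Z (other j) (x *\<^sub>R axis j 1) $ j > 0" if "x \<in> {-\<eta>..\<eta>}" for x
      using g(2)[OF sq[OF that]] g'(1) by (auto simp: sgn_real_def split: if_splits)
    show "\<bar>q $ j\<bar> \<le> \<eta>" if "q \<in> S" for q
      using that bj[of q] by (simp add: S_def)
  qed (use pS in auto)
  have hS: "h ` S = {q \<in> h ` open_square \<eta>. q $ other j = 0 \<and> s * q $ j > 0}"
  proof -
    have "h q $ other j = 0 \<longleftrightarrow> q $ other j = 0" "s * h q $ j > 0 \<longleftrightarrow> s * q $ j > 0" for q
      using h(2)[of q "other j"] same_side[OF h(2)] by (auto simp: sgn_0_0)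
    then show ?thesis by (auto simp: S_def)
  qed
  have "bounded (h ` square \<eta>)"
    using continuous_on_subset[OF h(1)] compact_square
    by (intro compact_imp_bounded compact_continuous_image) auto
  then obtain B where B: "\<And>q. q \<in> square \<eta> \<Longrightarrow> norm (h q) \<le> B"
    by (auto simp: bounded_iff)
  have "directed_orbit Z' (h ` open_square \<eta>) (h ` S) j (sgn g')"
  proof (rule half_axis_directed_orbit[OF Z' hS, where g = "\<lambda>_. g'" and b = B])
    show "connected (h ` S)"
      using connS continuous_on_subset[OF h(1)] by (intro connected_continuous_image) auto
    show "\<bar>q $ j\<bar> \<le> B" if "q \<in> h ` S" for q
      using that B open_square_subset[of \<eta> \<eta>] component_le_norm_cart[of q j]
      by (fastforce simp: S_def)
    show "sgn g' * g' > 0"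
      using g'(1) by (auto simp: sgn_real_def)
  qed (use pS g' in auto)
  with pS dir show ?thesis
  proof (rule orbits_matchedI)
    fix q q' assume q: "q \<in> S" "q' \<in> S" "sgn g' * q $ j < sgn g' * q' $ j"
    then show "sgn g' * h q $ j < sgn g' * h q' $ j"
      using g'(1) h(3)[of q q'] h(3)[of q' q] by (auto simp: S_def sgn_real_def split: if_splits)
  qed
qed

section \<open>Equivalence to a pair of constant fields\<close>

lemma eventually_sgn_eq:
  fixes f :: "plane \<Rightarrow> real"
  assumes "isCont f a" "f a \<noteq> 0"
  shows "\<forall>\<^sub>F p in nhds a. sgn (f p) = sgn (f a)"
proof -
  have f: "(f \<longlongrightarrow> f a) (nhds a)"
    using assms(1) by (simp add: continuous_within tendsto_at_iff_tendsto_nhds)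
  show ?thesis
  proof (cases "f a > 0")
    case True
    from order_tendstoD(1)[OF f this] show ?thesis
      by eventually_elim (use True in simp)
  next
    case False
    with assms(2) have neg: "f a < 0" by simp
    from order_tendstoD(2)[OF f this] show ?thesis
      by eventually_elim (use neg in simp)
  qed
qed

lemma continuous_sliding_component:
  assumes "continuous_on A (fst Z)" "continuous_on A (snd Z)"
    and "\<And>p. p \<in> A \<Longrightarrow> fst Z p $ i * snd Z p $ i < 0"
  shows "continuous_on A (\<lambda>p. sliding_field Z i p $ other i)"
proof -
  have "snd Z p $ i - fst Z p $ i \<noteq> 0" if "p \<in> A" for p
    using assms(3)[OF that] by (auto simp: mult_less_0_iff)
  then have "continuous_on A (\<lambda>p. (snd Z p $ i * fst Z p $ other i - fst Z p $ i * snd Z p $ other i) /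
      (snd Z p $ i - fst Z p $ i))"
    using assms(1,2) by (intro continuous_intros) auto
  then show ?thesis
    by (simp add: sliding_field_def axis_def)
qed

text \<open>Only the signs of the components and of the determinant at the origin matter. On a small square around
  the origin they are constant, which makes the system opposed there, determines the sense of the sliding
  field on each half axis, and gives the foliations of both fields the same sign of slope. The domain on
  the other side is the image of the square under \<open>h\<close>.\<close>

lemma locally_equivalent_to_constant:
  fixes X Y :: field and P N :: plane
  assumes "r \<ge> 1" "open U" "0 \<in> U" and XY: "(X, Y) \<in> Omega r U"
    and opp: "\<And>i. X 0 $ i * Y 0 $ i < 0" and det: "det_pw (X, Y) 0 \<noteq> 0"
    and P: "\<And>i. sgn (P $ i) = sgn (X 0 $ i)" and N: "\<And>i. sgn (N $ i) = sgn (Y 0 $ i)"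
    and PN: "sgn (P $ 1 * N $ 2 - P $ 2 * N $ 1) = sgn (det_pw (X, Y) 0)"
  shows "locally_Sigma_equivalent r U (X, Y) (\<lambda>_. P, \<lambda>_. N)"
proof -
  let ?Z = "(X, Y)" and ?Z' = "(\<lambda>_::plane. P, \<lambda>_::plane. N)"
  have nz: "X 0 $ i \<noteq> 0" "Y 0 $ i \<noteq> 0" "P $ i \<noteq> 0" "N $ i \<noteq> 0" for i
  proof -
    show "X 0 $ i \<noteq> 0" "Y 0 $ i \<noteq> 0" using opp[of i] by auto
    then show "P $ i \<noteq> 0" "N $ i \<noteq> 0" using P[of i] N[of i] by (auto simp: sgn_zero_iff)
  qed
  have Y_sgn: "sgn (Y 0 $ i) = - sgn (X 0 $ i)" for i
    using opp[of i] by (auto simp: sgn_real_def mult_less_0_iff)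
  obtain e0 where e0: "e0 > 0" "square e0 \<subseteq> U"
    using square_subset_open[OF \<open>open U\<close> \<open>0 \<in> U\<close>] .
  then have e0': "square e0 \<subseteq> closure U"
    using closure_subset by blast
  have C: "Ck_on_closed r X (closure U)" "Ck_on_closed r Y (closure U)"
    using XY by (auto simp: Omega_def)
  obtain LX where LX: "continuous_on (square e0) X"
    "\<And>x y z. \<bar>x\<bar> \<le> e0 \<Longrightarrow> \<bar>y\<bar> \<le> e0 \<Longrightarrow> \<bar>z\<bar> \<le> e0 \<Longrightarrow> norm (X (pt x y) - X (pt x z)) \<le> LX * \<bar>y - z\<bar>"
    using C1_local_lipschitz[OF C(1) \<open>r \<ge> 1\<close> e0'] by blast
  obtain LY where LY: "continuous_on (square e0) Y"
    "\<And>x y z. \<bar>x\<bar> \<le> e0 \<Longrightarrow> \<bar>y\<bar> \<le> e0 \<Longrightarrow> \<bar>z\<bar> \<le> e0 \<Longrightarrow> norm (Y (pt x y) - Y (pt x z)) \<le> LY * \<bar>y - z\<bar>"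
    using C1_local_lipschitz[OF C(2) \<open>r \<ge> 1\<close> e0'] by blast
  have zero: "0 \<in> open_square e" if "e > 0" for e
    using that by (simp add: open_square_def)
  have "isCont X 0" "isCont Y 0"
    using LX(1) LY(1) zero[OF e0(1)] open_square_subset[of e0 e0]
    by (metis continuous_on_eq_continuous_at continuous_on_subset open_open_square order_refl)+
  then have "\<forall>\<^sub>F p in nhds 0. sgn (X p $ i) = sgn (X 0 $ i)" "\<forall>\<^sub>F p in nhds 0. sgn (Y p $ i) = sgn (Y 0 $ i)"
    "\<forall>\<^sub>F p in nhds 0. sgn (det_pw ?Z p) = sgn (det_pw ?Z 0)" for i
    using nz det unfolding det_pw_def fst_conv snd_conv by (intro eventually_sgn_eq continuous_intros; simp)+
  then have "\<forall>\<^sub>F p in nhds 0. sgn (X p $ 1) = sgn (X 0 $ 1) \<and> sgn (X p $ 2) = sgn (X 0 $ 2) \<and>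
      sgn (Y p $ 1) = sgn (Y 0 $ 1) \<and> sgn (Y p $ 2) = sgn (Y 0 $ 2) \<and>
      sgn (det_pw ?Z p) = sgn (det_pw ?Z 0)"
    by (intro eventually_conj)
  then obtain A where A: "open A" "0 \<in> A"
    and sgnA: "\<And>p. p \<in> A \<Longrightarrow> sgn (X p $ 1) = sgn (X 0 $ 1) \<and> sgn (X p $ 2) = sgn (X 0 $ 2) \<and>
      sgn (Y p $ 1) = sgn (Y 0 $ 1) \<and> sgn (Y p $ 2) = sgn (Y 0 $ 2) \<and>
      sgn (det_pw ?Z p) = sgn (det_pw ?Z 0)"
    unfolding eventually_nhds by blast
  obtain e where e: "e > 0" "square e \<subseteq> A \<inter> open_square e0"
    using square_subset_open[of "A \<inter> open_square e0"] A zero[OF e0(1)] open_open_square by blast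
  have sgnX: "sgn (X p $ i) = sgn (X 0 $ i)" and sgnY: "sgn (Y p $ i) = sgn (Y 0 $ i)"
    and sgnD: "sgn (det_pw ?Z p) = sgn (det_pw ?Z 0)" if "p \<in> square e" for p i
  proof -
    have "p \<in> A" using that e(2) by blast
    from sgnA[OF this] show "sgn (X p $ i) = sgn (X 0 $ i)" "sgn (Y p $ i) = sgn (Y 0 $ i)"
      "sgn (det_pw ?Z p) = sgn (det_pw ?Z 0)"
      using exhaust_2[of i] by auto
  qed
  have ee0: "e \<le> e0" "square e \<subseteq> square e0"
  proof -
    have "pt e 0 \<in> open_square e0"
      using e by (intro subsetD[of "square e" "open_square e0"]) auto
    then show "e \<le> e0" by (auto simp: open_square_def)
    then show "square e \<subseteq> square e0" by (auto simp: square_def)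
  qed
  have contX: "continuous_on (square e) X" and contY: "continuous_on (square e) Y"
    using LX(1) LY(1) ee0(2) by (auto intro: continuous_on_subset)
  define \<epsilon> where "\<epsilon> = sgn (X 0 $ 1) * sgn (X 0 $ 2)"
  have \<epsilon>: "\<epsilon> = 1 \<or> \<epsilon> = - 1"
    using nz(1)[of 1] nz(1)[of 2] by (auto simp: \<epsilon>_def sgn_real_def)
  have \<epsilon>_sgn: "\<epsilon> * sgn (X 0 $ 1) = sgn (X 0 $ 2)"
    using nz(1)[of 1] by (auto simp: \<epsilon>_def sgn_real_def)
  have slope: "\<epsilon> * (a * b) > 0"
    if "sgn a = sgn (X 0 $ 1) \<and> sgn b = sgn (X 0 $ 2) \<or> sgn a = sgn (Y 0 $ 1) \<and> sgn b = sgn (Y 0 $ 2)" for a b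
    using that nz(1)[of 1] nz(1)[of 2] unfolding Y_sgn \<epsilon>_def
    by (auto simp: sgn_real_def zero_less_mult_iff mult_less_0_iff split: if_splits)
  have slope': "\<epsilon> * (b / a) > 0"
    if "sgn a = sgn (X 0 $ 1) \<and> sgn b = sgn (X 0 $ 2) \<or> sgn a = sgn (Y 0 $ 1) \<and> sgn b = sgn (Y 0 $ 2)" for a b
    using slope[OF that] by (auto simp: zero_less_mult_iff zero_less_divide_iff divide_less_0_iff mult_less_0_iff)
  have "norm (X (pt x y) - X (pt x z)) \<le> LX * \<bar>y - z\<bar>" if "\<bar>x\<bar> \<le> e" "\<bar>y\<bar> \<le> e" "\<bar>z\<bar> \<le> e" for x y z
    using that ee0(1) by (intro LX(2)) auto
  moreover have "0 < \<epsilon> * (X p $ 1 * X p $ 2)" if "p \<in> square e" for p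
    using sgnX[OF that] by (intro slope) simp
  ultimately obtain \<delta>X YX where \<delta>X: "0 < \<delta>X" and folX: "foliation \<epsilon> YX" and leavesX: "has_leaves X \<delta>X e YX"
    using foliation_of_field[OF contX e(1) _ \<epsilon>, of LX] by blast
  have "norm (Y (pt x y) - Y (pt x z)) \<le> LY * \<bar>y - z\<bar>" if "\<bar>x\<bar> \<le> e" "\<bar>y\<bar> \<le> e" "\<bar>z\<bar> \<le> e" for x y z
    using that ee0(1) by (intro LY(2)) auto
  moreover have "0 < \<epsilon> * (Y p $ 1 * Y p $ 2)" if "p \<in> square e" for p
    using sgnY[OF that] by (intro slope) simp
  ultimately obtain \<delta>Y YY where \<delta>Y: "0 < \<delta>Y" and folY: "foliation \<epsilon> YY" and leavesY: "has_leaves Y \<delta>Y e YY"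
    using foliation_of_field[OF contY e(1) _ \<epsilon>, of LY] by blast
  have slopePN: "\<epsilon> * (P $ 2 / P $ 1) > 0" "\<epsilon> * (N $ 2 / N $ 1) > 0"
    using P N by (intro slope'; simp)+
  obtain H where contH: "continuous_on UNIV (\<lambda>(x, y). H x y :: real)"
    and monoH: "\<And>y. strict_mono (\<lambda>x. H x y)" and H0: "\<And>y. H 0 y = 0"
    and H\<phi>: "\<And>s1 s2 :: real. s1 = 1 \<or> s1 = - 1 \<Longrightarrow> s2 = 1 \<or> s2 = - 1 \<Longrightarrow>
        \<exists>\<phi> :: real \<Rightarrow> real. strict_mono \<phi> \<and> (\<forall>x y. s1 * x > 0 \<longrightarrow> s2 * y > 0 \<longrightarrow>
          H x y = (y - \<phi> (level (if s1 * s2 > 0 then YX else YY) x y)) /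
            (if s1 * s2 > 0 then P $ 2 / P $ 1 else N $ 2 / N $ 1))"
  proof (rule transversal_coordinate_quadrants[OF folX folY slopePN])
    fix H
    assume H: "continuous_on UNIV (\<lambda>(x, y). H x y :: real)"
      "\<And>y. strict_mono (\<lambda>x. H x y)" "\<And>y. H 0 y = 0"
      "\<And>s1 s2 :: real. s1 = 1 \<or> s1 = - 1 \<Longrightarrow> s2 = 1 \<or> s2 = - 1 \<Longrightarrow>
        \<exists>\<phi> :: real \<Rightarrow> real. strict_mono \<phi> \<and> (\<forall>x y. s1 * x > 0 \<longrightarrow> s2 * y > 0 \<longrightarrow>
          H x y = (y - \<phi> (level (if s1 * s2 > 0 then YX else YY) x y)) /
            (if s1 * s2 > 0 then P $ 2 / P $ 1 else N $ 2 / N $ 1))"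
    show thesis
      by (rule that[OF H])
  qed
  define h where "h = (\<lambda>p::plane. pt (H (p $ 1) (p $ 2)) (p $ 2))"
  have h_eq: "h p = pt (H (p $ 1) (p $ 2)) (p $ 2)" for p
    by (simp add: h_def)
  have contH': "continuous_on UNIV (\<lambda>p::plane. H (p $ 1) (p $ 2))"
  proof -
    have "continuous_on UNIV (\<lambda>p::plane. (p $ 1, p $ 2))"
      by (intro continuous_intros)
    from continuous_on_compose2[OF contH this] show ?thesis
      by simp
  qed
  then have conth: "continuous_on UNIV h"
    unfolding h_def by (intro continuous_intros)
  have h_sgn: "sgn (h p $ k) = sgn (p $ k)" for p k
  proof -
    have "sgn (H x y) = sgn x" for x y
      using strict_mono_less[OF monoH, of x y 0] strict_mono_less[OF monoH, of 0 y x] H0[of y]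
      by (cases x "0::real" rule: linorder_cases) auto
    then show ?thesis
      using exhaust_2[of k] by (auto simp: h_def)
  qed
  have h0: "h 0 = 0"
    by (simp add: h_def H0 plane_eq_0_iff)
  have injh: "inj h"
  proof (rule injI)
    fix p q assume "h p = h q"
    then have "h p $ 1 = h q $ 1" "h p $ 2 = h q $ 2" by simp_all
    then show "p = q"
      by (simp add: h_def vec_eq_iff forall_2 strict_mono_eq[OF monoH])
  qed
  have "open (h -` U)" "0 \<in> h -` U"
    using conth \<open>open U\<close> \<open>0 \<in> U\<close> h0 by (simp_all add: open_vimage)
  then obtain \<eta>0 where \<eta>0: "\<eta>0 > 0" "square \<eta>0 \<subseteq> h -` U"
    by (rule square_subset_open)
  \<comment> \<open>Small enough for both foliations, for constant signs, and for the image under \<open>h\<close> to stay in \<open>U\<close>.\<close>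
  define \<eta> where "\<eta> = Min {\<eta>0, \<delta>X, \<delta>Y, e}"
  have \<eta>: "0 < \<eta>" "\<eta> \<le> \<eta>0" "\<eta> \<le> \<delta>X" "\<eta> \<le> \<delta>Y" "\<eta> \<le> e"
    using \<eta>0(1) \<delta>X \<delta>Y e(1) by (auto simp: \<eta>_def)
  define U0 where "U0 = open_square \<eta>"
  define U0' where "U0' = h ` U0"
  have U0: "open U0" "0 \<in> U0" "U0 \<subseteq> square e" "U0 \<subseteq> U" "U0' \<subseteq> U" "0 \<in> U0'"
  proof -
    show "open U0" "0 \<in> U0" "U0 \<subseteq> square e"
      using open_open_square zero[OF \<eta>(1)] open_square_subset[OF \<eta>(5)] by (auto simp: U0_def)
    then show "U0 \<subseteq> U"
      using ee0(2) e0(2) by blast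
    show "U0' \<subseteq> U"
      using open_square_subset[OF \<eta>(2)] \<eta>0(2) by (auto simp: U0'_def U0_def)
    show "0 \<in> U0'"
      unfolding U0'_def using \<open>0 \<in> U0\<close> h0 by (metis imageI)
  qed
  have injh0: "inj_on h U0" and conth0: "continuous_on U0 h"
    using injh conth by (auto intro: inj_on_subset continuous_on_subset)
  have openU0': "open U0'"
    unfolding U0'_def using conth0 U0(1) injh0 by (rule invariance_of_domain)
  obtain k where k: "homeomorphism U0 U0' h k"
    using invariance_of_domain_homeomorphism[OF U0(1) conth0 _ injh0] unfolding U0'_def by auto
  have oppZ: "X p $ i * Y p $ i < 0" if "p \<in> square e" for p i
    using sgnX[OF that, of i] sgnY[OF that, of i] nz(1)[of i] unfolding Y_sgn
    by (auto simp: sgn_real_def mult_less_0_iff split: if_splits)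
  have oppZ': "P $ i * N $ i < 0" for i
    using P[of i] N[of i] nz(1)[of i] unfolding Y_sgn
    by (auto simp: sgn_real_def mult_less_0_iff split: if_splits)
  have Z: "opposed ?Z U0" and Z': "opposed ?Z' U0'"
    using U0 openU0' oppZ oppZ' by (auto simp: opposed_def subset_iff)
  have matched: "orbits_matched ?Z U0 h ?Z' U0' p" if p: "p \<in> U0" "p \<noteq> 0" for p
  proof (cases "p $ 1 \<noteq> 0 \<and> p $ 2 \<noteq> 0")
    case True
    define s1 s2 where "s1 = sgn (p $ 1)" and "s2 = sgn (p $ 2)"
    have s: "s1 = 1 \<or> s1 = - 1" "s2 = 1 \<or> s2 = - 1"
      and side: "s1 * p $ 1 > 0" "s2 * p $ 2 > 0"
      using True by (auto simp: s1_def s2_def sgn_real_def)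
    obtain \<phi> :: "real \<Rightarrow> real" where \<phi>: "strict_mono \<phi>"
      "\<And>x y. s1 * x > 0 \<Longrightarrow> s2 * y > 0 \<Longrightarrow> H x y = (y - \<phi> (level (if s1 * s2 > 0 then YX else YY) x y)) /
          (if s1 * s2 > 0 then P $ 2 / P $ 1 else N $ 2 / N $ 1)"
      using H\<phi>[OF s] by blast
    show ?thesis
    proof (cases "s1 * s2 > 0")
      case True
      show ?thesis
      proof (rule quadrant_orbits_matched[where \<eta> = \<eta> and h = h and v = P,
            folded U0_def, folded U0'_def, OF h_eq Z Z' folX s \<eta>(1,5) contX _ _ _ _ _ has_leaves_mono[OF leavesX \<eta>(3)] conth h_sgn \<phi>(1) _ p(1) side])
        show "sgn (X q $ 1) = sgn (P $ 1)" if "q \<in> square e" for q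
          using sgnX[OF that] P by simp
        show "P $ 1 \<noteq> 0" by (rule nz)
        show "sgn (P $ 2) = \<epsilon> * sgn (P $ 1)"
          using \<epsilon>_sgn by (simp add: P)
        show "cell_field ?Z q = X q" "cell_field ?Z' q = P" if "s1 * q $ 1 > 0" "s2 * q $ 2 > 0" for q
          using cell_field_quadrant[OF that] True by simp_all
        show "H x y = (y - \<phi> (level YX x y)) / (P $ 2 / P $ 1)" if "s1 * x > 0" "s2 * y > 0" for x y
          using \<phi>(2)[OF that] True by simp
      qed
    next
      case False
      show ?thesis
      proof (rule quadrant_orbits_matched[where \<eta> = \<eta> and h = h and v = N,
            folded U0_def, folded U0'_def, OF h_eq Z Z' folY s \<eta>(1,5) contY _ _ _ _ _ has_leaves_mono[OF leavesY \<eta>(4)] conth h_sgn \<phi>(1) _ p(1) side])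
        show "sgn (Y q $ 1) = sgn (N $ 1)" if "q \<in> square e" for q
          using sgnY[OF that] N by simp
        show "N $ 1 \<noteq> 0" by (rule nz)
        show "sgn (N $ 2) = \<epsilon> * sgn (N $ 1)"
          using \<epsilon>_sgn by (simp add: N Y_sgn)
        show "cell_field ?Z q = Y q" "cell_field ?Z' q = N" if "s1 * q $ 1 > 0" "s2 * q $ 2 > 0" for q
          using cell_field_quadrant[OF that] False by simp_all
        show "H x y = (y - \<phi> (level YY x y)) / (N $ 2 / N $ 1)" if "s1 * x > 0" "s2 * y > 0" for x y
          using \<phi>(2)[OF that] False by simp
      qed
    qed
  next
    case False
    then obtain j where j: "p $ other j = 0" "p $ j \<noteq> 0"
      using p(2) unfolding plane_eq_0_iff by (metis other_simps)
    let ?i = "other j"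
    define g' where "g' = sliding_field ?Z' ?i 0 $ j"
    have g'_sgn: "sgn g' = (if ?i = 1 then - 1 else 1) * sgn (det_pw ?Z 0) * sgn (Y 0 $ ?i)"
      using sgn_sliding_field[of ?Z' 0 ?i] oppZ'[of ?i] N PN by (simp add: g'_def det_pw_def)
    show ?thesis
    proof (rule half_axis_orbits_matched[where \<eta> = \<eta> and h = h,
          folded U0_def, folded U0'_def, OF Z Z' \<eta>(1,5) conth h_sgn])
      show "h q $ j < h q' $ j" if "q $ ?i = 0" "q' $ ?i = 0" "q $ j < q' $ j" for q q'
        using that exhaust_2[of j] strict_mono_less[OF monoH] by (auto simp: h_def)
      show "continuous_on (square e) (\<lambda>p. sliding_field ?Z ?i p $ j)"
        using continuous_sliding_component[of "square e" ?Z ?i] contX contY oppZ by simp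
      show "sgn (sliding_field ?Z ?i q $ j) = sgn g'" if "q \<in> square e" for q
        using sgn_sliding_field[of ?Z q ?i] oppZ[OF that, of ?i] sgnD[OF that] sgnY[OF that, of ?i]
        by (simp add: g'_sgn)
      show "g' \<noteq> 0"
      proof -
        have "sgn g' \<noteq> 0"
          using det nz(2)[of ?i] by (simp add: g'_sgn sgn_zero_iff)
        then show ?thesis by (simp add: sgn_zero_iff)
      qed
      show "sliding_field ?Z' ?i q $ j = g'" for q
        by (simp add: g'_def sliding_field_def)
    qed (use p j in auto)
  qed
  have "maps_trajectories h ?Z U0 ?Z' U0'"
    by (rule maps_trajectories_by_complete_orbits[OF Z Z' h0 matched[unfolded orbits_matched_def]])
  moreover have "orientation_preserving_on U0 h"
    unfolding h_def by (rule horizontal_shear_orientation_preserving[OF contH' monoH])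
  moreover have "h ` Sigma_set U0 = Sigma_set U0'"
  proof -
    have "h p $ 1 * h p $ 2 = 0 \<longleftrightarrow> p $ 1 * p $ 2 = 0" for p
      using h_sgn[of p 1] h_sgn[of p 2] by (metis mult_eq_0_iff sgn_zero_iff)
    then show ?thesis
      by (auto simp: Sigma_set_def U0'_def)
  qed
  moreover have "?Z' \<in> Omega r U"
    by (simp add: Omega_def Ck_on_closed_const)
  ultimately show ?thesis
    unfolding locally_Sigma_equivalent_def using XY U0 openU0' k by blast
qed

text \<open>In each of the four cases of \<open>a * b\<close> and \<open>c\<close> the constant fields have the signs required by
  \<open>locally_equivalent_to_constant\<close>; the factor two on one component serves to give the determinant the
  sign \<open>c\<close>.\<close>

theorem proposition3p10:
  fixes r :: nat and U :: "(real^2) set" and X Y :: "real^2 \<Rightarrow> real^2" and a b c :: real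
  assumes "r \<ge> 1" and "open U" and "bounded U" and "0 \<in> U"
    and "(X, Y) \<in> Omega r U"
    and "\<forall>i::2. X 0 $ i * Y 0 $ i < 0"
    and "det_pw (X, Y) 0 \<noteq> 0"
    and "a = sgn (X 0 $ 1)" and "b = sgn (X 0 $ 2)" and "c = sgn (det_pw (X, Y) 0)"
  shows "locally_Sigma_equivalent r U (X, Y)
    ((\<lambda>p. vector [(kronecker (-1) (a * b) * kronecker 1 c + 1) * a,
                  - (kronecker (-1) (a * b) * kronecker (-1) c - a * b) * a]),
     (\<lambda>p. vector [- (kronecker 1 (a * b) * kronecker 1 c + 1) * a,
                  - (kronecker 1 (a * b) * kronecker (-1) c + a * b) * a]))"
    (is "locally_Sigma_equivalent r U _ (\<lambda>_. ?P, \<lambda>_. ?N)")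
proof (rule locally_equivalent_to_constant)
  have opp: "X 0 $ 1 * Y 0 $ 1 < 0" "X 0 $ 2 * Y 0 $ 2 < 0"
    using assms(6) by auto
  have Y: "sgn (Y 0 $ 1) = - a" "sgn (Y 0 $ 2) = - b"
    using opp by (auto simp: assms(8,9) sgn_real_def mult_less_0_iff)
  have a: "a = 1 \<or> a = - 1" and b: "b = 1 \<or> b = - 1" and c: "c = 1 \<or> c = - 1"
    using opp assms(7) by (auto simp: assms(8-10) sgn_real_def)
  have X: "sgn (X 0 $ 1) = a" "sgn (X 0 $ 2) = b" and D: "sgn (det_pw (X, Y) 0) = c"
    by (simp_all add: assms(8-10))
  show "sgn (?P $ i) = sgn (X 0 $ i)" for i
    using exhaust_2[of i] a b c X by (elim disjE) (simp_all add: kronecker_def)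
  show "sgn (?N $ i) = sgn (Y 0 $ i)" for i
    using exhaust_2[of i] a b c Y by (elim disjE) (simp_all add: kronecker_def)
  show "sgn (?P $ 1 * ?N $ 2 - ?P $ 2 * ?N $ 1) = sgn (det_pw (X, Y) 0)"
    using a b c D by (elim disjE) (simp_all add: kronecker_def)
qed (use assms in auto)

end
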